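(* Let $d\ge2$, let $\Omega\subset\mathbb R^d$ be a bounded domain, let $1\le k\le d$, let $S\subset\overline\Omega$ be a compact $(d-k)$-dimensional Lipschitz submanifold, let $0\le\gamma<k$ and $\mu_\Omega^*(x)=\mathrm{dist}(x,S)^\gamma$. Assume $q\in[2,\infty)$ and $\theta\in(0,1)$ are such that $1-\frac{d+\gamma}{2}\ge\theta-\frac dq$. Then one has the (continuous) embedding $$W^{1,2}(\mathbb R^d,\mu_\Omega^* )\subset W^{\theta,q}(\mathbb R^d).$$
   Context: For $1\le k\le d-1$, a set $S\subset\mathbb R^d$ is a $(d-k)$-dimensional Lipschitz submanifold if for all $x\in S$ there are an open neighbourhood $V$ of $x$ in $\mathbb R^d$ and a bi-Lipschitz map $\varphi$ from $V$ to $\mathbb R^d$ with $\varphi(S\cap V)=\,]0,1[^{d-k}\times\{0_{\mathbb R^k}\}$. A compact $0$-dimensional Lipschitz submanifold (case $k=d$) is a finite union of points. $W^{1,2}(\mathbb R^d,\mu_\Omega^* )$ is the weighted Sobolev space of functions $u\in L^2(\mathbb R^d)$ with weak gradient satisfying $\int_{\mathbb R^d}|\nabla u|^2\mu_\Omega^*\,dx<\infty$, with norm $\|u\|_{W^{1,2}(\mathbb R^d,\mu_\Omega^* )}^2=\|u\|_{L^2(\mathbb R^d)}^2+\int_{\mathbb R^d}|\nabla u|^2\mu_\Omega^*\,dx$ (the weight appears only in the gradient term). $W^{\theta,q}(\mathbb R^d)$ is the usual (unweighted) Slobodetskii space. *)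

theory Defs
  imports "HOL-Analysis.Analysis"
begin

section \<open>Lipschitz submanifolds and the weight\<close>

definition bi_lipschitz_on :: "'a::metric_space set \<Rightarrow> ('a \<Rightarrow> 'b::metric_space) \<Rightarrow> bool" where
  "bi_lipschitz_on V \<phi> \<longleftrightarrow>
     (\<exists>L. L-lipschitz_on V \<phi> \<and> (\<forall>x\<in>V. \<forall>y\<in>V. dist x y \<le> L * dist (\<phi> x) (\<phi> y)))"

text \<open>
  For \<open>card I = m\<close> this is \<open>]0,1[\<^sup>m \<times> {0}\<close>, where the coordinates with index in \<open>I\<close> play the role
  of the first \<open>m\<close> ones (a finite index type carries no canonical order).
\<close>

definition coordinate_cube :: "'n::finite set \<Rightarrow> (real^'n) set" where
  "coordinate_cube I = {y. (\<forall>i\<in>I. 0 < y $ i \<and> y $ i < 1) \<and> (\<forall>i\<in>- I. y $ i = 0)}"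

text \<open>
  The parameter \<open>k\<close> is the codimension. Codimension \<open>d\<close> is treated separately, by convention:
  a compact submanifold of dimension 0 is a finite set of points.
\<close>

definition compact_lipschitz_submanifold :: "nat \<Rightarrow> (real^'n::finite) set \<Rightarrow> bool" where
  "compact_lipschitz_submanifold k S \<longleftrightarrow>
     (if k = CARD('n) then finite S
      else compact S \<and>
           (\<forall>x\<in>S. \<exists>V (\<phi> :: real^'n \<Rightarrow> real^'n) I.
              open V \<and> x \<in> V \<and> bi_lipschitz_on V \<phi> \<and>
              card I = CARD('n) - k \<and> \<phi> ` (S \<inter> V) = coordinate_cube I))"

text \<open>The case \<open>\<gamma> = 0\<close> is singled out because \<open>0 powr 0 = 0\<close>.\<close>

definition dist_weight :: "(real^'n::finite) set \<Rightarrow> real \<Rightarrow> real^'n \<Rightarrow> real" where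
  "dist_weight S \<gamma> x = (if \<gamma> = 0 then 1 else infdist x S powr \<gamma>)"


section \<open>Weak gradients\<close>

definition partial_deriv :: "'n::finite \<Rightarrow> (real^'n \<Rightarrow> real) \<Rightarrow> real^'n \<Rightarrow> real" where
  "partial_deriv i f x = frechet_derivative f (at x) (axis i 1)"

fun continuously_differentiable :: "nat \<Rightarrow> (real^'n::finite \<Rightarrow> real) \<Rightarrow> bool" where
  "continuously_differentiable 0 f \<longleftrightarrow> continuous_on UNIV f"
| "continuously_differentiable (Suc m) f \<longleftrightarrow>
     f differentiable_on UNIV \<and> (\<forall>i. continuously_differentiable m (partial_deriv i f))"

definition test_functions :: "(real^'n::finite \<Rightarrow> real) set" where
  "test_functions =
     {\<phi>. (\<forall>m. continuously_differentiable m \<phi>) \<and> compact (closure {x. \<phi> x \<noteq> 0})}"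

definition locally_integrable :: "('a::euclidean_space \<Rightarrow> 'b::euclidean_space) \<Rightarrow> bool" where
  "locally_integrable f \<longleftrightarrow> (\<forall>K. compact K \<longrightarrow> f absolutely_integrable_on K)"

definition has_weak_gradient ::
    "(real^'n::finite \<Rightarrow> real) \<Rightarrow> (real^'n \<Rightarrow> real^'n) \<Rightarrow> bool" where
  "has_weak_gradient u g \<longleftrightarrow>
     locally_integrable u \<and> locally_integrable g \<and>
     (\<forall>\<phi>\<in>test_functions. \<forall>i.
        (LINT x|lebesgue. u x * partial_deriv i \<phi> x) = - (LINT x|lebesgue. g x $ i * \<phi> x))"

text \<open>Weak gradients are unique up to null sets, so the chosen representative is immaterial below.\<close>

definition weak_gradient :: "(real^'n::finite \<Rightarrow> real) \<Rightarrow> real^'n \<Rightarrow> real^'n" where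
  "weak_gradient u = (SOME g. has_weak_gradient u g)"


section \<open>Function spaces\<close>

text \<open>
  Spaces consist of functions rather than of classes modulo null sets; all norms are invariant
  under changes on null sets. They are obtained from \<open>[0,\<infinity>]\<close>-valued integrals, which are finite
  for members of the respective space.
\<close>

definition Lp_integral :: "real \<Rightarrow> (real^'n::finite \<Rightarrow> real) \<Rightarrow> ennreal" where
  "Lp_integral p u = (\<integral>\<^sup>+ x. ennreal (\<bar>u x\<bar> powr p) \<partial>lebesgue)"

definition Lp_space :: "real \<Rightarrow> (real^'n::finite \<Rightarrow> real) set" where
  "Lp_space p = {u \<in> borel_measurable lebesgue. Lp_integral p u < \<infinity>}"

definition weighted_dirichlet_integral ::
    "(real^'n::finite \<Rightarrow> real) \<Rightarrow> (real^'n \<Rightarrow> real) \<Rightarrow> ennreal" where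
  "weighted_dirichlet_integral w u =
     (\<integral>\<^sup>+ x. ennreal ((norm (weak_gradient u x))\<^sup>2 * w x) \<partial>lebesgue)"

definition weighted_W12_space :: "(real^'n::finite \<Rightarrow> real) \<Rightarrow> (real^'n \<Rightarrow> real) set" where
  "weighted_W12_space w =
     {u \<in> Lp_space 2. (\<exists>g. has_weak_gradient u g) \<and> weighted_dirichlet_integral w u < \<infinity>}"

definition weighted_W12_norm :: "(real^'n::finite \<Rightarrow> real) \<Rightarrow> (real^'n \<Rightarrow> real) \<Rightarrow> real" where
  "weighted_W12_norm w u = sqrt (enn2real (Lp_integral 2 u + weighted_dirichlet_integral w u))"

definition slobodetskii_integral ::
    "real \<Rightarrow> real \<Rightarrow> (real^'n::finite \<Rightarrow> real) \<Rightarrow> ennreal" where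
  "slobodetskii_integral \<theta> q u =
     (\<integral>\<^sup>+ x. (\<integral>\<^sup>+ y. ennreal (\<bar>u x - u y\<bar> powr q / norm (x - y) powr (real CARD('n) + \<theta> * q))
        \<partial>lebesgue) \<partial>lebesgue)"

definition slobodetskii_space :: "real \<Rightarrow> real \<Rightarrow> (real^'n::finite \<Rightarrow> real) set" where
  "slobodetskii_space \<theta> q = {u \<in> Lp_space q. slobodetskii_integral \<theta> q u < \<infinity>}"

definition slobodetskii_norm :: "real \<Rightarrow> real \<Rightarrow> (real^'n::finite \<Rightarrow> real) \<Rightarrow> real" where
  "slobodetskii_norm \<theta> q u = enn2real (Lp_integral q u + slobodetskii_integral \<theta> q u) powr (1 / q)"

end

theory Submission
  imports Defs
begin

text \<open>
  Let \<open>f = \<bar>\<nabla>u\<bar>\<close>, let \<open>A\<^sub>i f(x)\<close> be the average of \<open>f\<close> over the ball of radius \<open>r\<^sub>i = 2\<^sup>-\<^sup>i\<close> about \<open>x\<close>, and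
  let \<open>\<delta> = dist(\<cdot>, S)\<close>.
  Testing the weak gradient against translated bump functions shows that, for every \<open>h\<close> and almost every \<open>x\<close>,
  \<open>u(x + h) - u(x)\<close> is the integral of \<open>\<nabla>u \<bullet> h\<close> along the segment. Averaging over \<open>h\<close> bounds the mean oscillation
  of \<open>u\<close> on a ball of radius \<open>r\<^sub>j\<close> by \<open>\<Sum>\<^sub>i\<^sub>\<ge>\<^sub>j r\<^sub>i A\<^sub>i f\<close>, and two points at distance less than \<open>r\<^sub>j\<close> are compared
  through these oscillations. Since \<open>\<theta> > 0\<close>, the part of the Slobodetskii integral near the diagonal is thereby
  controlled by the energy \<open>\<Sum>\<^sub>i r\<^sub>i\<^bsup>q(1 - \<theta>)\<^esup> \<integral> (A\<^sub>i f)\<^sup>q\<close>; the part far from it is controlled by the \<open>L\<^sup>q\<close> norm,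
  which is estimated in the same way.

  The geometry of \<open>S\<close> enters only through \<open>\<integral>\<^bsub>B(x,r)\<^esub> \<delta>\<^sup>-\<^sup>s \<le> C r\<^bsup>d - s\<^esup>\<close> for \<open>0 \<le> s < k\<close> and small \<open>r\<close>, which follows
  from covering \<open>S\<close> by small balls in bi-Lipschitz charts. By Cauchy--Schwarz,
  \<open>(A\<^sub>i f)\<^sup>2 \<le> C r\<^sub>i\<^bsup>- d - \<gamma>\<^esup> \<integral> f\<^sup>2 \<delta>\<^sup>\<gamma>\<close>. Applying this to \<open>q - 2\<close> of the \<open>q\<close> factors, the condition on the exponents
  reduces the energy to \<open>\<Sum>\<^sub>i r\<^sub>i\<^sup>\<gamma> \<integral> (A\<^sub>i f)\<^sup>2\<close>, which for \<open>\<gamma> > 0\<close> is bounded by \<open>\<integral> f\<^sup>2 \<delta>\<^sup>\<gamma>\<close> by a Schur test.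
  For \<open>\<gamma> = 0\<close> this last sum diverges; there one has either \<open>q = 2\<close>, where \<open>\<theta> < 1\<close> leaves room for convergence, or
  \<open>q > 2\<close>, where \<open>f\<close> is truncated at a level depending on the scale.
\<close>

section \<open>Smooth bump functions supported in boxes\<close>

text \<open>Multiplied by q, the hypothesis on the exponents reads q (1 - \<theta>) - (d + \<gamma>)
  (q - 2) / 2 \<ge> \<gamma>, with equality allowed. So after the pointwise bound has been spent on
  q - 2 factors there may be exactly r_i^\<gamma> left, and the sum over i has to converge for a
  reason other than a surplus power of r_i. For \<gamma> > 0 that reason is the distance function:
  at a point y the scales below \<delta>(y) form a geometric series with ratio 2^-\<gamma>, and the
  scales above it are summed with the stronger weight exponent \<gamma> + b, which is still
  integrable because \<gamma> < k leaves room for b > 0. For \<gamma> = 0 the former series has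
  constant terms. The estimates for the weight hold only at radii up to some r0 depending on S, so
  every energy starts at an index i0. The value of \<theta> is spent in halves: one half pays for
  passing from a sum over scales to a sum of q-th powers, the other for resumming the resulting
  double series. The difference formula is obtained by shifting test functions, so u is never
  approximated by smooth functions.\<close>

definition bump_atom :: "real \<Rightarrow> real \<Rightarrow> real \<Rightarrow> real poly \<Rightarrow> nat \<Rightarrow> real \<Rightarrow> real" where
  "bump_atom c a b p n t =
     (if a < t \<and> t < b then poly p t * exp (- c / ((t - a) * (b - t))) / ((t - a) * (b - t)) ^ n else 0)"

text \<open>With \<open>w = (t - a) (b - t)\<close>, differentiating \<open>p w\<^sup>-\<^sup>n exp (- c / w)\<close> yields another atom with
  exponent \<open>n + 2\<close>; this is its polynomial factor.\<close>

definition bump_deriv :: "real \<Rightarrow> real \<Rightarrow> real \<Rightarrow> real poly \<Rightarrow> nat \<Rightarrow> real poly" where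
  "bump_deriv c a b p n =
     (let w = [:- a, 1:] * [:b, -1:]; w' = [:a + b, -2:]
      in pderiv p * w\<^sup>2 - smult (real n) (p * w' * w) + smult c (p * w'))"

lemma poly_bump_deriv:
  "poly (bump_deriv c a b p n) t =
     poly (pderiv p) t * ((t - a) * (b - t))\<^sup>2
     - real n * (poly p t * (a + b - 2 * t) * ((t - a) * (b - t))) + c * (poly p t * (a + b - 2 * t))"
  by (simp add: bump_deriv_def Let_def algebra_simps power2_eq_square)

text \<open>A single term of the exponential series of c / w suffices. Near the ends of the interval
  the exponential thus beats every power of w.\<close>

lemma exp_minus_inverse_le:
  fixes c w :: real
  assumes "c > 0" "w > 0"
  shows "exp (- c / w) \<le> fact m / c ^ m * w ^ m"
proof -
  have "(c / w) ^ m / fact m \<le> exp (c / w)"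
    using sum_le_suminf[OF summable_exp[of "c / w"], of "{m}"] assms
    by (simp add: exp_def divide_inverse mult_ac)
  then have "(c / w) ^ m \<le> exp (c / w) * fact m"
    by (simp only: pos_divide_le_eq fact_gt_zero)
  then have "c ^ m / w ^ m \<le> fact m * exp (c / w)"
    by (simp only: power_divide mult.commute)
  then have "exp (- c / w) * (c ^ m / w ^ m) \<le> exp (- c / w) * (fact m * exp (c / w))"
    by (intro mult_left_mono) auto
  also have "\<dots> = fact m" by (simp add: exp_minus)
  finally show ?thesis using assms by (simp add: field_simps)
qed

text \<open>With m = n + 2 the negative power of w is absorbed and a factor w squared remains: a
  double zero at both ends, which makes the pieces fit together differentiably.\<close>

lemma bump_atom_bound:
  assumes "c > 0"
  shows "\<bar>bump_atom c a b p n s\<bar> \<le> \<bar>poly p s\<bar> * (fact (n + 2) / c ^ (n + 2)) * ((s - a) * (b - s))\<^sup>2"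
proof (cases "a < s \<and> s < b")
  case True
  let ?w = "(s - a) * (b - s)"
  have w: "?w > 0" using True by simp
  have "\<bar>bump_atom c a b p n s\<bar> = \<bar>poly p s\<bar> * exp (- c / ?w) / ?w ^ n"
    using True w by (simp add: bump_atom_def abs_mult)
  also have "\<dots> \<le> \<bar>poly p s\<bar> * (fact (n + 2) / c ^ (n + 2) * ?w ^ (n + 2)) / ?w ^ n"
    using w by (intro divide_right_mono mult_left_mono exp_minus_inverse_le assms) auto
  also have "\<dots> = \<bar>poly p s\<bar> * (fact (n + 2) / c ^ (n + 2)) * ?w\<^sup>2"
    using less_imp_neq[OF w] by (simp only: power_add) simp
  finally show ?thesis .
next
  case False
  then show ?thesis using assms by (auto simp: bump_atom_def)
qed

lemma bump_atom_deriv_edge: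
  assumes c: "c > 0" and t: "t = a \<or> t = b"
  shows "(bump_atom c a b p n has_real_derivative 0) (at t)"
proof -
  let ?M = "fact (n + 2) / c ^ (n + 2) :: real"
  \<comment> \<open>\<open>a + b - t\<close> is the endpoint other than \<open>t\<close>. The
    squared product contains the factor |s - t| twice: the difference quotient uses one, the other
    sends \<open>K\<close> to 0.\<close>
  define K where "K s = \<bar>poly p s\<bar> * ?M * ((s - (a + b - t))\<^sup>2) * \<bar>s - t\<bar>" for s
  have "(K \<longlongrightarrow> K t) (at t)"
    unfolding K_def by (intro tendsto_intros)
  then have K: "(K \<longlongrightarrow> 0) (at t)" by (simp add: K_def)
  have E0: "bump_atom c a b p n t = 0" using t by (auto simp: bump_atom_def)
  have "((\<lambda>s. (bump_atom c a b p n s - bump_atom c a b p n t) / (s - t)) \<longlongrightarrow> 0) (at t)"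
  proof (rule Lim_null_comparison[OF _ K], rule eventually_at_filter[THEN iffD2], intro always_eventually allI impI)
    fix s assume s: "s \<noteq> t"
    have "\<bar>bump_atom c a b p n s\<bar> \<le> \<bar>poly p s\<bar> * ?M * ((s - a) * (b - s))\<^sup>2"
      by (rule bump_atom_bound[OF c])
    also have "((s - a) * (b - s))\<^sup>2 = (s - (a + b - t))\<^sup>2 * (\<bar>s - t\<bar> * \<bar>s - t\<bar>)"
      using t by (auto simp: power2_eq_square algebra_simps simp flip: abs_mult)
    finally show "norm ((bump_atom c a b p n s - bump_atom c a b p n t) / (s - t)) \<le> K s"
      using s by (simp add: E0 K_def divide_le_eq mult_ac)
  qed
  then show ?thesis by (simp add: has_field_derivative_iff)
qed

text \<open>Atoms are closed under differentiation, also at the two ends. This is why the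
  exponential is carried together with an arbitrary polynomial and an arbitrary negative power:
  smoothness becomes an induction on the order.\<close>

lemma bump_atom_has_derivative:
  assumes c: "c > 0"
  shows "(bump_atom c a b p n has_real_derivative bump_atom c a b (bump_deriv c a b p n) (n + 2) t) (at t)"
proof -
  consider "a < t \<and> t < b" | "t = a \<or> t = b" | "t < a \<or> b < t" by linarith
  then show ?thesis
  proof cases
    case 1
    let ?w = "\<lambda>t. (t - a) * (b - t)"
    have w: "?w t > 0" using 1 by simp
    have "((\<lambda>t. poly p t * exp (- c / ?w t) / ?w t ^ n) has_real_derivative
        bump_atom c a b (bump_deriv c a b p n) (n + 2) t) (at t)"
    proof -
      have dw: "(?w has_real_derivative (a + b - 2 * t)) (at t)"
        by (auto intro!: derivative_eq_intros simp: algebra_simps)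
      have de: "((\<lambda>t. exp (- c / ?w t)) has_real_derivative exp (- c / ?w t) * (c * (a + b - 2 * t) / (?w t)\<^sup>2)) (at t)"
        by (rule derivative_eq_intros dw refl)+ (use w 1 in \<open>auto simp: power2_eq_square\<close>)
      have dp: "((\<lambda>t. ?w t ^ n) has_real_derivative real n * ?w t ^ (n - 1) * (a + b - 2 * t)) (at t)"
        by (rule derivative_eq_intros dw refl)+ (auto simp: mult_ac)
      \<comment> \<open>Avoids the truncated exponent \<open>n - 1\<close>; for \<open>n = 0\<close>
        both sides are 0.\<close>
      have dn: "real n * ?w t ^ (n - 1) = real n * ?w t ^ n / ?w t"
        using w by (cases n) auto
      have w0: "?w t ^ n \<noteq> 0" using w by (metis less_irrefl power_not_zero)
      have "((\<lambda>t. poly p t * exp (- c / ?w t) / ?w t ^ n) has_real_derivative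
         ((poly (pderiv p) t * exp (- c / ?w t) + exp (- c / ?w t) * (c * (a + b - 2 * t) / (?w t)\<^sup>2) * poly p t) * ?w t ^ n
          - poly p t * exp (- c / ?w t) * (real n * ?w t ^ (n - 1) * (a + b - 2 * t))) / (?w t ^ n * ?w t ^ n)) (at t)"
        by (rule DERIV_divide[OF DERIV_mult[OF poly_DERIV de] dp w0])
      also have "((poly (pderiv p) t * exp (- c / ?w t) + exp (- c / ?w t) * (c * (a + b - 2 * t) / (?w t)\<^sup>2) * poly p t) * ?w t ^ n
          - poly p t * exp (- c / ?w t) * (real n * ?w t ^ (n - 1) * (a + b - 2 * t))) / (?w t ^ n * ?w t ^ n)
        = bump_atom c a b (bump_deriv c a b p n) (n + 2) t"
      proof -
        \<comment> \<open>The exponential, the power and w are made opaque, so that only an identity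
          between rational functions is left.\<close>
        obtain W where W: "W = ?w t" by simp
        obtain e where e: "e = exp (- c / W)" by simp
        obtain V where V: "V = a + b - 2 * t" by simp
        obtain X where X: "X = W ^ n" by simp
        have "W \<noteq> 0" "X \<noteq> 0" using w W X by auto
        have dn': "real n * W ^ (n - 1) = real n * X / W" using dn by (simp only: X W)
        have "((poly (pderiv p) t * e + e * (c * V / W\<^sup>2) * poly p t) * X
          - poly p t * e * (real n * X / W * V)) / (X * X) =
          (poly (pderiv p) t * W\<^sup>2 - real n * (poly p t * V * W) + c * (poly p t * V)) * e / (X * W\<^sup>2)"
          using \<open>W \<noteq> 0\<close> \<open>X \<noteq> 0\<close> by (simp add: field_simps power2_eq_square)
        then show ?thesis using 1 dn'
          by (simp only: bump_atom_def poly_bump_deriv if_True power_add simp_thms flip: V W X e)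
      qed
      finally show ?thesis .
    qed
    then show ?thesis
      by (rule has_field_derivative_transform_within_open[where S="{a<..<b}"])
         (use 1 in \<open>auto simp: bump_atom_def\<close>)
  next
    case 2
    then show ?thesis using bump_atom_deriv_edge[OF c 2, of p n] by (auto simp: bump_atom_def)
  next
    case 3
    have "((\<lambda>_. 0) has_real_derivative 0) (at t)" by simp
    then have "(bump_atom c a b p n has_real_derivative 0) (at t)"
      by (rule has_field_derivative_transform_within_open[where S="{..<a} \<union> {b<..}"])
         (use 3 in \<open>auto simp: bump_atom_def\<close>)
    then show ?thesis using 3 by (auto simp: bump_atom_def)
  qed
qed

text \<open>Polynomial and exponent depend on the coordinate because a partial derivative changes
  them in one coordinate only.\<close>

definition prod_bump ::
    "real \<Rightarrow> real^'n \<Rightarrow> real^'n \<Rightarrow> ('n \<Rightarrow> real poly) \<Rightarrow> ('n \<Rightarrow> nat) \<Rightarrow> real^'n::finite \<Rightarrow> real" where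
  "prod_bump c a b p n x = (\<Prod>i\<in>UNIV. bump_atom c (a $ i) (b $ i) (p i) (n i) (x $ i))"

lemma prod_bump_has_derivative:
  assumes c: "c > 0"
  shows "(prod_bump c a b p n has_derivative
     (\<lambda>h. \<Sum>i\<in>UNIV. h $ i * prod_bump c a b (p(i := bump_deriv c (a $ i) (b $ i) (p i) (n i))) (n(i := n i + 2)) x)) (at x)"
proof -
  let ?B = "\<lambda>i x. bump_atom c (a $ i) (b $ i) (p i) (n i) (x $ i)"
  let ?D = "\<lambda>i. bump_atom c (a $ i) (b $ i) (bump_deriv c (a $ i) (b $ i) (p i) (n i)) (n i + 2) (x $ i)"
  have d: "(?B i has_derivative (\<lambda>h. ?D i * h $ i)) (at x)" for i
  proof -
    have "(bump_atom c (a $ i) (b $ i) (p i) (n i) has_derivative (*) (?D i)) (at (x $ i))"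
      using bump_atom_has_derivative[OF c] by (simp add: has_field_derivative_def)
    from has_derivative_compose[OF bounded_linear_imp_has_derivative[OF bounded_linear_vec_nth] this]
    show ?thesis .
  qed
  have "((\<lambda>x. \<Prod>i\<in>UNIV. ?B i x) has_derivative
       (\<lambda>h. \<Sum>i\<in>UNIV. (?D i * h $ i) * (\<Prod>j\<in>UNIV - {i}. ?B j x))) (at x)"
    by (rule has_derivative_prod) (rule d)
  moreover have "(?D i * h $ i) * (\<Prod>j\<in>UNIV - {i}. ?B j x) =
     h $ i * prod_bump c a b (p(i := bump_deriv c (a $ i) (b $ i) (p i) (n i))) (n(i := n i + 2)) x" for h i
    unfolding prod_bump_def by (subst prod.remove[of UNIV i]) (auto simp: mult_ac intro!: prod.cong)
  ultimately show ?thesis by (simp only:) (simp only: prod_bump_def[abs_def])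
qed

lemma partial_deriv_prod_bump:
  assumes c: "c > 0"
  shows "partial_deriv i (prod_bump c a b p n) =
     prod_bump c a b (p(i := bump_deriv c (a $ i) (b $ i) (p i) (n i))) (n(i := n i + 2))"
proof
  fix x
  show "partial_deriv i (prod_bump c a b p n) x =
     prod_bump c a b (p(i := bump_deriv c (a $ i) (b $ i) (p i) (n i))) (n(i := n i + 2)) x"
    using frechet_derivative_at[OF prod_bump_has_derivative[OF c, of a b p n x], symmetric]
    by (simp add: partial_deriv_def axis_def of_bool_def[symmetric] flip: sum.delta)
qed

lemma prod_bump_smooth:
  assumes c: "c > 0"
  shows "continuously_differentiable m (prod_bump c a b p n)"
proof (induction m arbitrary: p n)
  case 0
  have "continuous (at x) (prod_bump c a b p n)" for x
    using prod_bump_has_derivative[OF c] has_derivative_continuous by blast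
  then show ?case by (simp add: continuous_on_eq_continuous_at)
next
  case (Suc m)
  then show ?case
    using prod_bump_has_derivative[OF c]
    by (auto simp: partial_deriv_prod_bump[OF c] differentiable_on_def intro!: differentiableI)
qed

lemma prod_bump_eq_0: "x \<notin> box a b \<Longrightarrow> prod_bump c a b p n x = 0"
  by (auto simp: prod_bump_def bump_atom_def mem_box_cart)

lemma continuous_on_prod_bump: "c > 0 \<Longrightarrow> continuous_on A (prod_bump c a b p n)"
  using prod_bump_smooth[of c 0 a b p n] continuous_on_subset by auto

lemma prod_bump_test_function:
  assumes c: "c > 0"
  shows "prod_bump c a b p n \<in> test_functions"
proof -
  have "{x. prod_bump c a b p n x \<noteq> 0} \<subseteq> cbox a b"
    using prod_bump_eq_0 box_subset_cbox by blast
  then have "compact (closure {x. prod_bump c a b p n x \<noteq> 0})"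
    by (meson bounded_cbox bounded_subset compact_closure)
  then show ?thesis using prod_bump_smooth[OF c] by (auto simp: test_functions_def)
qed

text \<open>Left unnormalised: as \<open>c\<close> decreases to 0 these functions increase to the
  indicator of the box, and this is how test functions reach boxes.\<close>

definition box_bump :: "real \<Rightarrow> real^'n \<Rightarrow> real^'n \<Rightarrow> real^'n::finite \<Rightarrow> real" where
  "box_bump c a b = prod_bump c a b (\<lambda>_. 1) (\<lambda>_. 0)"

lemma box_bump_bounds:
  assumes "c > 0" shows "0 \<le> box_bump c a b x" "box_bump c a b x \<le> indicator (box a b) x"
proof -
  have atom: "0 \<le> bump_atom c a b 1 0 t \<and> bump_atom c a b 1 0 t \<le> 1" for a b t :: real
    using assms by (auto simp: bump_atom_def)
  show "0 \<le> box_bump c a b x" by (auto simp: box_bump_def prod_bump_def atom intro!: prod_nonneg)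
  have "box_bump c a b x \<le> 1" by (auto simp: box_bump_def prod_bump_def atom intro!: prod_le_1)
  then show "box_bump c a b x \<le> indicator (box a b) x"
    using prod_bump_eq_0[of x a b c] by (cases "x \<in> box a b") (auto simp: box_bump_def)
qed

lemma box_bump_tendsto:
  "(\<lambda>n. box_bump (1 / Suc n) a b x) \<longlonglongrightarrow> indicator (box a b) x"
proof (cases "x \<in> box a b")
  case True
  have "(\<lambda>n. bump_atom (1 / Suc n) (a $ i) (b $ i) 1 0 (x $ i)) \<longlonglongrightarrow> 1" for i
  proof -
    have i: "a $ i < x $ i" "x $ i < b $ i" using True by (auto simp: mem_box_cart)
    have "(\<lambda>n. exp (- (1 / real (Suc n)) / ((x $ i - a $ i) * (b $ i - x $ i)))) \<longlonglongrightarrow> exp (- 0 / ((x $ i - a $ i) * (b $ i - x $ i)))"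
      by (intro tendsto_intros LIMSEQ_Suc lim_1_over_n) (use i in auto)
    then show ?thesis using i by (simp add: bump_atom_def)
  qed
  then have "(\<lambda>n. \<Prod>i\<in>UNIV. bump_atom (1 / Suc n) (a $ i) (b $ i) 1 0 (x $ i)) \<longlonglongrightarrow> (\<Prod>i\<in>(UNIV::'a set). 1)"
    by (intro tendsto_prod)
  then show ?thesis using True by (simp add: box_bump_def prod_bump_def)
next
  case False
  then show ?thesis by (simp add: box_bump_def prod_bump_eq_0)
qed

lemma box_bump_translate: "box_bump c a b (x - v) = box_bump c (a + v) (b + v) x"
  by (auto simp: box_bump_def prod_bump_def bump_atom_def algebra_simps intro!: prod.cong)

text \<open>The translate of a box bump is the bump of the translated box. Hence the weak gradient
  can be tested against translates without leaving this explicit family.\<close>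

lemma partial_deriv_box_bump_translate:
  assumes "c > 0"
  shows "partial_deriv i (box_bump c a b) (x - v) = partial_deriv i (box_bump c (a + v) (b + v)) x"
  unfolding box_bump_def partial_deriv_prod_bump[OF assms]
  by (auto simp: prod_bump_def bump_atom_def bump_deriv_def Let_def algebra_simps intro!: prod.cong)

section \<open>Vanishing almost everywhere from integrals against boxes and bumps\<close>

lemma Int_stable_box: "Int_stable (range (\<lambda>(a, b). box a b :: 'a::euclidean_space set))"
  by (auto simp: Int_stable_def box_Int_box)

text \<open>Boxes are stable under intersection and generate the Borel sets, so the \<pi>-\<lambda>
  theorem extends the vanishing of the integral to all Borel sets. As \<open>F\<close> is integrable
  only over bounded boxes, this is done inside each window \<open>Q n\<close>.\<close>

lemma AE_zero_if_box_integrals_zero: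
  fixes F :: "'a::euclidean_space \<Rightarrow> real"
  assumes int: "\<And>a b. set_integrable lborel (box a b) F"
    and zero: "\<And>a b. (LINT x:box a b|lborel. F x) = 0"
  shows "AE x in lborel. F x = 0"
proof -
  define Q where "Q n = box (- (real n *\<^sub>R One)) (real n *\<^sub>R One :: 'a)" for n :: nat
  have Q: "AE x in lborel. indicator (Q n) x * F x = 0" for n
  proof (rule density_unique_real[of lborel _ "\<lambda>_. 0", simplified set_lebesgue_integral_def[of _ _ "\<lambda>_. 0"], simplified])
    show F: "integrable lborel (\<lambda>x. indicator (Q n) x * F x)"
      using int by (simp add: Q_def set_integrable_def)
    let ?G = "\<lambda>x. indicator (Q n) x * F x"
    have I: "integrable lborel (\<lambda>x. indicator A x *\<^sub>R ?G x)" if "A \<in> sets borel" for A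
      using integrable_mult_indicator[OF _ F] that by simp
    fix A :: "'a set" assume "A \<in> sets borel"
    then have "A \<in> sigma_sets UNIV (range (\<lambda>(a, b). box a b))"
      by (simp add: borel_eq_box)
    then show "set_lebesgue_integral lborel A ?G = 0"
    proof (rule sigma_sets_induct_disjoint[OF Int_stable_box _ _, where A=A and \<Omega>=UNIV and
          P="\<lambda>A. set_lebesgue_integral lborel A ?G = 0", rotated])
      fix A :: "'a set" assume "A \<in> range (\<lambda>(a, b). box a b)"
      then obtain a b where A: "A \<inter> Q n = box a b" by (auto simp: Q_def box_Int_box)
      have "set_lebesgue_integral lborel A ?G = (LINT x:A \<inter> Q n|lborel. F x)"
        by (auto simp: set_lebesgue_integral_def indicator_def intro!: Bochner_Integration.integral_cong)
      then show "set_lebesgue_integral lborel A ?G = 0" by (simp add: A zero)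
    next
      fix A :: "'a set"
      assume A: "A \<in> sigma_sets UNIV (range (\<lambda>(a, b). box a b))" and 0: "set_lebesgue_integral lborel A ?G = 0"
      then have A: "A \<in> sets borel" by (simp add: borel_eq_box)
      have "?G x = indicator A x *\<^sub>R ?G x + indicator (UNIV - A) x *\<^sub>R ?G x" for x
        by (auto simp: indicator_def)
      then have "(LINT x|lborel. ?G x) = set_lebesgue_integral lborel A ?G + set_lebesgue_integral lborel (UNIV - A) ?G"
        unfolding set_lebesgue_integral_def using A
        by (subst Bochner_Integration.integral_add[symmetric]) (auto intro!: I[simplified] Bochner_Integration.integral_cong)
      \<comment> \<open>The window is itself a box. Since the total integral is 0, the class of good
        sets is closed under complements.\<close>
      moreover have "(LINT x|lborel. ?G x) = 0"
        using zero by (simp add: Q_def set_lebesgue_integral_def)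
      ultimately show "set_lebesgue_integral lborel (UNIV - A) ?G = 0" using 0 by simp
    next
      fix A :: "nat \<Rightarrow> 'a set"
      assume dis: "disjoint_family A" and A: "range A \<subseteq> sigma_sets UNIV (range (\<lambda>(a, b). box a b))"
        and 0: "\<And>i. set_lebesgue_integral lborel (A i) ?G = 0"
      from A have A: "A i \<in> sets lborel" for i by (auto simp: borel_eq_box)
      have "set_lebesgue_integral lborel (\<Union>i. A i) ?G = (\<Sum>i. set_lebesgue_integral lborel (A i) ?G)"
      proof (rule lebesgue_integral_countable_add)
        show "set_integrable lborel (\<Union>i. A i) ?G"
          unfolding set_integrable_def using A by (intro I) auto
      qed (use A dis in \<open>auto simp: disjoint_family_on_def\<close>)
      then show "set_lebesgue_integral lborel (\<Union>i. A i) ?G = 0" by (simp add: 0)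
    qed (auto simp: set_lebesgue_integral_def)
  qed
  have "AE x in lborel. \<forall>n. indicator (Q n) x * F x = 0"
    unfolding AE_all_countable using Q by blast
  then show ?thesis
  proof eventually_elim
    case (elim x)
    have "x \<in> (\<Union>n. Q n)" unfolding Q_def using UN_box_eq_UNIV by auto
    then show ?case using elim by (auto simp: indicator_def split: if_splits)
  qed
qed

lemma box_bump_measurable [measurable]:
  assumes "c > 0" shows "box_bump c a b \<in> borel_measurable borel"
  using continuous_on_prod_bump[OF assms] by (auto simp: box_bump_def intro!: borel_measurable_continuous_onI)

lemma box_bump_integrable:
  fixes F :: "real^'n::finite \<Rightarrow> real"
  assumes "c > 0" and [measurable]: "F \<in> borel_measurable borel"
    and "set_integrable lborel (box a b) F"
  shows "integrable lborel (\<lambda>x. box_bump c a b x * F x)"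
proof (rule Bochner_Integration.integrable_bound)
  show "integrable lborel (\<lambda>x. indicator (box a b) x *\<^sub>R F x)"
    using assms by (simp add: set_integrable_def)
  have [measurable]: "box_bump c a b \<in> borel_measurable borel" using assms by simp
  show "(\<lambda>x. box_bump c a b x * F x) \<in> borel_measurable lborel" by simp
  show "AE x in lborel. norm (box_bump c a b x * F x) \<le> norm (indicator (box a b) x *\<^sub>R F x)"
    using box_bump_bounds[OF assms(1), of a b] by (auto simp: abs_mult intro!: mult_right_mono)
qed

text \<open>Let \<open>c\<close> run through 1 / (n + 1): the bumps converge to the indicator of the
  box and are dominated by it.\<close>

lemma AE_zero_if_bump_integrals_zero:
  fixes F :: "real^'n::finite \<Rightarrow> real"
  assumes [measurable]: "F \<in> borel_measurable borel"
    and int: "\<And>a b. set_integrable lborel (box a b) F"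
    and zero: "\<And>a b c. c > 0 \<Longrightarrow> (LINT x|lborel. box_bump c a b x * F x) = 0"
  shows "AE x in lborel. F x = 0"
proof (rule AE_zero_if_box_integrals_zero[OF int])
  fix a b :: "real^'n"
  have [measurable]: "box_bump (1 / real (Suc n)) a b \<in> borel_measurable borel" for n by simp
  have "(\<lambda>n. LINT x|lborel. box_bump (1 / Suc n) a b x * F x) \<longlonglongrightarrow> (LINT x|lborel. indicator (box a b) x * F x)"
  proof (rule integral_dominated_convergence[where w="\<lambda>x. norm (indicator (box a b) x * F x)"])
    show "integrable lborel (\<lambda>x. norm (indicator (box a b) x * F x))"
      using int[of a b] by (simp add: set_integrable_def)
    show "AE x in lborel. (\<lambda>n. box_bump (1 / Suc n) a b x * F x) \<longlonglongrightarrow> indicator (box a b) x * F x"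
      by (intro AE_I2 tendsto_intros box_bump_tendsto)
    show "AE x in lborel. norm (box_bump (1 / Suc n) a b x * F x) \<le> norm (indicator (box a b) x * F x)" for n
      using box_bump_bounds[of "1 / Suc n" a b] by (auto simp: abs_mult intro!: mult_right_mono)
  qed auto
  then show "(LINT x:box a b|lborel. F x) = 0"
    by (simp add: zero set_lebesgue_integral_def LIMSEQ_const_iff)
qed

section \<open>Weak gradients and differences\<close>

lemma nn_integral_translate:
  fixes f :: "'a::euclidean_space \<Rightarrow> ennreal"
  assumes [measurable]: "f \<in> borel_measurable borel"
  shows "(\<integral>\<^sup>+ x. f (x + h) \<partial>lborel) = (\<integral>\<^sup>+ x. f x \<partial>lborel)"
proof -
  have "(\<integral>\<^sup>+ x. f x \<partial>distr lborel borel ((+) h)) = (\<integral>\<^sup>+ x. f (x + h) \<partial>lborel)"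
    by (subst nn_integral_distr) (auto simp: add.commute)
  then show ?thesis by (simp add: lborel_distr_plus)
qed

lemma integral_translate:
  fixes f :: "'a::euclidean_space \<Rightarrow> real"
  assumes [measurable]: "f \<in> borel_measurable borel"
  shows "(LINT x|lborel. f (x + h)) = (LINT x|lborel. f x)"
proof -
  have "(LINT x|distr lborel borel ((+) h). f x) = (LINT x|lborel. f (x + h))"
    by (subst integral_distr) (auto simp: add.commute)
  then show ?thesis by (simp add: lborel_distr_plus)
qed

lemma integrable_translate:
  fixes f :: "'a::euclidean_space \<Rightarrow> real"
  assumes [measurable]: "f \<in> borel_measurable borel"
  shows "integrable lborel (\<lambda>x. f (x + h)) \<longleftrightarrow> integrable lborel f"
proof -
  have "integrable (distr lborel borel ((+) h)) f \<longleftrightarrow> integrable lborel (\<lambda>x. f (x + h))"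
    by (subst integrable_distr_eq) (auto simp: add.commute)
  then show ?thesis by (simp add: lborel_distr_plus)
qed

lemma partial_deriv_box_bump:
  assumes "c > 0"
  obtains p n where "partial_deriv i (box_bump c a b) = prod_bump c a b p n"
  unfolding box_bump_def partial_deriv_prod_bump[OF assms] by blast

lemma partial_deriv_box_bump_measurable:
  assumes "c > 0" shows "partial_deriv i (box_bump c a b) \<in> borel_measurable borel"
  using partial_deriv_box_bump[OF assms] continuous_on_prod_bump[OF assms]
  by (metis borel_measurable_continuous_onI)

lemma partial_deriv_box_bump_bounded:
  assumes c: "c > 0"
  obtains K where "\<And>x i. \<bar>partial_deriv i (box_bump c a b) x\<bar> \<le> K * indicator (box a b) x" "0 \<le> K"
proof -
  have "\<exists>K. \<forall>x. \<bar>partial_deriv i (box_bump c a b) x\<bar> \<le> K * indicator (box a b) x" for i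
  proof -
    obtain p n where eq: "partial_deriv i (box_bump c a b) = prod_bump c a b p n"
      using partial_deriv_box_bump[OF c] .
    have "compact (prod_bump c a b p n ` cbox a b)"
      by (intro compact_continuous_image continuous_on_prod_bump c compact_cbox)
    then obtain K where "\<forall>x\<in>cbox a b. \<bar>prod_bump c a b p n x\<bar> \<le> K"
      by (auto dest!: compact_imp_bounded simp: bounded_iff)
    then have "\<bar>partial_deriv i (box_bump c a b) x\<bar> \<le> K * indicator (box a b) x" for x
      using box_subset_cbox by (cases "x \<in> box a b") (auto simp: eq prod_bump_eq_0)
    then show ?thesis by blast
  qed
  then obtain K where K: "\<And>i x. \<bar>partial_deriv i (box_bump c a b) x\<bar> \<le> K i * indicator (box a b) x"
    by metis
  have "\<bar>partial_deriv i (box_bump c a b) x\<bar> \<le> (\<Sum>i\<in>UNIV. \<bar>K i\<bar>) * indicator (box a b) x" for i x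
  proof -
    have "K i \<le> (\<Sum>i\<in>UNIV. \<bar>K i\<bar>)"
      using member_le_sum[of i UNIV "\<lambda>i. \<bar>K i\<bar>"] by simp
    then show ?thesis using K[of i x] by (auto intro: order_trans mult_right_mono)
  qed
  then show thesis by (rule that) (simp add: sum_nonneg)
qed

text \<open>Fundamental theorem of calculus on the segment from \<open>x\<close> to
  \<open>x - h\<close>. The difference is taken of the smooth test function because \<open>u\<close>
  need not be differentiable.\<close>

lemma box_bump_ftc:
  assumes c: "c > 0"
  shows "(LINT t|lborel. - (\<Sum>i\<in>UNIV. h $ i * partial_deriv i (box_bump c a b) (x - t *\<^sub>R h)) * indicator {0..1} t)
      = box_bump c a b (x - h) - box_bump c a b x"
proof -
  let ?\<phi> = "box_bump c a b"
  have "((\<lambda>t. ?\<phi> (x - t *\<^sub>R h)) has_real_derivative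
      - (\<Sum>i\<in>UNIV. h $ i * partial_deriv i ?\<phi> (x - t *\<^sub>R h))) (at t)" for t
  proof -
    have l: "((\<lambda>t. x - t *\<^sub>R h) has_derivative (\<lambda>s. - (s *\<^sub>R h))) (at t)"
      by (auto intro!: derivative_eq_intros)
    have "(?\<phi> has_derivative (\<lambda>v. \<Sum>i\<in>UNIV. v $ i * partial_deriv i ?\<phi> (x - t *\<^sub>R h))) (at (x - t *\<^sub>R h))"
      using prod_bump_has_derivative[OF c] by (simp only: box_bump_def partial_deriv_prod_bump[OF c])
    from has_derivative_compose[OF l this]
    have "((\<lambda>t. ?\<phi> (x - t *\<^sub>R h)) has_derivative
      (\<lambda>s. \<Sum>i\<in>UNIV. (- (s *\<^sub>R h)) $ i * partial_deriv i ?\<phi> (x - t *\<^sub>R h))) (at t)" .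
    also have "(\<lambda>s. \<Sum>i\<in>UNIV. (- (s *\<^sub>R h)) $ i * partial_deriv i ?\<phi> (x - t *\<^sub>R h)) =
      (*) (- (\<Sum>i\<in>UNIV. h $ i * partial_deriv i ?\<phi> (x - t *\<^sub>R h)))"
      by (auto simp: fun_eq_iff sum_distrib_left sum_negf mult_ac)
    finally show ?thesis unfolding has_field_derivative_def .
  qed
  moreover have "isCont (\<lambda>t. - (\<Sum>i\<in>UNIV. h $ i * partial_deriv i ?\<phi> (x - t *\<^sub>R h))) t" for t
  proof -
    have "continuous_on UNIV (partial_deriv i ?\<phi>)" for i
      using partial_deriv_box_bump[OF c] continuous_on_prod_bump[OF c] by metis
    then have "continuous_on UNIV (\<lambda>t. - (\<Sum>i\<in>UNIV. h $ i * partial_deriv i ?\<phi> (x - t *\<^sub>R h)))"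
      by (intro continuous_on_minus continuous_on_sum continuous_on_mult continuous_on_const)
        (rule continuous_on_compose2[where t=UNIV], assumption, auto intro!: continuous_intros)
    then show ?thesis by (simp add: continuous_on_eq_continuous_at)
  qed
  ultimately show ?thesis
    using integral_FTC_Icc_real[of 0 1 "\<lambda>t. ?\<phi> (x - t *\<^sub>R h)" "\<lambda>t. - (\<Sum>i\<in>UNIV. h $ i * partial_deriv i ?\<phi> (x - t *\<^sub>R h))"]
    by simp
qed

text \<open>One enlarged box contains all translates by t h with t in [0,1]; it serves as a common
  domain of integration.\<close>

lemma box_translate_subset:
  fixes a b h :: "real^'n::finite"
  assumes "t \<in> {0..1}" "x - t *\<^sub>R h \<in> box a b"
  shows "x \<in> box (a - (\<chi> i. norm h)) (b + (\<chi> i. norm h))"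
proof -
  have "\<bar>t * h $ i\<bar> \<le> norm h" for i
    using assms(1) component_le_norm_cart[of h i] mult_left_le_one_le[of "\<bar>h $ i\<bar>" t]
    by (auto simp: abs_mult)
  then have "a $ i - norm h < x $ i \<and> x $ i < b $ i + norm h" for i
    using assms(2)[unfolded mem_box_cart, rule_format, of i] by (simp add: abs_le_iff) (smt (verit))
  then show ?thesis by (simp add: mem_box_cart)
qed

text \<open>Tonelli: for fixed \<open>t\<close> a translation by t h turns the inner integral into
  one over the enlarged box. The resulting bound is independent of \<open>t\<close>, and the
  interval of \<open>t\<close> has length 1.\<close>

lemma segment_integrable:
  fixes g :: "real^'n::finite \<Rightarrow> real"
  assumes [measurable]: "g \<in> borel_measurable borel"
    and g: "\<And>a b. set_integrable lborel (box a b) g"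
    and p: "p \<in> borel_measurable borel" "\<And>x. \<bar>p x\<bar> \<le> indicator (box a b) x"
  shows "integrable (lborel \<Otimes>\<^sub>M lborel) (\<lambda>(x, t). p x * g (x + t *\<^sub>R h) * indicator {0..1} (t::real))"
proof (rule integrableI_bounded)
  note p(1)[measurable]
  show "(\<lambda>(x, t). p x * g (x + t *\<^sub>R h) * indicator {0..1} (t::real)) \<in> borel_measurable (lborel \<Otimes>\<^sub>M lborel)"
    by measurable
  let ?K = "\<integral>\<^sup>+ x. ennreal \<bar>g x\<bar> * indicator (box (a - (\<chi> i. norm h)) (b + (\<chi> i. norm h))) x \<partial>lborel"
  have K: "?K < \<infinity>"
  proof -
    have "?K = (\<integral>\<^sup>+ x. norm (indicator (box (a - (\<chi> i. norm h)) (b + (\<chi> i. norm h))) x *\<^sub>R g x) \<partial>lborel)"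
      by (intro nn_integral_cong) (auto simp: indicator_def)
    also have "\<dots> < \<infinity>"
      using g by (simp only: set_integrable_def integrable_iff_bounded)
    finally show ?thesis .
  qed
  have "(\<integral>\<^sup>+ z. norm (case z of (x, t) \<Rightarrow> p x * g (x + t *\<^sub>R h) * indicator {0..1} t) \<partial>(lborel \<Otimes>\<^sub>M lborel))
      = (\<integral>\<^sup>+ t. \<integral>\<^sup>+ x. norm (p x * g (x + t *\<^sub>R h) * indicator {0..1} t) \<partial>lborel \<partial>lborel)"
    by (subst lborel_pair.nn_integral_snd[symmetric]) auto
  also have "\<dots> \<le> (\<integral>\<^sup>+ t. ?K * indicator {0..1} (t::real) \<partial>lborel)"
  proof (rule nn_integral_mono)
    fix t :: real
    have "(\<integral>\<^sup>+ x. norm (p x * g (x + t *\<^sub>R h) * indicator {0..1} t) \<partial>lborel) =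
        (\<integral>\<^sup>+ x. norm (p (x - t *\<^sub>R h) * g x * indicator {0..1} t) \<partial>lborel)"
      using nn_integral_translate[of "\<lambda>x. norm (p (x - t *\<^sub>R h) * g x * indicator {0..1} t)" "t *\<^sub>R h"] by simp
    also have "\<dots> \<le> (\<integral>\<^sup>+ x. (ennreal \<bar>g x\<bar> * indicator (box (a - (\<chi> i. norm h)) (b + (\<chi> i. norm h))) x) * indicator {0..1} t \<partial>lborel)"
    proof (rule nn_integral_mono)
      fix x
      show "ennreal (norm (p (x - t *\<^sub>R h) * g x * indicator {0..1} t))
         \<le> ennreal \<bar>g x\<bar> * indicator (box (a - (\<chi> i. norm h)) (b + (\<chi> i. norm h))) x * indicator {0..1} t"
      proof (cases "t \<in> {0..1} \<and> x - t *\<^sub>R h \<in> box a b")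
        case True
        then have "x \<in> box (a - (\<chi> i. norm h)) (b + (\<chi> i. norm h))"
          by (intro box_translate_subset) auto
        moreover have "\<bar>p (x - t *\<^sub>R h) * g x\<bar> \<le> \<bar>g x\<bar>"
          using p(2)[of "x - t *\<^sub>R h"] True by (simp add: abs_mult mult_left_le_one_le)
        ultimately show ?thesis using True by (simp add: ennreal_leI)
      next
        case False
        then show ?thesis using p(2)[of "x - t *\<^sub>R h"] by (auto simp: indicator_def split: if_splits)
      qed
    qed
    also have "\<dots> = ?K * indicator {0..1} t"
      by (subst nn_integral_multc) auto
    finally show "(\<integral>\<^sup>+ x. norm (p x * g (x + t *\<^sub>R h) * indicator {0..1} t) \<partial>lborel) \<le> ?K * indicator {0..1} t" .
  qed
  also have "\<dots> = ?K"
    by (subst nn_integral_cmult) auto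
  finally show "(\<integral>\<^sup>+ z. norm (case z of (x, t) \<Rightarrow> p x * g (x + t *\<^sub>R h) * indicator {0..1} t) \<partial>(lborel \<Otimes>\<^sub>M lborel)) < \<infinity>"
    using K by order
qed

lemma bump_deriv_integrable:
  fixes u :: "real^'n::finite \<Rightarrow> real"
  assumes c: "c > 0" and [measurable]: "u \<in> borel_measurable borel"
    and u: "\<And>a b. set_integrable lborel (box a b) u"
  shows "integrable lborel (\<lambda>x. u x * partial_deriv i (box_bump c a b) x)"
proof -
  obtain K where K: "\<And>x i. \<bar>partial_deriv i (box_bump c a b) x\<bar> \<le> K * indicator (box a b) x" "0 \<le> K"
    using partial_deriv_box_bump_bounded[OF c] by blast
  note partial_deriv_box_bump_measurable[OF c, measurable]
  show ?thesis
  proof (rule Bochner_Integration.integrable_bound)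
    show "integrable lborel (\<lambda>x. K * (indicator (box a b) x *\<^sub>R u x))"
      using u[of a b] by (simp add: set_integrable_def)
    show "AE x in lborel. norm (u x * partial_deriv i (box_bump c a b) x) \<le> norm (K * (indicator (box a b) x *\<^sub>R u x))"
    proof (rule AE_I2)
      fix x
      have "\<bar>u x\<bar> * \<bar>partial_deriv i (box_bump c a b) x\<bar> \<le> \<bar>u x\<bar> * (K * indicator (box a b) x)"
        by (intro mult_left_mono K) auto
      then show "norm (u x * partial_deriv i (box_bump c a b) x) \<le> norm (K * (indicator (box a b) x *\<^sub>R u x))"
        using K(2) by (simp add: abs_mult mult_ac)
    qed
  qed simp
qed

lemma borel_measurable_vec_nth [measurable (raw)]:
  assumes [measurable]: "g \<in> borel_measurable M"
  shows "(\<lambda>x. g x $ i :: real) \<in> borel_measurable M"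
proof -
  have "(\<lambda>x. g x \<bullet> axis i 1) \<in> borel_measurable M" by measurable
  then show ?thesis by (simp add: inner_axis)
qed

text \<open>The difference is expanded by \<open>box_bump_ftc\<close> and the integrals are
  exchanged. For each \<open>t\<close> the weak gradient is tested with the bump moved by t h, and
  the shift is then transferred to \<open>g\<close>.\<close>

lemma box_bump_difference_integral:
  fixes u :: "real^'n::finite \<Rightarrow> real" and g :: "real^'n \<Rightarrow> real^'n"
  assumes [measurable]: "u \<in> borel_measurable borel" "g \<in> borel_measurable borel"
    and u: "\<And>a b. set_integrable lborel (box a b) u"
    and weak: "\<And>a b c i. c > 0 \<Longrightarrow>
      (LINT x|lborel. u x * partial_deriv i (box_bump c a b) x) = - (LINT x|lborel. g x $ i * box_bump c a b x)"
    and g: "\<And>a b i. set_integrable lborel (box a b) (\<lambda>x. g x $ i)"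
    and c: "c > 0"
  shows "(LINT x|lborel. u x * (box_bump c a b (x - h) - box_bump c a b x)) =
     (LINT t|lborel. (LINT x|lborel. box_bump c a b x * (g (x + t *\<^sub>R h) \<bullet> h)) * indicator {0..1} t)"
proof -
  let ?\<phi> = "box_bump c a b" and ?D = "\<lambda>i x. partial_deriv i (box_bump c a b) x"
  let ?I = "\<lambda>t. indicator {0..1} (t::real) :: real"
  note partial_deriv_box_bump_measurable[OF c, measurable] box_bump_measurable[OF c, measurable]
  obtain K where K: "\<And>x i. \<bar>?D i x\<bar> \<le> K * indicator (box a b) x" "0 \<le> K"
    using partial_deriv_box_bump_bounded[OF c] by blast
  let ?A = "a - (\<chi> i. norm h)" and ?B = "b + (\<chi> i. norm h)"
  let ?\<Psi> = "\<lambda>x t. u x * (- (\<Sum>i\<in>UNIV. h $ i * ?D i (x - t *\<^sub>R h))) * ?I t"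
  have int: "integrable (lborel \<Otimes>\<^sub>M lborel) (\<lambda>(x, t). ?\<Psi> x t)"
  proof (rule Bochner_Integration.integrable_bound)
    let ?L = "K * (\<Sum>i\<in>UNIV. \<bar>h $ i\<bar>)"
    \<comment> \<open>\<open>segment_integrable\<close> with displacement 0 supplies the majorant on
      the product space.\<close>
    have "integrable (lborel \<Otimes>\<^sub>M lborel)
       (\<lambda>(x, t). indicator (box ?A ?B) x * u (x + t *\<^sub>R 0) * ?I t)"
      by (rule segment_integrable[OF _ u]) (auto simp: indicator_def)
    then show "integrable (lborel \<Otimes>\<^sub>M lborel) (\<lambda>z. ?L * (case z of (x, t) \<Rightarrow> indicator (box ?A ?B) x * u x * ?I t))"
      by (intro integrable_mult_right) simp
    show "AE z in lborel \<Otimes>\<^sub>M lborel. norm (case z of (x, t) \<Rightarrow> ?\<Psi> x t) \<le>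
        norm (?L * (case z of (x, t) \<Rightarrow> indicator (box ?A ?B) x * u x * ?I t))"
    proof (intro AE_I2, clarify)
      fix x :: "real^'n" and t :: real
      show "norm (?\<Psi> x t) \<le> norm (?L * (indicator (box ?A ?B) x * u x * ?I t))"
      proof (cases "t \<in> {0..1}")
        case True
        have "\<bar>?D i (x - t *\<^sub>R h)\<bar> \<le> K * indicator (box ?A ?B) x" for i
          using K(1)[of i "x - t *\<^sub>R h"] box_translate_subset[OF True, of x h a b] K(2)
          by (cases "x - t *\<^sub>R h \<in> box a b"; cases "x \<in> box ?A ?B") auto
        then have "\<bar>\<Sum>i\<in>UNIV. h $ i * ?D i (x - t *\<^sub>R h)\<bar> \<le> (\<Sum>i\<in>UNIV. \<bar>h $ i\<bar> * (K * indicator (box ?A ?B) x))"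
          by (intro sum_abs[THEN order_trans] sum_mono) (auto simp: abs_mult intro!: mult_left_mono)
        also have "\<dots> = ?L * indicator (box ?A ?B) x" by (simp add: sum_distrib_left sum_distrib_right mult_ac)
        finally have "\<bar>u x\<bar> * \<bar>\<Sum>i\<in>UNIV. h $ i * ?D i (x - t *\<^sub>R h)\<bar> \<le> \<bar>u x\<bar> * (?L * indicator (box ?A ?B) x)"
          by (rule mult_left_mono) simp
        moreover have "0 \<le> ?L" using K(2) by (intro mult_nonneg_nonneg sum_nonneg) auto
        ultimately show ?thesis using True K(2) by (simp add: abs_mult mult_ac abs_of_nonneg sum_nonneg)
      qed auto
    qed
    show "(\<lambda>(x, t). ?\<Psi> x t) \<in> borel_measurable (lborel \<Otimes>\<^sub>M lborel)" by measurable
  qed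
  have "(LINT x|lborel. u x * (?\<phi> (x - h) - ?\<phi> x)) = (LINT x|lborel. LINT t|lborel. ?\<Psi> x t)"
    by (simp only: box_bump_ftc[OF c, symmetric] mult.assoc integral_mult_right_zero)
  also have "\<dots> = (LINT t|lborel. LINT x|lborel. ?\<Psi> x t)"
    using lborel_pair.Fubini_integral[OF int] by simp
  also have "\<dots> = (LINT t|lborel. (LINT x|lborel. ?\<phi> x * (g (x + t *\<^sub>R h) \<bullet> h)) * ?I t)"
  proof (rule Bochner_Integration.integral_cong[OF refl])
    fix t :: real
    let ?a = "a + t *\<^sub>R h" and ?b = "b + t *\<^sub>R h"
    \<comment> \<open>The integrand becomes a derivative of the bump on the shifted box, to which
      \<open>weak\<close> applies.\<close>
    have D: "?D i (x - t *\<^sub>R h) = partial_deriv i (box_bump c ?a ?b) x" for i x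
      by (rule partial_deriv_box_bump_translate[OF c])
    have tr: "box_bump c ?a ?b (x + t *\<^sub>R h) = ?\<phi> x" for x
      using box_bump_translate[of c a b "x + t *\<^sub>R h" "t *\<^sub>R h"] by simp
    have [measurable]: "box_bump c ?a ?b \<in> borel_measurable borel" by (rule box_bump_measurable[OF c])
    have "(LINT x|lborel. ?\<Psi> x t) =
        (LINT x|lborel. (\<Sum>i\<in>UNIV. (- ?I t * h $ i) * (u x * partial_deriv i (box_bump c ?a ?b) x)))"
      by (intro Bochner_Integration.integral_cong refl) (simp add: D sum_distrib_left sum_negf mult_ac)
    also have "\<dots> = (\<Sum>i\<in>UNIV. (- ?I t * h $ i) * (LINT x|lborel. u x * partial_deriv i (box_bump c ?a ?b) x))"
      by (subst Bochner_Integration.integral_sum) (auto intro!: integrable_mult_right bump_deriv_integrable c u)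
    also have "\<dots> = (\<Sum>i\<in>UNIV. (?I t * h $ i) * (LINT x|lborel. g x $ i * box_bump c ?a ?b x))"
      by (simp add: weak[OF c])
    also have "\<dots> = (\<Sum>i\<in>UNIV. (?I t * h $ i) * (LINT x|lborel. g (x + t *\<^sub>R h) $ i * ?\<phi> x))"
      by (subst integral_translate[symmetric, where h="t *\<^sub>R h"]) (simp_all add: tr)
    also have "\<dots> = (LINT x|lborel. (\<Sum>i\<in>UNIV. (?I t * h $ i) * (g (x + t *\<^sub>R h) $ i * ?\<phi> x)))"
    proof (subst Bochner_Integration.integral_sum)
      show "integrable lborel (\<lambda>x. ?I t * h $ i * (g (x + t *\<^sub>R h) $ i * ?\<phi> x))" for i
      proof (intro integrable_mult_right)
        have "integrable lborel (\<lambda>x. box_bump c ?a ?b x * g x $ i)"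
          by (rule box_bump_integrable[OF c _ g]) simp
        then have "integrable lborel (\<lambda>x. box_bump c ?a ?b (x + t *\<^sub>R h) * g (x + t *\<^sub>R h) $ i)"
          by (subst integrable_translate[where f="\<lambda>x. box_bump c ?a ?b x * g x $ i"]) auto
        then show "integrable lborel (\<lambda>x. g (x + t *\<^sub>R h) $ i * ?\<phi> x)"
          by (simp only: tr mult.commute)
      qed
    qed simp
    also have "\<dots> = (LINT x|lborel. (?\<phi> x * (g (x + t *\<^sub>R h) \<bullet> h)) * ?I t)"
      by (intro Bochner_Integration.integral_cong refl) (simp add: inner_vec_def sum_distrib_left sum_distrib_right mult_ac)
    finally show "(LINT x|lborel. ?\<Psi> x t) = (LINT x|lborel. ?\<phi> x * (g (x + t *\<^sub>R h) \<bullet> h)) * ?I t" by simp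
  qed
  finally show ?thesis .
qed

text \<open>Both sides have equal integrals against every box bump. The exceptional null set depends
  on \<open>h\<close>; this is repaired later by exchanging two almost-everywhere
  quantifiers.\<close>

proposition weak_gradient_difference:
  fixes u :: "real^'n::finite \<Rightarrow> real" and g :: "real^'n \<Rightarrow> real^'n"
  assumes [measurable]: "u \<in> borel_measurable borel" "g \<in> borel_measurable borel"
    and u: "\<And>a b. set_integrable lborel (box a b) u"
    and g: "\<And>a b. set_integrable lborel (box a b) g"
    and weak: "\<And>a b c i. c > 0 \<Longrightarrow>
      (LINT x|lborel. u x * partial_deriv i (box_bump c a b) x) = - (LINT x|lborel. g x $ i * box_bump c a b x)"
  shows "AE x in lborel. u (x + h) - u x = (LINT t|lborel. (g (x + t *\<^sub>R h) \<bullet> h) * indicator {0..1} t)"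
proof -
  let ?I = "\<lambda>t. indicator {0..1} (t::real) :: real"
  define G where "G x = (LINT t|lborel. (g (x + t *\<^sub>R h) \<bullet> h) * ?I t)" for x
  have [measurable]: "G \<in> borel_measurable borel"
    unfolding G_def by measurable
  have gi: "set_integrable lborel (box a b) (\<lambda>x. g x $ i)" for a b i
    using integrable_inner_left[of "axis i 1", OF g[of a b, unfolded set_integrable_def]]
    by (simp add: set_integrable_def inner_axis)
  have gh: "set_integrable lborel (box a b) (\<lambda>x. g x \<bullet> h)" for a b
    using integrable_inner_left[of h, OF g[of a b, unfolded set_integrable_def]]
    by (simp add: set_integrable_def)
  have seg: "integrable (lborel \<Otimes>\<^sub>M lborel) (\<lambda>(x, t). p x * (g (x + t *\<^sub>R h) \<bullet> h) * ?I t)"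
    if "p \<in> borel_measurable borel" "\<And>x. \<bar>p x\<bar> \<le> indicator (box a b) x" for p a b
    by (rule segment_integrable[OF _ gh that]) auto
  have G: "set_integrable lborel (box a b) G" for a b
  proof -
    have "integrable (lborel \<Otimes>\<^sub>M lborel) (\<lambda>(x, t). indicator (box a b) x * (g (x + t *\<^sub>R h) \<bullet> h) * ?I t)"
      by (rule seg[of _ a b]) auto
    from lborel_pair.integrable_fst'[OF this] show ?thesis
      by (simp add: set_integrable_def G_def mult.assoc)
  qed
  have ut: "set_integrable lborel (box a b) (\<lambda>x. u (x + h))" for a b
  proof -
    have "integrable lborel (\<lambda>x. indicator (box (a + h) (b + h)) (x + h) * u (x + h))"
      using u[of "a + h" "b + h"]
      by (subst integrable_translate[where f="\<lambda>x. indicator (box (a + h) (b + h)) x * u x"])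
        (auto simp: set_integrable_def)
    moreover have "x + h \<in> box (a + h) (b + h) \<longleftrightarrow> x \<in> box a b" for x
      by (auto simp: mem_box_cart)
    ultimately show ?thesis by (simp add: set_integrable_def indicator_def cong: if_cong)
  qed
  have "AE x in lborel. u (x + h) - u x - G x = 0"
  proof (rule AE_zero_if_bump_integrals_zero)
    show "set_integrable lborel (box a b) (\<lambda>x. u (x + h) - u x - G x)" for a b
      by (intro set_integral_diff ut u G)
    fix a b :: "real^'n" and c :: real assume c: "c > 0"
    let ?\<phi> = "box_bump c a b"
    note box_bump_measurable[OF c, measurable]
    have i1: "integrable lborel (\<lambda>x. ?\<phi> x * u (x + h))" and i2: "integrable lborel (\<lambda>x. ?\<phi> x * u x)"
      and i3: "integrable lborel (\<lambda>x. ?\<phi> x * G x)"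
      by (rule box_bump_integrable[OF c]; simp add: ut u G)+
    have i1': "integrable lborel (\<lambda>x. ?\<phi> (x - h) * u x)"
      using i1 integrable_translate[of "\<lambda>x. ?\<phi> (x - h) * u x" h] by simp
    have "(LINT x|lborel. ?\<phi> x * u (x + h)) = (LINT x|lborel. ?\<phi> (x - h) * u x)"
      using integral_translate[of "\<lambda>x. ?\<phi> (x - h) * u x" h] by simp
    then have "(LINT x|lborel. ?\<phi> x * u (x + h)) - (LINT x|lborel. ?\<phi> x * u x) =
        (LINT x|lborel. u x * (?\<phi> (x - h) - ?\<phi> x))"
      using i1' i2 by (simp add: right_diff_distrib mult.commute)
    also have "\<dots> = (LINT t|lborel. (LINT x|lborel. ?\<phi> x * (g (x + t *\<^sub>R h) \<bullet> h)) * ?I t)"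
      by (rule box_bump_difference_integral[OF _ _ u weak gi c]) auto
    also have "\<dots> = (LINT t|lborel. LINT x|lborel. ?\<phi> x * (g (x + t *\<^sub>R h) \<bullet> h) * ?I t)"
      by simp
    also have "\<dots> = (LINT x|lborel. LINT t|lborel. ?\<phi> x * (g (x + t *\<^sub>R h) \<bullet> h) * ?I t)"
      by (rule lborel_pair.Fubini_integral, rule seg[of _ a b])
        (use box_bump_bounds[OF c, of a b] in auto)
    also have "\<dots> = (LINT x|lborel. ?\<phi> x * G x)"
      by (simp add: G_def mult.assoc)
    finally show "(LINT x|lborel. ?\<phi> x * (u (x + h) - u x - G x)) = 0"
      using i1 i2 i3 by (simp add: right_diff_distrib)
  qed simp
  then show ?thesis by (simp add: G_def)
qed

section \<open>Dyadic averages and mean oscillations\<close>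

definition dyadic :: "nat \<Rightarrow> real" where "dyadic i = (1 / 2) ^ i"

lemma dyadic_simps [simp]: "0 < dyadic i" "0 \<le> dyadic i" "dyadic i \<noteq> 0" "dyadic i \<le> 1" "dyadic 0 = 1"
  "dyadic (Suc i) = dyadic i / 2"
  by (auto simp: dyadic_def power_le_one)

lemma dyadic_add: "dyadic (i + j) = dyadic i * dyadic j"
  by (simp add: dyadic_def power_add)

lemma dyadic_antimono: "i \<le> j \<Longrightarrow> dyadic j \<le> dyadic i"
  by (simp add: dyadic_def power_decreasing)

lemma dyadic_tendsto: "dyadic \<longlonglongrightarrow> 0"
  by (auto simp: dyadic_def[abs_def] intro!: LIMSEQ_power_zero)

lemma ex_dyadic_less: "0 < e \<Longrightarrow> \<exists>i. dyadic i < e"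
  using real_arch_pow_inv[of e "1/2"] by (auto simp: dyadic_def)

text \<open>The index is written relative to \<open>j\<close> because the sums over scales start at
  a base scale.\<close>

lemma dyadic_bracket:
  assumes "0 < t" "t < dyadic j"
  obtains i where "dyadic (Suc (i + j)) \<le> t" "t < dyadic (i + j)"
proof -
  define n where "n = (LEAST n. dyadic n \<le> t)"
  have ex: "\<exists>n. dyadic n \<le> t" using ex_dyadic_less[OF assms(1)] by (auto intro: less_imp_le)
  have n: "dyadic n \<le> t" unfolding n_def using ex by (rule LeastI_ex)
  have nj: "j < n"
    using n assms(2) dyadic_antimono[of n j] by (meson linorder_not_le order.trans leD)
  then obtain k where k: "n = Suc (k + j)"
    by (metis add.commute add_Suc_right less_imp_Suc_add)
  have "t < dyadic (k + j)"
    using not_less_Least[of "k + j" "\<lambda>n. dyadic n \<le> t"] k n_def by (simp add: not_le)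
  then show thesis using n k by (intro that) auto
qed

lemma nn_integral_scaleR_ball:
  fixes f :: "'a::euclidean_space \<Rightarrow> ennreal"
  assumes [measurable]: "f \<in> borel_measurable borel" and t: "0 < t"
  shows "(\<integral>\<^sup>+ h. f (x + t *\<^sub>R h) * indicator (ball 0 r) h \<partial>lborel)
    = ennreal ((1 / t) ^ DIM('a)) * (\<integral>\<^sup>+ y. f y * indicator (ball x (t * r)) y \<partial>lborel)"
proof -
  have "(\<integral>\<^sup>+ y. F y \<partial>lborel) = ennreal (t ^ DIM('a)) * (\<integral>\<^sup>+ h. F (x + t *\<^sub>R h) \<partial>lborel)"
    if [measurable]: "F \<in> borel_measurable borel" for F :: "'a \<Rightarrow> ennreal"
    by (subst lborel_affine[of t x]) (use t in \<open>simp_all add: nn_integral_density nn_integral_distr nn_integral_cmult\<close>)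
  from this[of "\<lambda>y. f y * indicator (ball x (t * r)) y", OF borel_measurable_times_ennreal[OF assms(1) borel_measurable_indicator]]
  have "(\<integral>\<^sup>+ y. f y * indicator (ball x (t * r)) y \<partial>lborel) = ennreal (t ^ DIM('a)) *
      (\<integral>\<^sup>+ h. f (x + t *\<^sub>R h) * indicator (ball x (t * r)) (x + t *\<^sub>R h) \<partial>lborel)"
    by simp
  also have "(\<lambda>h. indicator (ball x (t * r)) (x + t *\<^sub>R h) :: ennreal) = indicator (ball 0 r)"
    using t by (auto simp: fun_eq_iff indicator_def dist_norm)
  finally show ?thesis
    using t by (simp add: mult.assoc[symmetric] ennreal_mult[symmetric] power_divide)
qed

lemma nn_integral_ball_translate:
  fixes f :: "'a::euclidean_space \<Rightarrow> ennreal"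
  assumes [measurable]: "f \<in> borel_measurable borel"
  shows "(\<integral>\<^sup>+ h. f (x + h) * indicator (ball 0 r) h \<partial>lborel) = (\<integral>\<^sup>+ y. f y * indicator (ball x r) y \<partial>lborel)"
  using nn_integral_scaleR_ball[of f 1 x r] by simp

text \<open>Normalised by \<open>r\<^sup>d\<close> instead of the volume of the ball.\<close>

definition ball_avg :: "nat \<Rightarrow> ('a::euclidean_space \<Rightarrow> ennreal) \<Rightarrow> 'a \<Rightarrow> ennreal" where
  "ball_avg i f x = ennreal (1 / dyadic i ^ DIM('a)) * (\<integral>\<^sup>+ y. f y * indicator (ball x (dyadic i)) y \<partial>lborel)"

text \<open>Oscillation about the value \<open>u x\<close> and not about the average of
  \<open>u\<close>: point values enter directly, so two such quantities bound a difference of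
  values.\<close>

definition mean_osc :: "nat \<Rightarrow> ('a::euclidean_space \<Rightarrow> real) \<Rightarrow> 'a \<Rightarrow> ennreal" where
  "mean_osc i u x = ball_avg i (\<lambda>y. ennreal \<bar>u y - u x\<bar>) x"

lemma ball_pred_measurable [measurable]:
  "Measurable.pred (borel \<Otimes>\<^sub>M borel) (\<lambda>(x::'a::euclidean_space, y). y \<in> ball x r)"
  unfolding mem_ball by measurable

lemma ball_integral_eq:
  assumes [measurable]: "f \<in> borel_measurable borel"
  shows "(\<integral>\<^sup>+ y. f y * indicator (ball x (dyadic i)) y \<partial>lborel) = ennreal (dyadic i ^ DIM('a)) * ball_avg i f (x::'a::euclidean_space)"
  by (simp add: ball_avg_def mult.assoc[symmetric] ennreal_mult[symmetric])

lemma ball_avg_measurable [measurable]: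
  assumes [measurable]: "f \<in> borel_measurable borel"
  shows "ball_avg i f \<in> borel_measurable (borel :: 'a::euclidean_space measure)"
proof -
  have "(\<lambda>x::'a. \<integral>\<^sup>+ y. f y * indicator {z. snd z \<in> ball (fst z) (dyadic i)} (x, y) \<partial>lborel) \<in> borel_measurable borel"
    by measurable
  then have "(\<lambda>x::'a. \<integral>\<^sup>+ y. f y * indicator (ball x (dyadic i)) y \<partial>lborel) \<in> borel_measurable borel"
    by (simp add: indicator_def)
  then show ?thesis unfolding ball_avg_def[abs_def] by measurable
qed

lemma le_suminf_ennreal: "f m \<le> (\<Sum>i. f i :: ennreal)"
  using sum_le_suminf[of f "{m}"] by simp

lemma nn_integral_dyadic_split:
  fixes \<Psi> :: "real \<Rightarrow> ennreal"
  assumes [measurable]: "\<Psi> \<in> borel_measurable borel"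
    and c: "\<And>m t. \<lbrakk>dyadic (Suc m) \<le> t; t < dyadic m\<rbrakk> \<Longrightarrow> \<Psi> t \<le> c m"
  shows "(\<integral>\<^sup>+ t. \<Psi> t * indicator {0..1} t \<partial>lborel) \<le> (\<Sum>m. c m * ennreal (dyadic m))"
proof -
  have "(\<integral>\<^sup>+ t. \<Psi> t * indicator {0..1} t \<partial>lborel) \<le> (\<integral>\<^sup>+ t. (\<Sum>m. c m * indicator {dyadic (Suc m)..<dyadic m} t) \<partial>lborel)"
  proof (rule nn_integral_mono_AE)
    \<comment> \<open>0 and 1 lie in none of the half-open dyadic intervals.\<close>
    have "AE t in lborel. t \<noteq> (0::real) \<and> t \<noteq> 1"
      by (auto intro: AE_conjI AE_lborel_singleton)
    then show "AE t in lborel. \<Psi> t * indicator {0..1} t \<le> (\<Sum>m. c m * indicator {dyadic (Suc m)..<dyadic m} t)"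
    proof eventually_elim
      case (elim t)
      show ?case
      proof (cases "t \<in> {0..1}")
        case True
        with elim have "0 < t" "t < dyadic 0" by auto
        then obtain m where m: "dyadic (Suc (m + 0)) \<le> t" "t < dyadic (m + 0)" by (rule dyadic_bracket)
        then have "\<Psi> t \<le> c m * indicator {dyadic (Suc m)..<dyadic m} t"
          using c by simp
        also have "\<dots> \<le> (\<Sum>m. c m * indicator {dyadic (Suc m)..<dyadic m} t)"
          by (rule le_suminf_ennreal)
        finally show ?thesis using True by simp
      qed simp
    qed
  qed
  also have "\<dots> = (\<Sum>m. c m * ennreal (dyadic m - dyadic (Suc m)))"
    by (subst nn_integral_suminf) (auto intro!: suminf_cong simp: nn_integral_cmult dyadic_antimono simp del: dyadic_simps(6))
  also have "\<dots> \<le> (\<Sum>m. c m * ennreal (dyadic m))"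
    by (intro suminf_le mult_left_mono ennreal_leI) auto
  finally show ?thesis .
qed

text \<open>Exchange the integrals over \<open>t\<close> and \<open>h\<close>. For \<open>t\<close>
  of size r_m the substitution y = x + t h turns the ball of radius r_j into one of radius at most
  r_(m+j). The bound r_j for |h| and the length of the interval of \<open>t\<close> together give
  the weight r_(m+j).\<close>

proposition mean_osc_le:
  fixes u :: "'a::euclidean_space \<Rightarrow> real" and f :: "'a \<Rightarrow> ennreal"
  assumes [measurable]: "u \<in> borel_measurable borel" "f \<in> borel_measurable borel"
    and diff: "AE h in lborel. ennreal \<bar>u (x + h) - u x\<bar> \<le>
      ennreal (norm h) * (\<integral>\<^sup>+ t. f (x + t *\<^sub>R h) * indicator {0..1} t \<partial>lborel)"
  shows "mean_osc j u x \<le> ennreal (2 ^ DIM('a)) * (\<Sum>m. ennreal (dyadic (m + j)) * ball_avg (m + j) f x)"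
proof -
  let ?d = "DIM('a)"
  have "(\<integral>\<^sup>+ y. ennreal \<bar>u y - u x\<bar> * indicator (ball x (dyadic j)) y \<partial>lborel) =
      (\<integral>\<^sup>+ h. ennreal \<bar>u (x + h) - u x\<bar> * indicator (ball 0 (dyadic j)) h \<partial>lborel)"
    by (rule nn_integral_ball_translate[symmetric]) simp
  also have "\<dots> \<le> (\<integral>\<^sup>+ h. (\<integral>\<^sup>+ t. (ennreal (dyadic j) * (f (x + t *\<^sub>R h) * indicator (ball 0 (dyadic j)) h)) * indicator {0..1} t \<partial>lborel) \<partial>lborel)"
  proof (rule nn_integral_mono_AE)
    show "AE h in lborel. ennreal \<bar>u (x + h) - u x\<bar> * indicator (ball 0 (dyadic j)) h \<le>
      (\<integral>\<^sup>+ t. (ennreal (dyadic j) * (f (x + t *\<^sub>R h) * indicator (ball 0 (dyadic j)) h)) * indicator {0..1} t \<partial>lborel)"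
      using diff
    proof eventually_elim
      case (elim h)
      show ?case
      proof (cases "h \<in> ball 0 (dyadic j)")
        case True
        then have "norm h \<le> dyadic j" by simp
        then have "ennreal (norm h) * (\<integral>\<^sup>+ t. f (x + t *\<^sub>R h) * indicator {0..1} t \<partial>lborel)
          \<le> ennreal (dyadic j) * (\<integral>\<^sup>+ t. f (x + t *\<^sub>R h) * indicator {0..1} t \<partial>lborel)"
          by (intro mult_right_mono ennreal_leI) auto
        also have "\<dots> = (\<integral>\<^sup>+ t. (ennreal (dyadic j) * (f (x + t *\<^sub>R h))) * indicator {0..1} t \<partial>lborel)"
          by (subst nn_integral_cmult[symmetric]) (auto simp: mult.assoc)
        finally show ?thesis using elim True by simp
      qed simp
    qed
  qed
  also have "\<dots> = (\<integral>\<^sup>+ t. (\<integral>\<^sup>+ h. (ennreal (dyadic j) * (f (x + t *\<^sub>R h) * indicator (ball 0 (dyadic j)) h)) * indicator {0..1} t \<partial>lborel) \<partial>lborel)"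
    by (rule lborel_pair.Fubini') measurable
  also have "\<dots> = (\<integral>\<^sup>+ t. (ennreal (dyadic j) * (\<integral>\<^sup>+ h. f (x + t *\<^sub>R h) * indicator (ball 0 (dyadic j)) h \<partial>lborel)) * indicator {0..1} t \<partial>lborel)"
    by (simp add: nn_integral_multc nn_integral_cmult)
  also have "\<dots> \<le> (\<Sum>m. ennreal (dyadic j * (2 ^ ?d * dyadic j ^ ?d)) * ball_avg (m + j) f x * ennreal (dyadic m))"
  proof (rule nn_integral_dyadic_split)
    show "(\<lambda>t. ennreal (dyadic j) * (\<integral>\<^sup>+ h. f (x + t *\<^sub>R h) * indicator (ball 0 (dyadic j)) h \<partial>lborel)) \<in> borel_measurable borel"
      by measurable
    fix m t assume t: "dyadic (Suc m) \<le> t" "t < dyadic m"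
    from less_le_trans[OF dyadic_simps(1) t(1)] have t0: "0 < t" .
    have "(\<integral>\<^sup>+ h. f (x + t *\<^sub>R h) * indicator (ball 0 (dyadic j)) h \<partial>lborel)
      = ennreal ((1 / t) ^ ?d) * (\<integral>\<^sup>+ y. f y * indicator (ball x (t * dyadic j)) y \<partial>lborel)"
      by (rule nn_integral_scaleR_ball[OF _ t0]) simp
    \<comment> \<open>Since \<open>t\<close> is at least half of r_m, the Jacobian costs at most a
      factor 2 per dimension.\<close>
    also have "\<dots> \<le> ennreal ((2 / dyadic m) ^ ?d) * (\<integral>\<^sup>+ y. f y * indicator (ball x (dyadic (m + j))) y \<partial>lborel)"
    proof (intro mult_mono ennreal_leI power_mono nn_integral_mono)
      show "1 / t \<le> 2 / dyadic m" using t t0 by (simp add: field_simps)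
      have "t * dyadic j \<le> dyadic (m + j)" using t by (simp add: dyadic_add)
      then show "indicator (ball x (t * dyadic j)) y \<le> (indicator (ball x (dyadic (m + j))) y :: ennreal)" for y
        by (auto simp: indicator_def)
    qed (use t0 in auto)
    also have "\<dots> = ennreal (2 ^ ?d * dyadic j ^ ?d) * ball_avg (m + j) f x"
      by (subst ball_integral_eq, simp)
        (simp add: mult.assoc[symmetric] ennreal_mult[symmetric] dyadic_add power_mult_distrib power_divide)
    finally show "ennreal (dyadic j) * (\<integral>\<^sup>+ h. f (x + t *\<^sub>R h) * indicator (ball 0 (dyadic j)) h \<partial>lborel)
      \<le> ennreal (dyadic j * (2 ^ ?d * dyadic j ^ ?d)) * ball_avg (m + j) f x"
      by (simp add: ennreal_mult mult.assoc mult_left_mono)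
  qed
  also have "\<dots> = (\<Sum>m. ennreal (2 ^ ?d * dyadic j ^ ?d) * (ennreal (dyadic (m + j)) * ball_avg (m + j) f x))"
    by (intro suminf_cong) (simp add: dyadic_add ennreal_mult mult_ac)
  finally have *: "(\<integral>\<^sup>+ y. ennreal \<bar>u y - u x\<bar> * indicator (ball x (dyadic j)) y \<partial>lborel)
     \<le> ennreal (2 ^ ?d * dyadic j ^ ?d) * (\<Sum>m. ennreal (dyadic (m + j)) * ball_avg (m + j) f x)"
    by simp
  have "mean_osc j u x \<le> ennreal (1 / dyadic j ^ ?d) *
     (ennreal (2 ^ ?d * dyadic j ^ ?d) * (\<Sum>m. ennreal (dyadic (m + j)) * ball_avg (m + j) f x))"
    unfolding mean_osc_def ball_avg_def[of j "\<lambda>y. ennreal \<bar>u y - u x\<bar>"] by (intro mult_left_mono *) auto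
  also have "\<dots> = ennreal (2 ^ ?d) * (\<Sum>m. ennreal (dyadic (m + j)) * ball_avg (m + j) f x)"
    by (simp only: mult.assoc[symmetric] ennreal_mult[symmetric]) (simp add: ennreal_mult[symmetric] mult.assoc[symmetric])
  finally show ?thesis .
qed

text \<open>The triangle inequality through a third point \<open>z\<close> is averaged over the ball
  of half the radius about the midpoint, which lies in both balls. Its volume accounts for the
  constant.\<close>

lemma abs_diff_le_mean_osc:
  fixes u :: "'a::euclidean_space \<Rightarrow> real"
  assumes [measurable]: "u \<in> borel_measurable borel" and xy: "dist x y < dyadic j"
  shows "ennreal \<bar>u x - u y\<bar> \<le> ennreal (2 ^ DIM('a) / unit_ball_vol DIM('a)) * (mean_osc j u x + mean_osc j u y)"
proof -
  let ?d = "DIM('a)" let ?v = "unit_ball_vol DIM('a)"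
  have v: "0 < ?v" "?v \<noteq> 0" using less_imp_neq[OF unit_ball_vol_pos[of "real DIM('a)"]] by auto
  define B where "B = ball ((1/2) *\<^sub>R (x + y)) ((1/2) * dyadic j)"
  have [measurable]: "B \<in> sets borel" by (simp add: B_def)
  have B: "z \<in> ball x (dyadic j) \<and> z \<in> ball y (dyadic j)" if "z \<in> B" for z
  proof -
    let ?m = "(1/2) *\<^sub>R (x + y)"
    have "x - ?m = (1/2) *\<^sub>R (x - y)" "y - ?m = (1/2) *\<^sub>R (y - x)"
      by (simp_all add: algebra_simps) (metis scaleR_half_double scaleR_add_right add_diff_cancel)+
    then have "dist x ?m = dist x y / 2" "dist y ?m = dist x y / 2"
      by (auto simp: dist_norm norm_minus_commute)
    then show ?thesis
      using that xy dist_triangle[of x z ?m] dist_triangle[of y z ?m] by (auto simp: B_def)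
  qed
  have "ennreal \<bar>u x - u y\<bar> * ennreal (?v * (1/2) ^ ?d * dyadic j ^ ?d) = (\<integral>\<^sup>+ z. ennreal \<bar>u x - u y\<bar> * indicator B z \<partial>lborel)"
    unfolding B_def by (subst nn_integral_cmult_indicator) (auto simp: emeasure_ball power_mult_distrib power_divide mult_ac)
  also have "\<dots> \<le> (\<integral>\<^sup>+ z. ennreal \<bar>u z - u x\<bar> * indicator (ball x (dyadic j)) z
      + ennreal \<bar>u z - u y\<bar> * indicator (ball y (dyadic j)) z \<partial>lborel)"
  proof (rule nn_integral_mono)
    fix z
    have "ennreal \<bar>u x - u y\<bar> \<le> ennreal \<bar>u z - u x\<bar> + ennreal \<bar>u z - u y\<bar>"
      using ennreal_leI[of "\<bar>u x - u y\<bar>" "\<bar>u z - u x\<bar> + \<bar>u z - u y\<bar>"] by simp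
    then show "ennreal \<bar>u x - u y\<bar> * indicator B z \<le> ennreal \<bar>u z - u x\<bar> * indicator (ball x (dyadic j)) z
      + ennreal \<bar>u z - u y\<bar> * indicator (ball y (dyadic j)) z"
      using B[of z] by (cases "z \<in> B") auto
  qed
  also have "\<dots> = ennreal (dyadic j ^ ?d) * mean_osc j u x + ennreal (dyadic j ^ ?d) * mean_osc j u y"
    by (subst nn_integral_add) (auto simp: ball_integral_eq mean_osc_def)
  finally have *: "ennreal \<bar>u x - u y\<bar> * ennreal (?v * (1/2) ^ ?d * dyadic j ^ ?d) \<le>
     ennreal (dyadic j ^ ?d) * (mean_osc j u x + mean_osc j u y)" by (simp add: distrib_left)
  have "ennreal \<bar>u x - u y\<bar> = ennreal (2 ^ ?d / (?v * dyadic j ^ ?d)) * (ennreal \<bar>u x - u y\<bar> * ennreal (?v * (1/2) ^ ?d * dyadic j ^ ?d))"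
    using v by (simp add: ennreal_mult[symmetric] power_divide)
  also have "\<dots> \<le> ennreal (2 ^ ?d / (?v * dyadic j ^ ?d)) * (ennreal (dyadic j ^ ?d) * (mean_osc j u x + mean_osc j u y))"
    by (intro mult_left_mono *) auto
  also have "\<dots> = ennreal (2 ^ ?d / ?v) * (mean_osc j u x + mean_osc j u y)"
    using v by (simp add: mult.assoc[symmetric] ennreal_mult[symmetric])
  finally show ?thesis .
qed

text \<open>Here |u x| \<le> |u z - u x| + |u z| is averaged over \<open>z\<close> in the whole
  ball.\<close>

lemma abs_le_mean_osc:
  fixes u :: "'a::euclidean_space \<Rightarrow> real"
  assumes [measurable]: "u \<in> borel_measurable borel"
  shows "ennreal \<bar>u x\<bar> \<le> ennreal (1 / unit_ball_vol DIM('a)) * (mean_osc j u x + ball_avg j (\<lambda>y. ennreal \<bar>u y\<bar>) x)"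
proof -
  let ?d = "DIM('a)" let ?v = "unit_ball_vol DIM('a)"
  have v: "0 < ?v" "?v \<noteq> 0" using less_imp_neq[OF unit_ball_vol_pos[of "real DIM('a)"]] by auto
  have "ennreal \<bar>u x\<bar> * ennreal (?v * dyadic j ^ ?d) = (\<integral>\<^sup>+ z. ennreal \<bar>u x\<bar> * indicator (ball x (dyadic j)) z \<partial>lborel)"
    by (subst nn_integral_cmult_indicator) (auto simp: emeasure_ball power_mult_distrib power_divide mult_ac)
  also have "\<dots> \<le> (\<integral>\<^sup>+ z. ennreal \<bar>u z - u x\<bar> * indicator (ball x (dyadic j)) z
      + ennreal \<bar>u z\<bar> * indicator (ball x (dyadic j)) z \<partial>lborel)"
  proof (rule nn_integral_mono)
    fix z
    have "ennreal \<bar>u x\<bar> \<le> ennreal \<bar>u z - u x\<bar> + ennreal \<bar>u z\<bar>"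
      using ennreal_leI[of "\<bar>u x\<bar>" "\<bar>u z - u x\<bar> + \<bar>u z\<bar>"] by simp
    then show "ennreal \<bar>u x\<bar> * indicator (ball x (dyadic j)) z \<le> ennreal \<bar>u z - u x\<bar> * indicator (ball x (dyadic j)) z
      + ennreal \<bar>u z\<bar> * indicator (ball x (dyadic j)) z"
      by (auto simp: indicator_def)
  qed
  also have "\<dots> = ennreal (dyadic j ^ ?d) * mean_osc j u x + ennreal (dyadic j ^ ?d) * ball_avg j (\<lambda>y. ennreal \<bar>u y\<bar>) x"
    by (subst nn_integral_add) (auto simp: ball_integral_eq mean_osc_def)
  finally have *: "ennreal \<bar>u x\<bar> * ennreal (?v * dyadic j ^ ?d) \<le>
     ennreal (dyadic j ^ ?d) * (mean_osc j u x + ball_avg j (\<lambda>y. ennreal \<bar>u y\<bar>) x)" by (simp add: distrib_left)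
  have "ennreal \<bar>u x\<bar> = ennreal (1 / (?v * dyadic j ^ ?d)) * (ennreal \<bar>u x\<bar> * ennreal (?v * dyadic j ^ ?d))"
    using v by (simp add: ennreal_mult[symmetric])
  also have "\<dots> \<le> ennreal (1 / (?v * dyadic j ^ ?d)) * (ennreal (dyadic j ^ ?d) * (mean_osc j u x + ball_avg j (\<lambda>y. ennreal \<bar>u y\<bar>) x))"
    by (intro mult_left_mono *) auto
  also have "\<dots> = ennreal (1 / ?v) * (mean_osc j u x + ball_avg j (\<lambda>y. ennreal \<bar>u y\<bar>) x)"
    using v by (simp add: mult.assoc[symmetric] ennreal_mult[symmetric])
  finally show ?thesis .
qed

section \<open>Summing oscillations over scales\<close>

lemma suminf_commute_ennreal: "(\<Sum>n. \<Sum>m. f n m) = (\<Sum>m. \<Sum>n. f n m :: ennreal)"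
proof -
  have "(\<Sum>n. \<Sum>m. f n m) = (\<Sum>n. \<integral>\<^sup>+ m. f n m \<partial>count_space UNIV)"
    by (simp add: nn_integral_count_space_nat)
  also have "\<dots> = (\<integral>\<^sup>+ m. (\<Sum>n. f n m) \<partial>count_space UNIV)"
    by (rule nn_integral_suminf[symmetric]) simp
  finally show ?thesis by (simp add: nn_integral_count_space_nat)
qed

lemma suminf_offset_le_ennreal: "(\<Sum>n. f (n + m)) \<le> (\<Sum>n. f n :: ennreal)"
  using suminf_offset[of f m] by simp

lemma suminf_geometric_powr:
  fixes s :: real
  assumes "0 < s"
  shows "(\<Sum>n. ennreal (dyadic n powr s)) = ennreal (1 / (1 - 2 powr - s))"
proof -
  have z: "2 powr - s < (1::real)" using assms by (simp add: powr_less_one)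
  have "dyadic n powr s = (2 powr - s) ^ n" for n
    by (simp add: dyadic_def powr_power powr_realpow[symmetric] powr_powr power_one_over powr_minus_divide powr_divide mult.commute)
  then show ?thesis using z
    by (simp add: suminf_ennreal_eq geometric_sums)
qed

text \<open>The \<open>\<ell>\<^sup>1\<close> norm on the left is dominated by a supremum, which in turn is dominated by the
  \<open>\<ell>\<^sup>q\<close> norm; this replaces Hoelder's inequality.\<close>

lemma powr_le_suminf_powr:
  fixes b :: "nat \<Rightarrow> real"
  assumes b: "\<And>m. 0 \<le> b m" and s: "0 < s" and q: "0 < q" and t: "0 \<le> t"
    and le: "ennreal t \<le> (\<Sum>m. ennreal (dyadic m powr s * b m))"
  shows "ennreal (t powr q) \<le> ennreal ((1 / (1 - 2 powr - s)) powr q) * (\<Sum>m. ennreal (b m powr q))"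
proof (cases "(\<Sum>m. ennreal (b m powr q)) = \<infinity>")
  case True
  have "2 powr - s < (1::real)" using s by (simp add: powr_less_one)
  then have "0 < (1 / (1 - 2 powr - s)) powr q" using s by simp
  then show ?thesis using True by (simp add: ennreal_mult_top)
next
  case False
  then obtain B where B: "0 \<le> B" "(\<Sum>m. ennreal (b m powr q)) = ennreal B"
    by (metis ennreal_cases infinity_ennreal_def)
  define K where "K = 1 / (1 - 2 powr - s)"
  have K: "0 \<le> K" using powr_less_one[of 2 "- s"] s by (simp add: K_def)
  have bB: "b m \<le> B powr (1 / q)" for m
  proof -
    have "ennreal (b m powr q) \<le> ennreal B"
      using le_suminf_ennreal[of "\<lambda>m. ennreal (b m powr q)" m] B by simp
    then have "b m powr q \<le> B" using B by simp
    then have "(b m powr q) powr (1 / q) \<le> B powr (1 / q)"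
      using q by (intro powr_mono2) auto
    then show ?thesis using q b[of m] by (simp add: powr_powr)
  qed
  have "ennreal t \<le> (\<Sum>m. ennreal (dyadic m powr s) * ennreal (B powr (1 / q)))"
    using bB by (intro order_trans[OF le] suminf_le) (auto simp flip: ennreal_mult intro!: ennreal_leI mult_left_mono)
  also have "\<dots> = ennreal (K * B powr (1 / q))"
    using K by (simp only: ennreal_suminf_multc suminf_geometric_powr[OF s] K_def[symmetric] ennreal_mult powr_ge_zero)
  finally have "t \<le> K * B powr (1 / q)" using K by simp
  then have "t powr q \<le> (K * B powr (1 / q)) powr q"
    using q t by (intro powr_mono2) auto
  also have "\<dots> = K powr q * B" using K q B by (simp add: powr_mult powr_powr)
  finally show ?thesis using B by (simp add: K_def[symmetric] ennreal_leI flip: ennreal_mult)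
qed

text \<open>One of the two summands is at least t / 2. \<open>S\<close> and \<open>T\<close> may be
  infinite, so their powers are replaced by bounds for the powers of the real numbers below
  them.\<close>

lemma powr_add_le:
  fixes S T :: ennreal
  assumes "0 \<le> t" "ennreal t \<le> S + T" "0 < q" "0 < C"
    and S: "\<And>r. 0 \<le> r \<Longrightarrow> ennreal r \<le> S \<Longrightarrow> ennreal (r powr q) \<le> P"
    and T: "\<And>r. 0 \<le> r \<Longrightarrow> ennreal r \<le> T \<Longrightarrow> ennreal (r powr q) \<le> Q"
  shows "ennreal (t powr q) \<le> ennreal (2 powr q) * (P + Q)"
proof -
  have half: "ennreal (t / 2) + ennreal (t / 2) = ennreal t"
    using assms(1) by (simp flip: ennreal_plus)
  have "ennreal (t / 2) \<le> S \<or> ennreal (t / 2) \<le> T"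
  proof (rule ccontr)
    assume "\<not> ?thesis"
    then have "S + T < ennreal (t / 2) + ennreal (t / 2)"
      by (intro add_strict_mono) (auto simp: not_le)
    then show False using half assms(2) by simp
  qed
  then have "ennreal ((t / 2) powr q) \<le> P + Q"
    using S[of "t / 2"] T[of "t / 2"] assms(1) by (auto intro: add_increasing add_increasing2)
  then have "ennreal (2 powr q) * ennreal ((t / 2) powr q) \<le> ennreal (2 powr q) * (P + Q)"
    by (rule mult_left_mono) simp
  moreover have "2 powr q * (t / 2) powr q = t powr q"
    using assms(1) by (simp add: powr_divide)
  ultimately show ?thesis by (simp flip: ennreal_mult)
qed

text \<open>Replaces the q-th power of the series that bounds the oscillation at scale
  \<open>j\<close>, in the form delivered by \<open>powr_le_suminf_powr\<close> with s = \<theta> /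
  2. Giving away only half of \<theta> leaves a convergent factor for
  \<open>osc_sum_energy\<close>.\<close>

definition osc_sum :: "real \<Rightarrow> real \<Rightarrow> ('a::euclidean_space \<Rightarrow> ennreal) \<Rightarrow> nat \<Rightarrow> 'a \<Rightarrow> ennreal" where
  "osc_sum \<theta> q f j x =
     (\<Sum>m. ennreal ((dyadic m powr (- (\<theta> / 2)) * dyadic (m + j) * enn2real (ball_avg (m + j) f x)) powr q))"

text \<open>\<open>enn2real\<close> gives the right value only where the averages are finite;
  finiteness at the scales from \<open>i0\<close> on is therefore carried along separately.\<close>

definition avg_energy :: "real \<Rightarrow> real \<Rightarrow> nat \<Rightarrow> ('a::euclidean_space \<Rightarrow> ennreal) \<Rightarrow> ennreal" where
  "avg_energy \<theta> q i0 f = (\<Sum>i. ennreal (dyadic (i + i0) powr (q * (1 - \<theta>))) *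
     (\<integral>\<^sup>+ x. ennreal (enn2real (ball_avg (i + i0) f x) powr q) \<partial>lborel))"

lemma osc_sum_measurable [measurable]:
  assumes [measurable]: "f \<in> borel_measurable borel"
  shows "osc_sum \<theta> q f j \<in> borel_measurable borel"
  unfolding osc_sum_def[abs_def] by measurable

lemma mean_osc_powr_le:
  fixes u :: "'a::euclidean_space \<Rightarrow> real" and \<theta> q :: real
  assumes osc: "mean_osc j u x \<le> ennreal (2 ^ DIM('a)) * (\<Sum>m. ennreal (dyadic (m + j)) * ball_avg (m + j) f x)"
    and fin: "\<And>i. i \<ge> j \<Longrightarrow> ball_avg i f x < \<infinity>"
    and \<theta>: "0 < \<theta>" and q: "0 < q" and r: "0 \<le> r" and C: "0 < C" and le: "ennreal r \<le> ennreal C * mean_osc j u x"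
  shows "ennreal (r powr q) \<le> ennreal ((C * 2 ^ DIM('a) / (1 - 2 powr - (\<theta> / 2))) powr q) * osc_sum \<theta> q f j x"
proof -
  define D where "D = C * 2 ^ DIM('a)"
  have D: "0 < D" using C by (simp add: D_def)
  let ?b = "\<lambda>m. dyadic m powr (- (\<theta> / 2)) * dyadic (m + j) * enn2real (ball_avg (m + j) f x)"
  have "ennreal r \<le> ennreal C * (ennreal (2 ^ DIM('a)) * (\<Sum>m. ennreal (dyadic (m + j)) * ball_avg (m + j) f x))"
    by (rule order_trans[OF le mult_left_mono[OF osc]]) simp
  also have "\<dots> = ennreal D * (\<Sum>m. ennreal (dyadic (m + j)) * ball_avg (m + j) f x)"
    using C by (simp add: D_def ennreal_mult mult.assoc)
  \<comment> \<open>A factor \<open>dyadic m powr (\<theta> / 2)\<close> and its inverse are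
    inserted to reach the form required by \<open>powr_le_suminf_powr\<close>.\<close>
  also have "(\<Sum>m. ennreal (dyadic (m + j)) * ball_avg (m + j) f x) = (\<Sum>m. ennreal (dyadic m powr (\<theta> / 2) * ?b m))"
  proof (intro suminf_cong)
    fix m
    have "dyadic m powr (\<theta> / 2) * ?b m = dyadic (m + j) * enn2real (ball_avg (m + j) f x)"
      by (simp add: powr_minus field_simps)
    then show "ennreal (dyadic (m + j)) * ball_avg (m + j) f x = ennreal (dyadic m powr (\<theta> / 2) * ?b m)"
      using fin[of "m + j"] by (simp only:) (simp add: ennreal_mult)
  qed
  finally have "ennreal (1 / D) * ennreal r \<le> ennreal (1 / D) * (ennreal D * (\<Sum>m. ennreal (dyadic m powr (\<theta> / 2) * ?b m)))"
    by (rule mult_left_mono) simp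
  then have "ennreal (r / D) \<le> (\<Sum>m. ennreal (dyadic m powr (\<theta> / 2) * ?b m))"
    using D r by (simp add: mult.assoc[symmetric] flip: ennreal_mult)
  then have "ennreal ((r / D) powr q) \<le> ennreal ((1 / (1 - 2 powr - (\<theta> / 2))) powr q) * osc_sum \<theta> q f j x"
    unfolding osc_sum_def using \<theta> q r D by (intro powr_le_suminf_powr) auto
  then have "ennreal (D powr q) * ennreal ((r / D) powr q) \<le>
      ennreal (D powr q) * (ennreal ((1 / (1 - 2 powr - (\<theta> / 2))) powr q) * osc_sum \<theta> q f j x)"
    by (rule mult_left_mono) simp
  moreover have "D powr q * (r / D) powr q = r powr q"
    using r D by (simp add: powr_divide)
  moreover have "D powr q * (1 / (1 - 2 powr - (\<theta> / 2))) powr q = (D / (1 - 2 powr - (\<theta> / 2))) powr q"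
    using D \<theta> powr_less_one[of 2 "- (\<theta> / 2)"] by (subst powr_mult[symmetric]) auto
  ultimately show ?thesis by (simp add: D_def mult.assoc[symmetric] flip: ennreal_mult)
qed

text \<open>A discrete Hardy inequality. The double sum is regrouped by the scale n + m; the surplus
  \<open>dyadic m powr (\<theta> * q / 2)\<close> is summed over m, and for each m the sum over n is
  a tail of the energy.\<close>

lemma osc_sum_energy:
  fixes f :: "'a::euclidean_space \<Rightarrow> ennreal"
  assumes [measurable]: "f \<in> borel_measurable borel" and \<theta>: "0 < \<theta>" and q: "0 < q"
  shows "(\<Sum>n. ennreal (dyadic (n + i0) powr (- (\<theta> * q))) * (\<integral>\<^sup>+ x. osc_sum \<theta> q f (n + i0) x \<partial>lborel))
    \<le> ennreal (1 / (1 - 2 powr - (\<theta> * q / 2))) * avg_energy \<theta> q i0 f"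
proof -
  define I where "I i = (\<integral>\<^sup>+ x. ennreal (enn2real (ball_avg i f x) powr q) \<partial>lborel)" for i
  define \<phi> where "\<phi> i = ennreal (dyadic (i + i0) powr (q * (1 - \<theta>))) * I (i + i0)" for i
  have "ennreal (dyadic (n + i0) powr (- (\<theta> * q))) * (\<integral>\<^sup>+ x. osc_sum \<theta> q f (n + i0) x \<partial>lborel)
     = (\<Sum>m. ennreal (dyadic m powr (\<theta> * q / 2)) * \<phi> (n + m))" for n
  proof -
    have "(\<integral>\<^sup>+ x. osc_sum \<theta> q f (n + i0) x \<partial>lborel) =
      (\<Sum>m. \<integral>\<^sup>+ x. ennreal ((dyadic m powr (- (\<theta> / 2)) * dyadic (m + (n + i0))) powr q) *
          ennreal (enn2real (ball_avg (m + (n + i0)) f x) powr q) \<partial>lborel)"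
      unfolding osc_sum_def by (subst nn_integral_suminf) (auto simp: powr_mult simp flip: ennreal_mult)
    also have "\<dots> = (\<Sum>m. ennreal ((dyadic m powr (- (\<theta> / 2)) * dyadic (m + (n + i0))) powr q) * I (m + (n + i0)))"
      unfolding I_def by (subst nn_integral_cmult) auto
    finally have "ennreal (dyadic (n + i0) powr (- (\<theta> * q))) * (\<integral>\<^sup>+ x. osc_sum \<theta> q f (n + i0) x \<partial>lborel) =
      (\<Sum>m. ennreal (dyadic (n + i0) powr (- (\<theta> * q))) *
        (ennreal ((dyadic m powr (- (\<theta> / 2)) * dyadic (m + (n + i0))) powr q) * I (m + (n + i0))))"
      by simp
    also have "\<dots> = (\<Sum>m. ennreal (dyadic m powr (\<theta> * q / 2)) * \<phi> (n + m))"
    proof (intro suminf_cong)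
      fix m
      have "dyadic (n + i0) powr (- (\<theta> * q)) * (dyadic m powr (- (\<theta> / 2)) * dyadic (m + (n + i0))) powr q
         = dyadic m powr (\<theta> * q / 2) * dyadic (n + m + i0) powr (q * (1 - \<theta>))"
      proof -
        obtain X where X: "X = dyadic (n + i0)" and X0: "0 < X" by simp
        obtain M where M: "M = dyadic m" and M0: "0 < M" by simp
        have "dyadic (m + (n + i0)) = M * X" "dyadic (n + m + i0) = M * X"
          by (simp_all add: X M dyadic_add mult_ac)
        moreover have "X powr (- (\<theta> * q)) * (M powr (- (\<theta> / 2)) * (M * X)) powr q = 
            (M powr (- (\<theta> * q / 2)) * M powr q) * (X powr (- (\<theta> * q)) * X powr q)"
          using X0 M0 by (simp add: powr_mult powr_powr mult_ac)
        moreover have "\<dots> = M powr (q - \<theta> * q / 2) * X powr (q - \<theta> * q)"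
          by (simp flip: powr_add)
        moreover have "M powr (\<theta> * q / 2) * (M * X) powr (q * (1 - \<theta>)) = 
            (M powr (\<theta> * q / 2) * M powr (q * (1 - \<theta>))) * X powr (q * (1 - \<theta>))"
          using X0 M0 by (simp add: powr_mult)
        moreover have "\<dots> = M powr (q - \<theta> * q / 2) * X powr (q - \<theta> * q)"
          by (simp add: algebra_simps flip: powr_add)
        ultimately show ?thesis unfolding X[symmetric] M[symmetric] by (simp only:)
      qed
      then show "ennreal (dyadic (n + i0) powr (- (\<theta> * q))) *
        (ennreal ((dyadic m powr (- (\<theta> / 2)) * dyadic (m + (n + i0))) powr q) * I (m + (n + i0))) =
        ennreal (dyadic m powr (\<theta> * q / 2)) * \<phi> (n + m)"
        unfolding \<phi>_def
        by (simp only: mult.assoc[symmetric] ennreal_mult[symmetric] powr_ge_zero) (simp only: ac_simps)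
    qed
    finally show ?thesis .
  qed
  then have "(\<Sum>n. ennreal (dyadic (n + i0) powr (- (\<theta> * q))) * (\<integral>\<^sup>+ x. osc_sum \<theta> q f (n + i0) x \<partial>lborel))
     = (\<Sum>m. \<Sum>n. ennreal (dyadic m powr (\<theta> * q / 2)) * \<phi> (n + m))"
    by (simp only: suminf_commute_ennreal[of "\<lambda>n m. ennreal (dyadic m powr (\<theta> * q / 2)) * \<phi> (n + m)"])
  also have "\<dots> \<le> (\<Sum>m. ennreal (dyadic m powr (\<theta> * q / 2)) * suminf \<phi>)"
    by (intro suminf_le) (auto intro!: mult_left_mono suminf_offset_le_ennreal)
  also have "\<dots> = ennreal (1 / (1 - 2 powr - (\<theta> * q / 2))) * avg_energy \<theta> q i0 f"
    using \<theta> q by (simp only: ennreal_suminf_multc suminf_geometric_powr mult_pos_pos half_gt_zero_iff)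
      (simp add: avg_energy_def \<phi>_def[abs_def] I_def)
  finally show ?thesis .
qed

section \<open>Energies of averages\<close>

abbreviation ball_mean :: "nat \<Rightarrow> ('a::euclidean_space \<Rightarrow> real) \<Rightarrow> 'a \<Rightarrow> ennreal" where
  "ball_mean i f \<equiv> ball_avg i (\<lambda>y. ennreal (f y))"

abbreviation square_energy :: "real \<Rightarrow> nat \<Rightarrow> ('a::euclidean_space \<Rightarrow> real) \<Rightarrow> ennreal" where
  "square_energy \<kappa> i0 f \<equiv> (\<Sum>n. ennreal (dyadic (n + i0) powr \<kappa>) * (\<integral>\<^sup>+ x. (ball_mean (n + i0) f x)\<^sup>2 \<partial>lborel))"

lemma indicator_ball_measurable [measurable]:
  "(\<lambda>(x::'a::euclidean_space, y). indicator (ball x r) y :: ennreal) \<in> borel_measurable (borel \<Otimes>\<^sub>M borel)"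
proof -
  have "(\<lambda>z::'a \<times> 'a. indicator {z. snd z \<in> ball (fst z) r} z :: ennreal) \<in> borel_measurable (borel \<Otimes>\<^sub>M borel)"
    by measurable
  then show ?thesis by (simp add: indicator_def case_prod_unfold)
qed

text \<open>Fubini, and the symmetry in x and y of the condition that y lies in the ball about
  x.\<close>

lemma nn_integral_ball_avg:
  fixes h :: "'a::euclidean_space \<Rightarrow> ennreal"
  assumes [measurable]: "h \<in> borel_measurable borel"
  shows "(\<integral>\<^sup>+ x. ball_avg i h x \<partial>lborel) = ennreal (unit_ball_vol DIM('a)) * (\<integral>\<^sup>+ y. h y \<partial>lborel)"
proof -
  have "(\<integral>\<^sup>+ x. \<integral>\<^sup>+ y. h y * indicator (ball x (dyadic i)) y \<partial>lborel \<partial>lborel)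
     = (\<integral>\<^sup>+ y. \<integral>\<^sup>+ x. h y * indicator (ball x (dyadic i)) y \<partial>lborel \<partial>lborel)"
    by (rule lborel_pair.Fubini'[symmetric]) measurable
  also have "\<dots> = (\<integral>\<^sup>+ y. h y * ennreal (unit_ball_vol DIM('a) * dyadic i ^ DIM('a)) \<partial>lborel)"
  proof (rule nn_integral_cong)
    fix y :: 'a
    have "(\<integral>\<^sup>+ x. h y * indicator (ball x (dyadic i)) y \<partial>lborel) = (\<integral>\<^sup>+ x. h y * indicator (ball y (dyadic i)) x \<partial>lborel)"
      by (simp add: indicator_def dist_commute)
    then show "(\<integral>\<^sup>+ x. h y * indicator (ball x (dyadic i)) y \<partial>lborel) = h y * ennreal (unit_ball_vol DIM('a) * dyadic i ^ DIM('a))"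
      by (simp add: nn_integral_cmult_indicator emeasure_ball)
  qed
  also have "\<dots> = (\<integral>\<^sup>+ y. h y \<partial>lborel) * ennreal (unit_ball_vol DIM('a) * dyadic i ^ DIM('a))"
    by (rule nn_integral_multc) simp
  finally have E: "(\<integral>\<^sup>+ x. \<integral>\<^sup>+ y. h y * indicator (ball x (dyadic i)) y \<partial>lborel \<partial>lborel) = \<dots>" .
  have "(\<integral>\<^sup>+ x. ball_avg i h x \<partial>lborel) = ennreal (1 / dyadic i ^ DIM('a)) *
      (\<integral>\<^sup>+ x. \<integral>\<^sup>+ y. h y * indicator (ball x (dyadic i)) y \<partial>lborel \<partial>lborel)"
    unfolding ball_avg_def by (rule nn_integral_cmult) measurable
  also have "\<dots> = (ennreal (1 / dyadic i ^ DIM('a)) * ennreal (unit_ball_vol DIM('a) * dyadic i ^ DIM('a))) * (\<integral>\<^sup>+ y. h y \<partial>lborel)"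
    by (simp only: E mult_ac)
  also have "ennreal (1 / dyadic i ^ DIM('a)) * ennreal (unit_ball_vol DIM('a) * dyadic i ^ DIM('a)) = ennreal (unit_ball_vol DIM('a))"
    by (simp flip: ennreal_mult)
  finally show ?thesis .
qed

text \<open>Shifting the index to the first radius not exceeding \<open>R\<close> leaves a geometric
  series.\<close>

lemma suminf_dyadic_le:
  assumes s: "0 < s" and R: "0 < R"
  shows "(\<Sum>i. ennreal (dyadic i powr s) * indicator {r. r \<le> R} (dyadic i)) \<le> ennreal (R powr s / (1 - 2 powr - s))"
proof -
  define n where "n = (LEAST n. dyadic n \<le> R)"
  have ex: "\<exists>n. dyadic n \<le> R" using ex_dyadic_less[OF R] by (auto intro: less_imp_le)
  have n: "dyadic n \<le> R" unfolding n_def using ex by (rule LeastI_ex)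
  have before: "\<not> dyadic i \<le> R" if "i < n" for i using not_less_Least that unfolding n_def by blast
  have z: "2 powr - s < (1::real)" using s by (simp add: powr_less_one)
  let ?f = "\<lambda>i. ennreal (dyadic i powr s) * indicator {r. r \<le> R} (dyadic i)"
  have "(\<Sum>i. ?f i) = (\<Sum>i. ?f (i + n)) + (\<Sum>i<n. ?f i)"
    by (rule suminf_offset) auto
  also have "(\<Sum>i<n. ?f i) = 0" using before by (intro sum.neutral) auto
  also have "(\<Sum>i. ?f (i + n)) + 0 \<le> (\<Sum>i. ennreal (R powr s) * ennreal (dyadic i powr s))"
  proof (simp only: add_0_right, rule suminf_le)
    fix i
    have "dyadic (i + n) powr s \<le> R powr s * dyadic i powr s"
      using n s by (auto simp: dyadic_add powr_mult mult.commute intro!: mult_left_mono powr_mono2)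
    then show "?f (i + n) \<le> ennreal (R powr s) * ennreal (dyadic i powr s)"
      by (auto simp: indicator_def ennreal_leI simp flip: ennreal_mult)
  qed auto
  also have "\<dots> = ennreal (R powr s / (1 - 2 powr - s))"
    using z by (simp only: ennreal_suminf_cmult suminf_geometric_powr[OF s]) (simp flip: ennreal_mult)
  finally show ?thesis .
qed

text \<open>Only finitely many radii are at least \<open>R\<close>. Read backwards from the smallest
  of them, the partial sum is bounded by a geometric series.\<close>

lemma suminf_dyadic_ge:
  assumes s: "0 < s" and R: "0 < R"
  shows "(\<Sum>i. ennreal (dyadic i powr - s) * indicator {r. R \<le> r} (dyadic i)) \<le> ennreal (R powr - s / (1 - 2 powr - s))"
proof (rule suminf_le_const[OF summableI])
  let ?f = "\<lambda>i. ennreal (dyadic i powr - s) * indicator {r. R \<le> r} (dyadic i)"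
  have z: "2 powr - s < (1::real)" using s by (simp add: powr_less_one)
  fix n
  show "sum ?f {..<n} \<le> ennreal (R powr - s / (1 - 2 powr - s))"
  proof (induction n)
    case 0 then show ?case by simp
  next
    case (Suc m)
    show ?case
    proof (cases "R \<le> dyadic m")
      case False
      then show ?thesis using Suc by simp
    next
      case True
      have "sum ?f {..<Suc m} \<le> (\<Sum>i<Suc m. ennreal (R powr - s) * ennreal (dyadic (Suc m - Suc i) powr s))"
      proof (rule sum_mono)
        fix i assume "i \<in> {..<Suc m}"
        then have "dyadic m = dyadic i * dyadic (m - i)" by (simp flip: dyadic_add)
        then have e: "dyadic i = dyadic m / dyadic (m - i)" by simp
        have "dyadic m powr - s \<le> R powr - s" using True R s by (intro powr_mono2') auto
        then have "dyadic m powr - s * dyadic (m - i) powr s \<le> R powr - s * dyadic (m - i) powr s"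
          by (rule mult_right_mono) simp
        moreover have "dyadic i powr - s = dyadic m powr - s * dyadic (m - i) powr s"
          by (simp add: e powr_divide powr_minus field_simps)
        ultimately have "dyadic i powr - s \<le> R powr - s * dyadic (m - i) powr s" by simp
        then show "?f i \<le> ennreal (R powr - s) * ennreal (dyadic (Suc m - Suc i) powr s)"
          by (auto simp: indicator_def ennreal_leI simp flip: ennreal_mult)
      qed
      also have "\<dots> = (\<Sum>i<Suc m. ennreal (R powr - s) * ennreal (dyadic i powr s))"
        by (rule sum.nat_diff_reindex[where g="\<lambda>i. ennreal (R powr - s) * ennreal (dyadic i powr s)"])
      also have "\<dots> \<le> (\<Sum>i. ennreal (R powr - s) * ennreal (dyadic i powr s))"
        by (rule sum_le_suminf) auto
      also have "\<dots> = ennreal (R powr - s / (1 - 2 powr - s))"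
        using z by (simp only: ennreal_suminf_cmult suminf_geometric_powr[OF s]) (simp flip: ennreal_mult)
      finally show ?thesis .
    qed
  qed
qed

section \<open>Cauchy--Schwarz for averages and the square energies\<close>

lemma ball_avg_mono: "(\<And>y. y \<in> ball x (dyadic i) \<Longrightarrow> f y \<le> g y) \<Longrightarrow> ball_avg i f x \<le> ball_avg i g x"
  unfolding ball_avg_def by (intro mult_left_mono nn_integral_mono) (auto simp: indicator_def)

lemma ball_avg_cmult:
  assumes [measurable]: "f \<in> borel_measurable borel"
  shows "ball_avg i (\<lambda>y. c * f y) x = c * ball_avg i f (x::'a::euclidean_space)"
  unfolding ball_avg_def by (simp add: mult.assoc nn_integral_cmult mult.left_commute)

lemma ball_avg_add:
  assumes [measurable]: "f \<in> borel_measurable borel" "g \<in> borel_measurable borel"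
  shows "ball_avg i (\<lambda>y. f y + g y) x = ball_avg i f x + ball_avg i g (x::'a::euclidean_space)"
  unfolding ball_avg_def by (simp add: distrib_right nn_integral_add distrib_left)

lemma ball_avg_le_total:
  "ball_avg i h (x::'a::euclidean_space) \<le> ennreal (dyadic i powr (- DIM('a))) * (\<integral>\<^sup>+ y. h y \<partial>lborel)"
  unfolding ball_avg_def
  by (intro mult_mono nn_integral_mono ennreal_leI) (auto simp: indicator_def powr_minus powr_realpow field_simps)

text \<open>The function f is written as f \<delta>^(s/2) times \<delta>^(-s/2). This needs \<delta>
  > 0 almost everywhere, since \<open>0 powr x = 0\<close>.\<close>

lemma ball_avg_cauchy_schwarz:
  fixes f \<delta> :: "'a::euclidean_space \<Rightarrow> real" and s :: real
  assumes [measurable]: "f \<in> borel_measurable borel" "\<delta> \<in> borel_measurable borel"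
    and f: "\<And>y. 0 \<le> f y" and \<delta>: "AE y in lborel. 0 < \<delta> y" and C: "0 \<le> C"
    and H: "(\<integral>\<^sup>+ y. ennreal (\<delta> y powr (- s)) * indicator (ball x (dyadic i)) y \<partial>lborel)
       \<le> ennreal (C * dyadic i powr (DIM('a) - s))"
  shows "(ball_mean i f x)\<^sup>2 \<le>
     ennreal (C * dyadic i powr (- s)) * ball_avg i (\<lambda>y. ennreal ((f y)\<^sup>2 * \<delta> y powr s)) x"
proof -
  let ?B = "ball x (dyadic i)" let ?r = "dyadic i" let ?d = "DIM('a)"
  have "(\<integral>\<^sup>+ y. ennreal (f y) * indicator ?B y \<partial>lborel) =
     (\<integral>\<^sup>+ y. (ennreal (f y * \<delta> y powr (s / 2)) * indicator ?B y) * (ennreal (\<delta> y powr (- s / 2)) * indicator ?B y) \<partial>lborel)"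
  proof (rule nn_integral_cong_AE)
    show "AE y in lborel. ennreal (f y) * indicator ?B y =
      (ennreal (f y * \<delta> y powr (s / 2)) * indicator ?B y) * (ennreal (\<delta> y powr (- s / 2)) * indicator ?B y)"
      using \<delta>
    proof eventually_elim
      case (elim y)
      have "f y * \<delta> y powr (s / 2) * \<delta> y powr (- s / 2) = f y"
        using elim by (simp add: powr_minus)
      then show ?case using f[of y] by (auto simp: indicator_def simp flip: ennreal_mult)
    qed
  qed
  then have "(\<integral>\<^sup>+ y. ennreal (f y) * indicator ?B y \<partial>lborel)\<^sup>2 \<le>
     (\<integral>\<^sup>+ y. (ennreal (f y * \<delta> y powr (s / 2)) * indicator ?B y)\<^sup>2 \<partial>lborel) *
     (\<integral>\<^sup>+ y. (ennreal (\<delta> y powr (- s / 2)) * indicator ?B y)\<^sup>2 \<partial>lborel)"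
    by (simp only:) (rule Cauchy_Schwarz_nn_integral, measurable)
  also have "(\<integral>\<^sup>+ y. (ennreal (f y * \<delta> y powr (s / 2)) * indicator ?B y)\<^sup>2 \<partial>lborel) =
      (\<integral>\<^sup>+ y. ennreal ((f y)\<^sup>2 * \<delta> y powr s) * indicator ?B y \<partial>lborel)"
    using f by (intro nn_integral_cong)
      (auto simp: indicator_def power_mult_distrib ennreal_power power2_eq_square simp flip: powr_add ennreal_mult)
  also have "(\<integral>\<^sup>+ y. (ennreal (\<delta> y powr (- s / 2)) * indicator ?B y)\<^sup>2 \<partial>lborel) =
      (\<integral>\<^sup>+ y. ennreal (\<delta> y powr (- s)) * indicator ?B y \<partial>lborel)"
    by (intro nn_integral_cong) (auto simp: indicator_def ennreal_power power2_eq_square simp flip: powr_add ennreal_mult)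
  also have "(\<integral>\<^sup>+ y. ennreal ((f y)\<^sup>2 * \<delta> y powr s) * indicator ?B y \<partial>lborel) *
      (\<integral>\<^sup>+ y. ennreal (\<delta> y powr (- s)) * indicator ?B y \<partial>lborel) \<le>
     (ennreal (?r ^ ?d) * ball_avg i (\<lambda>y. ennreal ((f y)\<^sup>2 * \<delta> y powr s)) x) * ennreal (C * ?r powr (?d - s))"
    by (subst ball_integral_eq, measurable) (rule mult_left_mono[OF H], simp)
  finally have *: "(\<integral>\<^sup>+ y. ennreal (f y) * indicator ?B y \<partial>lborel)\<^sup>2 \<le> \<dots>" .
  have "(ball_mean i f x)\<^sup>2 = ennreal ((1 / ?r ^ ?d)\<^sup>2) * (\<integral>\<^sup>+ y. ennreal (f y) * indicator ?B y \<partial>lborel)\<^sup>2"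
    by (simp add: ball_avg_def power_mult_distrib ennreal_power)
  also have "\<dots> \<le> ennreal ((1 / ?r ^ ?d)\<^sup>2) *
     ((ennreal (?r ^ ?d) * ball_avg i (\<lambda>y. ennreal ((f y)\<^sup>2 * \<delta> y powr s)) x) * ennreal (C * ?r powr (?d - s)))"
    by (rule mult_left_mono[OF *]) simp
  also have "\<dots> = (ennreal ((1 / ?r ^ ?d)\<^sup>2) * ennreal (?r ^ ?d) * ennreal (C * ?r powr (?d - s))) * ball_avg i (\<lambda>y. ennreal ((f y)\<^sup>2 * \<delta> y powr s)) x"
    by (simp only: mult_ac)
  also have "ennreal ((1 / ?r ^ ?d)\<^sup>2) * ennreal (?r ^ ?d) * ennreal (C * ?r powr (?d - s)) = ennreal (C * ?r powr (- s))"
    using C by (simp add: power2_eq_square powr_diff powr_minus powr_realpow field_simps flip: ennreal_mult)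
  finally show ?thesis .
qed

text \<open>The case s = 0 for any \<delta>, an inequality because of \<open>0 powr 0 = 0\<close>.
  Through it the unweighted estimates reuse the weighted lemmas.\<close>

lemma unit_weight_integral:
  "(\<integral>\<^sup>+ y. ennreal (\<delta> y powr (- 0)) * indicator (ball (x::'a::euclidean_space) (dyadic i)) y \<partial>lborel)
     \<le> ennreal (unit_ball_vol DIM('a) * dyadic i powr (DIM('a) - (0::real)))"
proof -
  have "(\<integral>\<^sup>+ y. ennreal (\<delta> y powr (- 0)) * indicator (ball x (dyadic i)) y \<partial>lborel)
    \<le> (\<integral>\<^sup>+ y. indicator (ball x (dyadic i)) y \<partial>lborel)"
    by (intro nn_integral_mono) (auto simp: indicator_def)
  then show ?thesis by (simp add: emeasure_ball powr_realpow)
qed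

text \<open>Schur test: for balls far from the set \<open>{\<delta> = 0}\<close> the weight is comparable to a constant, while for the
  other balls Cauchy--Schwarz is applied with the slightly stronger weight \<open>\<delta> powr (\<gamma> + b)\<close>, so that the
  sum over the scales becomes geometric on both sides of \<open>\<delta> y\<close>.\<close>

lemma weighted_square_energy:
  fixes f \<delta> :: "'a::euclidean_space \<Rightarrow> real" and \<gamma> b C :: real
  assumes [measurable]: "f \<in> borel_measurable borel" "\<delta> \<in> borel_measurable borel"
    and f: "\<And>y. 0 \<le> f y" and \<delta>: "AE y in lborel. 0 < \<delta> y"
    and lip: "\<And>x y. \<delta> y \<le> \<delta> x + dist x y" and C: "0 \<le> C" and \<gamma>: "0 < \<gamma>" and b: "0 < b"
    and H: "\<And>x i. i0 \<le> i \<Longrightarrow> (\<integral>\<^sup>+ y. ennreal (\<delta> y powr (- (\<gamma> + b))) * indicator (ball x (dyadic i)) y \<partial>lborel)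
       \<le> ennreal (C * dyadic i powr (DIM('a) - (\<gamma> + b)))"
  shows "square_energy \<gamma> i0 f
    \<le> ennreal (unit_ball_vol DIM('a) * (unit_ball_vol DIM('a) + C) * (1 / (1 - 2 powr - \<gamma>) + 3 powr b / (1 - 2 powr - b))) *
      (\<integral>\<^sup>+ y. ennreal ((f y)\<^sup>2 * \<delta> y powr \<gamma>) \<partial>lborel)"
proof -
  let ?v = "unit_ball_vol DIM('a)"
  have v: "0 < ?v" using unit_ball_vol_pos[of "real DIM('a)"] by simp
  \<comment> \<open>A majorant for both kinds of balls. If \<delta> x \<ge> 2 r_i, then \<delta>
    \<ge> r_i on the ball about \<open>x\<close>; otherwise \<delta> < 3 r_i there. The two
    indicators record what this says about \<open>y\<close> alone, so that the sum over the scales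
    can be taken pointwise in \<open>y\<close>.\<close>
  define \<kappa> where "\<kappa> i y = indicator {r. r \<le> \<delta> y} (dyadic i) +
      ennreal (\<delta> y powr (\<gamma> + b)) * (ennreal (dyadic i powr - (\<gamma> + b)) * indicator {r. \<delta> y / 3 \<le> r} (dyadic i))" for i y
  have [measurable]: "\<kappa> i \<in> borel_measurable borel" for i
  proof -
    have "(\<lambda>y. indicator {y. dyadic i \<le> \<delta> y} y + ennreal (\<delta> y powr (\<gamma> + b)) *
        (ennreal (dyadic i powr - (\<gamma> + b)) * indicator {y. \<delta> y / 3 \<le> dyadic i} y)) \<in> borel_measurable borel"
      by measurable
    then show ?thesis by (simp add: \<kappa>_def[abs_def] indicator_def)
  qed
  define h where "h i y = ennreal ((f y)\<^sup>2) * \<kappa> i y" for i y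
  have [measurable]: "h i \<in> borel_measurable borel" for i unfolding h_def[abs_def] by measurable
  have point: "(ball_mean i f x)\<^sup>2 \<le> ennreal (?v + C) * ball_avg i (h i) x" if i: "i0 \<le> i" for x i
  proof (cases "2 * dyadic i \<le> \<delta> x")
    case True
    have "(ball_mean i f x)\<^sup>2 \<le> ennreal (?v * dyadic i powr (- 0)) * ball_avg i (\<lambda>y. ennreal ((f y)\<^sup>2 * \<delta> y powr 0)) x"
      by (rule ball_avg_cauchy_schwarz[OF _ _ f \<delta> _ unit_weight_integral]) (use v in auto)
    also have "\<dots> \<le> ennreal (?v + C) * ball_avg i (h i) x"
    proof (intro mult_mono ball_avg_mono ennreal_leI)
      fix y assume "y \<in> ball x (dyadic i)"
      then have "dyadic i \<le> \<delta> y" using lip[of x y] True by (simp add: dist_commute)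
      then have "1 \<le> \<kappa> i y" by (simp add: \<kappa>_def)
      then have "ennreal ((f y)\<^sup>2) * 1 \<le> h i y" unfolding h_def by (rule mult_left_mono) simp
      moreover have "ennreal ((f y)\<^sup>2 * \<delta> y powr 0) \<le> ennreal ((f y)\<^sup>2)" by (intro ennreal_leI) auto
      ultimately show "ennreal ((f y)\<^sup>2 * \<delta> y powr 0) \<le> h i y" by simp
    qed (use C in auto)
    finally show ?thesis .
  next
    case False
    have "(ball_mean i f x)\<^sup>2 \<le>
       ennreal (C * dyadic i powr (- (\<gamma> + b))) * ball_avg i (\<lambda>y. ennreal ((f y)\<^sup>2 * \<delta> y powr (\<gamma> + b))) x"
      by (rule ball_avg_cauchy_schwarz[OF _ _ f \<delta> C H[OF i]]) auto
    also have "\<dots> = ennreal C * ball_avg i (\<lambda>y. ennreal (dyadic i powr (- (\<gamma> + b))) * ennreal ((f y)\<^sup>2 * \<delta> y powr (\<gamma> + b))) x"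
      using C by (subst ball_avg_cmult) (simp_all add: ennreal_mult mult.assoc)
    also have "\<dots> \<le> ennreal (?v + C) * ball_avg i (h i) x"
    proof (intro mult_mono ball_avg_mono ennreal_leI)
      fix y assume "y \<in> ball x (dyadic i)"
      then have "\<delta> y / 3 \<le> dyadic i" using lip[of y x] False by simp
      then have "ennreal (\<delta> y powr (\<gamma> + b)) * ennreal (dyadic i powr - (\<gamma> + b)) \<le> \<kappa> i y" by (simp add: \<kappa>_def)
      then have "ennreal ((f y)\<^sup>2) * (ennreal (\<delta> y powr (\<gamma> + b)) * ennreal (dyadic i powr - (\<gamma> + b))) \<le> h i y"
        unfolding h_def by (rule mult_left_mono) simp
      then show "ennreal (dyadic i powr (- (\<gamma> + b))) * ennreal ((f y)\<^sup>2 * \<delta> y powr (\<gamma> + b)) \<le> h i y"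
        by (simp add: ennreal_mult mult_ac)
    qed (use v in auto)
    finally show ?thesis .
  qed
  have "square_energy \<gamma> i0 f
     \<le> (\<Sum>n. ennreal (dyadic (n + i0) powr \<gamma>) * (\<integral>\<^sup>+ x. ennreal (?v + C) * ball_avg (n + i0) (h (n + i0)) x \<partial>lborel))"
    by (intro suminf_le mult_left_mono nn_integral_mono point) auto
  also have "\<dots> = (\<Sum>n. ennreal (dyadic (n + i0) powr \<gamma>) * (ennreal (?v * (?v + C)) * (\<integral>\<^sup>+ y. h (n + i0) y \<partial>lborel)))"
    using v C by (simp add: nn_integral_cmult nn_integral_ball_avg ennreal_mult mult_ac)
  also have "\<dots> = ennreal (?v * (?v + C)) * (\<Sum>n. ennreal (dyadic (n + i0) powr \<gamma>) * (\<integral>\<^sup>+ y. h (n + i0) y \<partial>lborel))"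
    by (subst ennreal_suminf_cmult[symmetric]) (simp only: mult_ac)
  also have "\<dots> \<le> ennreal (?v * (?v + C)) * (\<Sum>n. ennreal (dyadic n powr \<gamma>) * (\<integral>\<^sup>+ y. h n y \<partial>lborel))"
    by (rule mult_left_mono[OF suminf_offset_le_ennreal[where f="\<lambda>n. ennreal (dyadic n powr \<gamma>) * (\<integral>\<^sup>+ y. h n y \<partial>lborel)"]]) simp
  also have "(\<Sum>n. ennreal (dyadic n powr \<gamma>) * (\<integral>\<^sup>+ y. h n y \<partial>lborel)) = (\<integral>\<^sup>+ y. (\<Sum>n. ennreal (dyadic n powr \<gamma>) * h n y) \<partial>lborel)"
    by (simp add: nn_integral_suminf nn_integral_cmult)
  also have "\<dots> \<le> (\<integral>\<^sup>+ y. ennreal (1 / (1 - 2 powr - \<gamma>) + 3 powr b / (1 - 2 powr - b)) * ennreal ((f y)\<^sup>2 * \<delta> y powr \<gamma>) \<partial>lborel)"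
  proof (rule nn_integral_mono_AE)
    show "AE y in lborel. (\<Sum>n. ennreal (dyadic n powr \<gamma>) * h n y) \<le>
       ennreal (1 / (1 - 2 powr - \<gamma>) + 3 powr b / (1 - 2 powr - b)) * ennreal ((f y)\<^sup>2 * \<delta> y powr \<gamma>)"
      using \<delta>
    proof eventually_elim
      case (elim y)
      \<comment> \<open>After multiplication by r_n^\<gamma> the exponents are \<gamma> for the
        scales below \<delta> y and - b for those above \<delta> y / 3. With the factor
        \<delta>^(\<gamma>+b) restored, each part sums to a multiple of \<delta>^\<gamma>.\<close>
      let ?a = "\<lambda>n. ennreal (dyadic n powr \<gamma>) * indicator {r. r \<le> \<delta> y} (dyadic n)"
      let ?c = "\<lambda>n. ennreal (dyadic n powr - b) * indicator {r. \<delta> y / 3 \<le> r} (dyadic n)"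
      have z: "2 powr - \<gamma> < (1::real)" "2 powr - b < (1::real)" using \<gamma> b by (simp_all add: powr_less_one)
      have "(\<Sum>n. ennreal (dyadic n powr \<gamma>) * h n y) = (\<Sum>n. ennreal ((f y)\<^sup>2) * (?a n + ennreal (\<delta> y powr (\<gamma> + b)) * ?c n))"
      proof (intro suminf_cong)
        fix n
        have alg: "G * (F * (I + D * (E * J))) = F * (G * I + D * ((G * E) * J))" for G F I D E J :: ennreal
          by (simp add: distrib_left mult_ac)
        have "ennreal (dyadic n powr \<gamma>) * ennreal (dyadic n powr - (\<gamma> + b)) = ennreal (dyadic n powr - b)"
          by (simp flip: ennreal_mult powr_add)
        then show "ennreal (dyadic n powr \<gamma>) * h n y = ennreal ((f y)\<^sup>2) * (?a n + ennreal (\<delta> y powr (\<gamma> + b)) * ?c n)"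
          unfolding h_def \<kappa>_def by (simp only: alg)
      qed
      also have "\<dots> = ennreal ((f y)\<^sup>2) * ((\<Sum>n. ?a n) + ennreal (\<delta> y powr (\<gamma> + b)) * (\<Sum>n. ?c n))"
        by (simp only: ennreal_suminf_cmult suminf_add[symmetric] summableI)
      also have "\<dots> \<le> ennreal ((f y)\<^sup>2) * (ennreal (\<delta> y powr \<gamma> / (1 - 2 powr - \<gamma>)) +
          ennreal (\<delta> y powr (\<gamma> + b)) * ennreal ((\<delta> y / 3) powr - b / (1 - 2 powr - b)))"
        using elim by (intro mult_left_mono add_mono suminf_dyadic_le[OF \<gamma>] suminf_dyadic_ge[OF b]) auto
      also have "\<dots> = ennreal ((f y)\<^sup>2 * (\<delta> y powr \<gamma> / (1 - 2 powr - \<gamma>) + \<delta> y powr (\<gamma> + b) * ((\<delta> y / 3) powr - b / (1 - 2 powr - b))))"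
        using z by (simp flip: ennreal_mult ennreal_plus)
      also have "(f y)\<^sup>2 * (\<delta> y powr \<gamma> / (1 - 2 powr - \<gamma>) + \<delta> y powr (\<gamma> + b) * ((\<delta> y / 3) powr - b / (1 - 2 powr - b)))
        = (1 / (1 - 2 powr - \<gamma>) + 3 powr b / (1 - 2 powr - b)) * ((f y)\<^sup>2 * \<delta> y powr \<gamma>)"
      proof -
        have "\<delta> y powr (\<gamma> + b) * (\<delta> y / 3) powr - b = 3 powr b * \<delta> y powr \<gamma>"
          using elim by (simp add: powr_divide powr_minus powr_add field_simps)
        then have "\<delta> y powr (\<gamma> + b) * ((\<delta> y / 3) powr - b / (1 - 2 powr - b)) = 3 powr b * \<delta> y powr \<gamma> / (1 - 2 powr - b)"
          by simp
        then show ?thesis by (simp only:) (simp add: algebra_simps)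
      qed
      finally show ?case using z by (subst ennreal_mult[symmetric]) simp_all
    qed
  qed
  also have "\<dots> = ennreal (1 / (1 - 2 powr - \<gamma>) + 3 powr b / (1 - 2 powr - b)) * (\<integral>\<^sup>+ y. ennreal ((f y)\<^sup>2 * \<delta> y powr \<gamma>) \<partial>lborel)"
    by (rule nn_integral_cmult) simp
  also have "ennreal (?v * (?v + C)) * \<dots> = ennreal (?v * (?v + C) * (1 / (1 - 2 powr - \<gamma>) + 3 powr b / (1 - 2 powr - b))) *
      (\<integral>\<^sup>+ y. ennreal ((f y)\<^sup>2 * \<delta> y powr \<gamma>) \<partial>lborel)"
  proof -
    have "2 powr - \<gamma> < (1::real)" "2 powr - b < (1::real)" using \<gamma> b by (simp_all add: powr_less_one)
    then have "0 \<le> 1 / (1 - 2 powr - \<gamma>) + 3 powr b / (1 - 2 powr - b)" by simp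
    then show ?thesis using v C by (simp add: ennreal_mult mult.assoc)
  qed
  finally show ?thesis by (simp add: mult_left_mono)
qed

text \<open>Every scale has the same bound by the squared norm, so the convergence comes from the
  factor r_n^\<eta> alone.\<close>

lemma unweighted_square_energy:
  fixes f :: "'a::euclidean_space \<Rightarrow> real" and \<eta> :: real
  assumes [measurable]: "f \<in> borel_measurable borel" and f: "\<And>y. 0 \<le> f y" and \<eta>: "0 < \<eta>"
  shows "square_energy \<eta> i0 f
    \<le> ennreal ((unit_ball_vol DIM('a))\<^sup>2 / (1 - 2 powr - \<eta>)) * (\<integral>\<^sup>+ y. ennreal ((f y)\<^sup>2) \<partial>lborel)"
proof -
  let ?v = "unit_ball_vol DIM('a)" let ?N = "\<integral>\<^sup>+ y. ennreal ((f y)\<^sup>2) \<partial>lborel"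
  have v: "0 < ?v" using unit_ball_vol_pos[of "real DIM('a)"] by simp
  have z: "2 powr - \<eta> < (1::real)" using \<eta> by (simp add: powr_less_one)
  have "(ball_mean i f x)\<^sup>2 \<le> ennreal ?v * ball_avg i (\<lambda>y. ennreal ((f y)\<^sup>2)) x" for i x
    using ball_avg_cauchy_schwarz[OF assms(1) borel_measurable_const[of 1] f _ _ unit_weight_integral, where x=x and i=i] v by simp
  then have "(\<integral>\<^sup>+ x. (ball_mean i f x)\<^sup>2 \<partial>lborel) \<le> (\<integral>\<^sup>+ x. ennreal ?v * ball_avg i (\<lambda>y. ennreal ((f y)\<^sup>2)) x \<partial>lborel)" for i
    by (intro nn_integral_mono)
  also have "(\<integral>\<^sup>+ x. ennreal ?v * ball_avg i (\<lambda>y. ennreal ((f y)\<^sup>2)) x \<partial>lborel) = ennreal (?v\<^sup>2) * ?N" for i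
    using v by (simp add: nn_integral_cmult nn_integral_ball_avg power2_eq_square ennreal_mult mult.assoc)
  finally have "square_energy \<eta> i0 f
     \<le> (\<Sum>n. ennreal (dyadic (n + i0) powr \<eta>) * (ennreal (?v\<^sup>2) * ?N))"
    by (intro suminf_le mult_left_mono) auto
  also have "\<dots> \<le> (\<Sum>n. ennreal (dyadic n powr \<eta>) * (ennreal (?v\<^sup>2) * ?N))"
    by (rule suminf_offset_le_ennreal[where f="\<lambda>n. ennreal (dyadic n powr \<eta>) * (ennreal (?v\<^sup>2) * ?N)"])
  also have "\<dots> = ennreal (?v\<^sup>2 / (1 - 2 powr - \<eta>)) * ?N"
    using z by (simp only: ennreal_suminf_multc suminf_geometric_powr[OF \<eta>]) (simp add: mult.assoc[symmetric] flip: ennreal_mult)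
  finally show ?thesis .
qed

section \<open>From squares to q-th powers\<close>

lemma power2_le_ennreal:
  assumes "A\<^sup>2 \<le> (ennreal r)\<^sup>2" "0 \<le> r"
  shows "A \<le> ennreal r"
proof (cases A)
  case (real a)
  then have "a\<^sup>2 \<le> r\<^sup>2" using assms by (simp add: ennreal_power)
  then have "a \<le> r" using assms(2) by (rule power2_le_imp_le)
  then show ?thesis using real by (simp add: ennreal_leI)
next
  case top
  then show ?thesis using assms by (simp add: ennreal_power power_eq_top_ennreal top_unique)
qed

lemma powr_half_shift: "0 \<le> N \<Longrightarrow> N powr ((q - 2) / 2) * N = N powr (q / 2)" for N q :: real
  using powr_mult_base[of N "(q - 2) / 2"] by (simp add: field_simps)

text \<open>\<open>sup\<close> is spent on q - 2 factors and \<open>sq\<close> on the remaining two.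
  \<open>\<kappa>\<close> is any exponent not above the one left over: \<gamma> in the weighted
  case, 2 (1 - \<theta>) for \<gamma> = 0 and q = 2.\<close>

lemma avg_energy_le_square:
  fixes f :: "'a::euclidean_space \<Rightarrow> real" and \<gamma> q \<theta> \<kappa> C K N :: real
  assumes [measurable]: "f \<in> borel_measurable borel"
    and C: "0 \<le> C" and K: "0 \<le> K" and N: "0 \<le> N" and q: "2 \<le> q"
    and sup: "\<And>x i. i0 \<le> i \<Longrightarrow> (ball_mean i f x)\<^sup>2 \<le> ennreal (C * dyadic i powr (- (DIM('a) + \<gamma>)) * N)"
    and sq: "square_energy \<kappa> i0 f \<le> ennreal (K * N)"
    and ex: "\<kappa> \<le> q * (1 - \<theta>) - (DIM('a) + \<gamma>) * (q - 2) / 2"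
  shows "avg_energy \<theta> q i0 (\<lambda>y. ennreal (f y)) \<le> ennreal (C powr ((q - 2) / 2) * K * N powr (q / 2))"
proof -
  let ?A = "\<lambda>i x. ball_mean i f x"
  let ?c = "C powr ((q - 2) / 2) * N powr ((q - 2) / 2)"
  \<comment> \<open>Needed because \<open>enn2real\<close> sends infinity to 0.\<close>
  have fin: "?A i x = ennreal (enn2real (?A i x))" if "i0 \<le> i" for i x
  proof -
    have "?A i x \<noteq> top"
    proof
      assume "?A i x = top"
      then have "(?A i x)\<^sup>2 = top" by (simp add: power_eq_top_ennreal)
      then show False using sup[OF that, of x] by (simp add: top_unique)
    qed
    then show ?thesis by (simp add: less_top)
  qed
  have scale_le: "ennreal (dyadic i powr (q * (1 - \<theta>))) * (\<integral>\<^sup>+ x. ennreal (enn2real (?A i x) powr q) \<partial>lborel)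
     \<le> ennreal ?c * (ennreal (dyadic i powr \<kappa>) * (\<integral>\<^sup>+ x. (?A i x)\<^sup>2 \<partial>lborel))" if i: "i0 \<le> i" for i
  proof -
    let ?m = "C * dyadic i powr (- (DIM('a) + \<gamma>)) * N"
    have m: "0 \<le> ?m" using C N by simp
    have "ennreal (enn2real (?A i x) powr q) \<le> ennreal (?m powr ((q - 2) / 2)) * (?A i x)\<^sup>2" for x
    proof -
      define a where "a = enn2real (?A i x)"
      have a: "0 \<le> a" "?A i x = ennreal a" using fin[OF i] by (simp_all add: a_def)
      have "a\<^sup>2 \<le> ?m" using sup[OF i, of x] a m by (simp add: ennreal_power)
      have "a powr q = (a\<^sup>2) powr ((q - 2) / 2) * a\<^sup>2"
      proof (cases "a = 0")
        case False
        then have "0 < a" using a by simp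
        then have "a\<^sup>2 = a powr 2" by (simp add: powr_numeral)
        moreover have "2 * ((q - 2) / 2) + 2 = q" by (simp add: field_simps)
        ultimately show ?thesis by (simp only: powr_powr powr_add[symmetric])
      qed (use q in simp)
      also have "\<dots> \<le> ?m powr ((q - 2) / 2) * a\<^sup>2"
        using \<open>a\<^sup>2 \<le> ?m\<close> q by (intro mult_right_mono powr_mono2) auto
      finally have "a powr q \<le> ?m powr ((q - 2) / 2) * a\<^sup>2" .
      then show ?thesis using a by (simp add: ennreal_power ennreal_leI flip: a_def ennreal_mult)
    qed
    then have "(\<integral>\<^sup>+ x. ennreal (enn2real (?A i x) powr q) \<partial>lborel) \<le> (\<integral>\<^sup>+ x. ennreal (?m powr ((q - 2) / 2)) * (?A i x)\<^sup>2 \<partial>lborel)"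
      by (intro nn_integral_mono)
    also have "\<dots> = ennreal (?m powr ((q - 2) / 2)) * (\<integral>\<^sup>+ x. (?A i x)\<^sup>2 \<partial>lborel)"
      by (rule nn_integral_cmult) simp
    finally have "ennreal (dyadic i powr (q * (1 - \<theta>))) * (\<integral>\<^sup>+ x. ennreal (enn2real (?A i x) powr q) \<partial>lborel)
       \<le> ennreal (dyadic i powr (q * (1 - \<theta>))) * (ennreal (?m powr ((q - 2) / 2)) * (\<integral>\<^sup>+ x. (?A i x)\<^sup>2 \<partial>lborel))"
      by (rule mult_left_mono) simp
    also have "\<dots> = ennreal (dyadic i powr (q * (1 - \<theta>)) * ?m powr ((q - 2) / 2)) * (\<integral>\<^sup>+ x. (?A i x)\<^sup>2 \<partial>lborel)"
      by (simp add: ennreal_mult mult.assoc)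
    also have "\<dots> \<le> ennreal (?c * dyadic i powr \<kappa>) * (\<integral>\<^sup>+ x. (?A i x)\<^sup>2 \<partial>lborel)"
    proof (intro mult_right_mono ennreal_leI)
      have "dyadic i powr (q * (1 - \<theta>)) * ?m powr ((q - 2) / 2) = ?c * dyadic i powr (q * (1 - \<theta>) - (DIM('a) + \<gamma>) * (q - 2) / 2)"
      proof -
        let ?e = "- (DIM('a) + \<gamma>)" and ?s = "(q - 2) / 2"
        have "?m powr ?s = C powr ?s * dyadic i powr (?e * ?s) * N powr ?s"
          using C N by (simp add: powr_mult powr_powr)
        then have "dyadic i powr (q * (1 - \<theta>)) * ?m powr ?s = ?c * (dyadic i powr (q * (1 - \<theta>)) * dyadic i powr (?e * ?s))"
          by (simp only: mult_ac)
        also have "dyadic i powr (q * (1 - \<theta>)) * dyadic i powr (?e * ?s) = dyadic i powr (q * (1 - \<theta>) - (DIM('a) + \<gamma>) * (q - 2) / 2)"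
          by (simp only: powr_add[symmetric] mult_minus_left times_divide_eq_right diff_conv_add_uminus minus_divide_left)
        finally show ?thesis .
      qed
      \<comment> \<open>The radii are at most 1, so lowering the exponent enlarges the
        power.\<close>
      also have "\<dots> \<le> ?c * dyadic i powr \<kappa>"
        using ex by (intro mult_left_mono powr_mono') auto
      finally show "dyadic i powr (q * (1 - \<theta>)) * ?m powr ((q - 2) / 2) \<le> ?c * dyadic i powr \<kappa>" .
    qed simp
    finally show ?thesis by (simp add: ennreal_mult mult.assoc)
  qed
  have "avg_energy \<theta> q i0 (\<lambda>y. ennreal (f y)) \<le> (\<Sum>n. ennreal ?c * (ennreal (dyadic (n + i0) powr \<kappa>) * (\<integral>\<^sup>+ x. (?A (n + i0) x)\<^sup>2 \<partial>lborel)))"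
    unfolding avg_energy_def by (intro suminf_le scale_le) auto
  also have "\<dots> \<le> ennreal ?c * ennreal (K * N)"
    by (simp only: ennreal_suminf_cmult) (rule mult_left_mono[OF sq], simp)
  also have "\<dots> = ennreal (C powr ((q - 2) / 2) * K * N powr (q / 2))"
  proof -
    have "N powr ((q - 2) / 2) * N = N powr (q / 2)"
      using N by (intro powr_half_shift) simp
    then have "?c * (K * N) = C powr ((q - 2) / 2) * K * N powr (q / 2)" by (simp add: mult_ac)
    then show ?thesis using K N by (simp flip: ennreal_mult)
  qed
  finally show ?thesis .
qed

text \<open>The critical case without weight. An average \<open>a\<close> of \<open>f\<close> over a ball is at most twice the average of
  \<open>f\<close> restricted to \<open>{2 v f > a}\<close>, \<open>v\<close> being the volume of the unit ball. Hence \<open>a powr q\<close> is controlled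
  by the average of \<open>f min(2 v f, \<rho>)\<^sup>q\<^sup>-\<^sup>1\<close>, where \<open>\<rho>\<close> is the Cauchy--Schwarz bound for \<open>a\<close>,
  and this sums geometrically over the scales.\<close>

lemma ball_avg_powr_le:
  fixes f :: "'a::euclidean_space \<Rightarrow> real" and q \<rho> :: real
  assumes [measurable]: "f \<in> borel_measurable borel" and f: "\<And>y. 0 \<le> f y" and q: "1 < q" and \<rho>: "0 \<le> \<rho>"
    and le: "ball_mean i f x \<le> ennreal \<rho>"
  shows "ennreal (enn2real (ball_mean i f x) powr q) \<le>
    ennreal 2 * ball_avg i (\<lambda>y. ennreal (f y * min (2 * unit_ball_vol DIM('a) * f y) \<rho> powr (q - 1))) x"
proof -
  let ?v = "unit_ball_vol DIM('a)"
  have v: "0 < ?v" using unit_ball_vol_pos[of "real DIM('a)"] by simp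
  let ?A = "ball_mean i f x"
  define a where "a = enn2real ?A"
  have Aa: "?A = ennreal a" "0 \<le> a" using le_less_trans[OF le ennreal_less_top] by (simp_all add: a_def)
  have a\<rho>: "a \<le> \<rho>" using le Aa \<rho> by simp
  define g where "g y = f y * indicator {y. a < 2 * ?v * f y} y" for y
  have [measurable]: "g \<in> borel_measurable borel" unfolding g_def[abs_def] by measurable
  have g0: "0 \<le> g y" for y using f by (simp add: g_def)
  have B1: "ball_mean i g x \<le> ?A"
    using f by (intro ball_avg_mono ennreal_leI) (auto simp: g_def indicator_def)
  then obtain G where G: "ball_mean i g x = ennreal G" "0 \<le> G"
    using Aa by (cases "ball_mean i g x") (auto simp: top_unique)
  \<comment> \<open>The part of f removed from \<open>g\<close> is at most a / (2 v), and this
    constant has average a / 2 because 1 has average v. So at least half of \<open>a\<close>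
    survives in \<open>g\<close>.\<close>
  have "?A \<le> ball_avg i (\<lambda>y. ennreal (g y) + ennreal (a / (2 * ?v)) * 1) x"
  proof (rule ball_avg_mono)
    fix y
    have "f y \<le> g y + a / (2 * ?v)" using v Aa(2) f[of y] by (auto simp: g_def indicator_def field_simps)
    then show "ennreal (f y) \<le> ennreal (g y) + ennreal (a / (2 * ?v)) * 1"
      using g0[of y] v Aa(2) by (simp add: ennreal_leI flip: ennreal_plus)
  qed
  also have "\<dots> = ennreal G + ennreal (a / (2 * ?v)) * ball_avg i (\<lambda>_. 1) x"
    by (subst ball_avg_add) (simp_all add: ball_avg_cmult G del: mult_1_right)
  also have "ball_avg i (\<lambda>_. 1) x = ennreal ?v"
    by (simp add: ball_avg_def emeasure_ball flip: ennreal_mult)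
  also have "ennreal G + ennreal (a / (2 * ?v)) * ennreal ?v = ennreal (G + a / 2)"
    using v less_imp_neq[OF v] Aa(2) G by (simp flip: ennreal_mult ennreal_plus)
  finally have "ennreal a \<le> ennreal (G + a / 2)" by (simp only: Aa)
  then have "a \<le> G + a / 2" using G Aa(2) by (subst (asm) ennreal_le_iff) auto
  then have "a \<le> 2 * G" by simp
  have "a powr q = a powr (q - 1) * a"
    using Aa(2) q by (cases "a = 0") (auto simp: powr_diff)
  also have "\<dots> \<le> a powr (q - 1) * (2 * G)"
    using \<open>a \<le> 2 * G\<close> by (rule mult_left_mono) simp
  finally have "ennreal (a powr q) \<le> ennreal (2 * (a powr (q - 1) * G))"
    by (intro ennreal_leI) simp
  also have "\<dots> = ennreal 2 * (ennreal (a powr (q - 1)) * ball_mean i g x)"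
    using G(2) unfolding G(1) by (simp add: ennreal_mult)
  also have "ennreal (a powr (q - 1)) * ball_mean i g x =
     ball_avg i (\<lambda>y. ennreal (a powr (q - 1)) * ennreal (g y)) x"
    by (rule ball_avg_cmult[symmetric]) simp
  also have "\<dots> \<le> ball_avg i (\<lambda>y. ennreal (f y * min (2 * ?v * f y) \<rho> powr (q - 1))) x"
  proof (rule ball_avg_mono)
    fix y
    have "a powr (q - 1) * g y \<le> f y * min (2 * ?v * f y) \<rho> powr (q - 1)"
    proof (cases "a < 2 * ?v * f y")
      case True
      then have "a powr (q - 1) \<le> min (2 * ?v * f y) \<rho> powr (q - 1)"
        using Aa(2) a\<rho> q by (intro powr_mono2) auto
      then show ?thesis using f[of y] True by (simp add: g_def mult.commute mult_left_mono)
    next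
      case False
      then show ?thesis using f[of y] by (simp add: g_def)
    qed
    then show "ennreal (a powr (q - 1)) * ennreal (g y) \<le> ennreal (f y * min (2 * ?v * f y) \<rho> powr (q - 1))"
      using g0 by (simp add: ennreal_leI flip: ennreal_mult)
  qed
  finally show ?thesis by (simp add: a_def mult_left_mono)
qed

text \<open>The two entries of the minimum cross at the radius \<open>R\<close>. Below
  \<open>R\<close> the terms are bounded by a positive power of the radius, because q > 2; above it
  by the power with exponent - d / 2. Both parts are geometric and dominated by their value at
  \<open>R\<close>.\<close>

lemma suminf_dyadic_min_le:
  fixes a \<rho> q d :: real
  assumes a: "0 \<le> a" and \<rho>: "0 \<le> \<rho>" and q: "2 < q" and d: "0 < d"
  shows "(\<Sum>i. ennreal (dyadic i powr (d * (q - 2) / 2) * min a (\<rho> * dyadic i powr (- d / 2)) powr (q - 1)))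
    \<le> ennreal ((1 / (1 - 2 powr - (d * (q - 2) / 2)) + 1 / (1 - 2 powr - (d / 2))) * \<rho> powr (q - 2) * a)"
proof (cases "a = 0 \<or> \<rho> = 0")
  case True
  have "min a (\<rho> * dyadic i powr (- d / 2)) = 0" for i
    using True a \<rho> by (auto simp: min_def)
  then show ?thesis using True q by simp
next
  case False
  then have pos: "0 < a" "0 < \<rho>" using a \<rho> by auto
  define \<sigma> where "\<sigma> = d * (q - 2) / 2"
  have \<sigma>: "0 < \<sigma>" using q d by (simp add: \<sigma>_def)
  define R where "R = (\<rho> / a) powr (2 / d)"
  have R: "0 < R" using pos by (simp add: R_def)
  have z: "2 powr - \<sigma> < (1::real)" "2 powr - (d / 2) < (1::real)" using \<sigma> d by (simp_all add: powr_less_one)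
  have "(\<Sum>i. ennreal (dyadic i powr \<sigma> * min a (\<rho> * dyadic i powr (- d / 2)) powr (q - 1))) \<le>
    (\<Sum>i. ennreal (a powr (q - 1)) * (ennreal (dyadic i powr \<sigma>) * indicator {r. r \<le> R} (dyadic i)) +
       ennreal (\<rho> powr (q - 1)) * (ennreal (dyadic i powr - (d / 2)) * indicator {r. R \<le> r} (dyadic i)))"
  proof (rule suminf_le)
    fix i
    have m0: "0 \<le> min a (\<rho> * dyadic i powr (- d / 2))" using pos by simp
    show "ennreal (dyadic i powr \<sigma> * min a (\<rho> * dyadic i powr (- d / 2)) powr (q - 1)) \<le>
       ennreal (a powr (q - 1)) * (ennreal (dyadic i powr \<sigma>) * indicator {r. r \<le> R} (dyadic i)) +
       ennreal (\<rho> powr (q - 1)) * (ennreal (dyadic i powr - (d / 2)) * indicator {r. R \<le> r} (dyadic i))"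
    proof (cases "dyadic i \<le> R")
      case True
      have "min a (\<rho> * dyadic i powr (- d / 2)) powr (q - 1) \<le> a powr (q - 1)"
        using m0 q by (intro powr_mono2) auto
      then have "dyadic i powr \<sigma> * min a (\<rho> * dyadic i powr (- d / 2)) powr (q - 1) \<le> dyadic i powr \<sigma> * a powr (q - 1)"
        by (rule mult_left_mono) simp
      then have "ennreal (dyadic i powr \<sigma> * min a (\<rho> * dyadic i powr (- d / 2)) powr (q - 1)) \<le>
         ennreal (a powr (q - 1)) * (ennreal (dyadic i powr \<sigma>) * indicator {r. r \<le> R} (dyadic i))"
        using True by (simp add: ennreal_leI mult.commute flip: ennreal_mult)
      then show ?thesis by (rule add_increasing2[rotated]) simp
    next
      case False
      have "min a (\<rho> * dyadic i powr (- d / 2)) powr (q - 1) \<le> (\<rho> * dyadic i powr (- d / 2)) powr (q - 1)"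
        using m0 q by (intro powr_mono2) auto
      also have "\<dots> = \<rho> powr (q - 1) * dyadic i powr (- d / 2 * (q - 1))"
        using pos by (simp add: powr_mult powr_powr)
      finally have "dyadic i powr \<sigma> * min a (\<rho> * dyadic i powr (- d / 2)) powr (q - 1) \<le>
         dyadic i powr \<sigma> * (\<rho> powr (q - 1) * dyadic i powr (- d / 2 * (q - 1)))"
        by (rule mult_left_mono) simp
      also have "\<dots> = \<rho> powr (q - 1) * (dyadic i powr \<sigma> * dyadic i powr (- d / 2 * (q - 1)))" by (simp only: mult_ac)
      also have "dyadic i powr \<sigma> * dyadic i powr (- d / 2 * (q - 1)) = dyadic i powr - (d / 2)"
        by (simp add: \<sigma>_def field_simps flip: powr_add)
      finally have "ennreal (dyadic i powr \<sigma> * min a (\<rho> * dyadic i powr (- d / 2)) powr (q - 1)) \<le>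
         ennreal (\<rho> powr (q - 1)) * (ennreal (dyadic i powr - (d / 2)) * indicator {r. R \<le> r} (dyadic i))"
        using False by (simp add: ennreal_leI flip: ennreal_mult)
      then show ?thesis by (rule add_increasing[rotated]) simp
    qed
  qed auto
  also have "\<dots> = ennreal (a powr (q - 1)) * (\<Sum>i. ennreal (dyadic i powr \<sigma>) * indicator {r. r \<le> R} (dyadic i)) +
       ennreal (\<rho> powr (q - 1)) * (\<Sum>i. ennreal (dyadic i powr - (d / 2)) * indicator {r. R \<le> r} (dyadic i))"
    by (simp only: ennreal_suminf_cmult suminf_add[symmetric] summableI)
  also have "\<dots> \<le> ennreal (a powr (q - 1)) * ennreal (R powr \<sigma> / (1 - 2 powr - \<sigma>)) +
       ennreal (\<rho> powr (q - 1)) * ennreal (R powr - (d / 2) / (1 - 2 powr - (d / 2)))"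
    using \<sigma> d R by (intro add_mono mult_left_mono suminf_dyadic_le suminf_dyadic_ge) auto
  also have "\<dots> = ennreal (a powr (q - 1) * (R powr \<sigma> / (1 - 2 powr - \<sigma>)) + \<rho> powr (q - 1) * (R powr - (d / 2) / (1 - 2 powr - (d / 2))))"
    using z by (simp flip: ennreal_mult ennreal_plus)
  also have "R powr \<sigma> = \<rho> powr (q - 2) / a powr (q - 2)"
  proof -
    have "2 / d * (d * (q - 2) / 2) = q - 2" using d by simp
    then show ?thesis unfolding R_def \<sigma>_def powr_powr by (simp only:) (use pos in \<open>simp add: powr_divide\<close>)
  qed
  also have "R powr - (d / 2) = a / \<rho>"
    using d pos by (simp add: R_def powr_powr powr_divide powr_minus)
  also have "a powr (q - 1) * (\<rho> powr (q - 2) / a powr (q - 2) / (1 - 2 powr - \<sigma>)) + \<rho> powr (q - 1) * (a / \<rho> / (1 - 2 powr - (d / 2)))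
     = (1 / (1 - 2 powr - \<sigma>) + 1 / (1 - 2 powr - (d / 2))) * \<rho> powr (q - 2) * a"
  proof -
    have "a powr (q - 1) = a powr (q - 2) * a" "\<rho> powr (q - 1) = \<rho> powr (q - 2) * \<rho>"
      using pos powr_add[of a "q - 2" 1] powr_add[of \<rho> "q - 2" 1] by simp_all
    moreover have "a powr (q - 2) \<noteq> 0" using pos by simp
    ultimately show ?thesis using pos by (simp add: distrib_right)
  qed
  finally show ?thesis by (simp add: \<sigma>_def)
qed

text \<open>The sum over the scales is taken pointwise inside the integral:
  \<open>suminf_dyadic_min_le\<close> turns the truncated powers into a multiple of f(y), which
  together with the remaining factor f(y) restores the square.\<close>

lemma unweighted_critical_energy:
  fixes f :: "'a::euclidean_space \<Rightarrow> real" and q \<theta> N :: real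
  assumes [measurable]: "f \<in> borel_measurable borel" and f: "\<And>y. 0 \<le> f y"
    and N: "0 \<le> N" "(\<integral>\<^sup>+ y. ennreal ((f y)\<^sup>2) \<partial>lborel) = ennreal N" and q: "2 < q"
    and ex: "DIM('a) * (q - 2) / 2 \<le> q * (1 - \<theta>)"
  shows "avg_energy \<theta> q i0 (\<lambda>y. ennreal (f y)) \<le>
    ennreal (2 * unit_ball_vol DIM('a) * (1 / (1 - 2 powr - (DIM('a) * (q - 2) / 2)) + 1 / (1 - 2 powr - (DIM('a) / 2))) *
      (unit_ball_vol DIM('a) powr ((q - 2) / 2) * (2 * unit_ball_vol DIM('a))) * N powr (q / 2))"
proof -
  let ?v = "unit_ball_vol DIM('a)" let ?d = "real DIM('a)"
  have v: "0 < ?v" using unit_ball_vol_pos[of "real DIM('a)"] by simp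
  define \<sigma> where "\<sigma> = ?d * (q - 2) / 2"
  \<comment> \<open>By Cauchy--Schwarz the average at scale i is at most \<rho> r_i^(-d/2).\<close>
  define \<rho> where "\<rho> = sqrt (?v * N)"
  have \<rho>: "0 \<le> \<rho>" using v N by (simp add: \<rho>_def)
  define K where "K = 1 / (1 - 2 powr - \<sigma>) + 1 / (1 - 2 powr - (?d / 2))"
  have "0 < \<sigma>" using q by (simp add: \<sigma>_def)
  have z: "2 powr - \<sigma> < (1::real)" "2 powr - (?d / 2) < (1::real)"
    using \<open>0 < \<sigma>\<close> by (simp_all add: powr_less_one)
  then have K: "0 \<le> K" by (simp add: K_def)
  let ?A = "\<lambda>i x. ball_mean i f x"
  let ?m = "\<lambda>i y. min (2 * ?v * f y) (\<rho> * dyadic i powr (- ?d / 2)) powr (q - 1)"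
  have sup: "?A i x \<le> ennreal (\<rho> * dyadic i powr (- ?d / 2))" for i x
  proof -
    have "(?A i x)\<^sup>2 \<le> ennreal ?v * ball_avg i (\<lambda>y. ennreal ((f y)\<^sup>2)) x"
      using ball_avg_cauchy_schwarz[OF assms(1) borel_measurable_const[of 1] f _ _ unit_weight_integral, where x=x and i=i] v by simp
    also have "\<dots> \<le> ennreal ?v * (ennreal (dyadic i powr (- ?d)) * ennreal N)"
      using ball_avg_le_total[of i "\<lambda>y. ennreal ((f y)\<^sup>2)" x] N by (intro mult_left_mono) auto
    also have "\<dots> = (ennreal (\<rho> * dyadic i powr (- ?d / 2)))\<^sup>2"
      using v N by (simp add: \<rho>_def ennreal_power power_mult_distrib mult_ac power2_eq_square flip: ennreal_mult powr_add)
    finally show ?thesis by (rule power2_le_ennreal) (use \<rho> in simp)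
  qed
  have scale_le: "ennreal (dyadic i powr (q * (1 - \<theta>))) * (\<integral>\<^sup>+ x. ennreal (enn2real (?A i x) powr q) \<partial>lborel)
    \<le> ennreal (2 * ?v) * (\<integral>\<^sup>+ y. ennreal (f y) * ennreal (dyadic i powr \<sigma> * ?m i y) \<partial>lborel)" for i
  proof -
    have "(\<integral>\<^sup>+ x. ennreal (enn2real (?A i x) powr q) \<partial>lborel) \<le> (\<integral>\<^sup>+ x. ennreal 2 * ball_avg i (\<lambda>y. ennreal (f y * ?m i y)) x \<partial>lborel)"
      using q \<rho> f by (intro nn_integral_mono ball_avg_powr_le sup) auto
    also have "\<dots> = ennreal (2 * ?v) * (\<integral>\<^sup>+ y. ennreal (f y * ?m i y) \<partial>lborel)"
      using v by (subst nn_integral_cmult) (simp_all add: nn_integral_ball_avg ennreal_mult mult.assoc)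
    finally have "ennreal (dyadic i powr (q * (1 - \<theta>))) * (\<integral>\<^sup>+ x. ennreal (enn2real (?A i x) powr q) \<partial>lborel) \<le>
       ennreal (dyadic i powr \<sigma>) * (ennreal (2 * ?v) * (\<integral>\<^sup>+ y. ennreal (f y * ?m i y) \<partial>lborel))"
      using ex by (intro mult_mono ennreal_leI powr_mono') (auto simp: \<sigma>_def)
    also have "\<dots> = ennreal (2 * ?v) * (ennreal (dyadic i powr \<sigma>) * (\<integral>\<^sup>+ y. ennreal (f y * ?m i y) \<partial>lborel))"
      by (simp only: mult_ac)
    also have "ennreal (dyadic i powr \<sigma>) * (\<integral>\<^sup>+ y. ennreal (f y * ?m i y) \<partial>lborel) =
       (\<integral>\<^sup>+ y. ennreal (f y) * ennreal (dyadic i powr \<sigma> * ?m i y) \<partial>lborel)"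
      using f by (subst nn_integral_cmult[symmetric]) (auto intro!: nn_integral_cong simp: mult_ac simp flip: ennreal_mult)
    finally show ?thesis .
  qed
  have "avg_energy \<theta> q i0 (\<lambda>y. ennreal (f y)) \<le>
     (\<Sum>n. ennreal (2 * ?v) * (\<integral>\<^sup>+ y. ennreal (f y) * ennreal (dyadic (n + i0) powr \<sigma> * ?m (n + i0) y) \<partial>lborel))"
    unfolding avg_energy_def by (intro suminf_le scale_le) auto
  also have "\<dots> \<le> (\<Sum>n. ennreal (2 * ?v) * (\<integral>\<^sup>+ y. ennreal (f y) * ennreal (dyadic n powr \<sigma> * ?m n y) \<partial>lborel))"
    by (rule suminf_offset_le_ennreal[where f="\<lambda>n. ennreal (2 * ?v) * (\<integral>\<^sup>+ y. ennreal (f y) * ennreal (dyadic n powr \<sigma> * ?m n y) \<partial>lborel)"])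
  also have "\<dots> = ennreal (2 * ?v) * (\<integral>\<^sup>+ y. (\<Sum>n. ennreal (f y) * ennreal (dyadic n powr \<sigma> * ?m n y)) \<partial>lborel)"
    by (subst ennreal_suminf_cmult, subst nn_integral_suminf) (simp_all del: ennreal_suminf_cmult)
  also have "(\<integral>\<^sup>+ y. (\<Sum>n. ennreal (f y) * ennreal (dyadic n powr \<sigma> * ?m n y)) \<partial>lborel) \<le>
     (\<integral>\<^sup>+ y. ennreal (K * \<rho> powr (q - 2) * (2 * ?v)) * ennreal ((f y)\<^sup>2) \<partial>lborel)"
  proof (rule nn_integral_mono)
    fix y
    have "(\<Sum>n. ennreal (dyadic n powr \<sigma> * ?m n y)) \<le> ennreal (K * \<rho> powr (q - 2) * (2 * ?v * f y))"
      unfolding \<sigma>_def K_def using v f[of y] \<rho> q by (intro suminf_dyadic_min_le) auto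
    then have "(\<Sum>n. ennreal (f y) * ennreal (dyadic n powr \<sigma> * ?m n y)) \<le> ennreal (f y) * ennreal (K * \<rho> powr (q - 2) * (2 * ?v * f y))"
      by (simp only: ennreal_suminf_cmult) (rule mult_left_mono, simp_all)
    also have "\<dots> = ennreal (K * \<rho> powr (q - 2) * (2 * ?v)) * ennreal ((f y)\<^sup>2)"
      using f[of y] K v by (simp add: power2_eq_square mult_ac flip: ennreal_mult)
    finally show "(\<Sum>n. ennreal (f y) * ennreal (dyadic n powr \<sigma> * ?m n y)) \<le> \<dots>" .
  qed
  also have "\<dots> = ennreal (K * \<rho> powr (q - 2) * (2 * ?v)) * ennreal N"
    by (subst nn_integral_cmult) (simp_all add: N)
  also have "ennreal (2 * ?v) * (ennreal (K * \<rho> powr (q - 2) * (2 * ?v)) * ennreal N) =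
     ennreal (2 * ?v * K * (?v powr ((q - 2) / 2) * (2 * ?v)) * N powr (q / 2))"
  proof -
    have "\<rho> powr (q - 2) = ?v powr ((q - 2) / 2) * N powr ((q - 2) / 2)"
      using v N by (simp add: \<rho>_def powr_half_sqrt[symmetric] powr_powr powr_mult)
    moreover have "N powr ((q - 2) / 2) * N = N powr (q / 2)"
      using N by (intro powr_half_shift) simp
    ultimately have "2 * ?v * (K * \<rho> powr (q - 2) * (2 * ?v) * N) = 2 * ?v * K * (?v powr ((q - 2) / 2) * (2 * ?v)) * N powr (q / 2)"
      by (simp add: mult_ac)
    moreover have "ennreal (2 * ?v) * (ennreal (K * \<rho> powr (q - 2) * (2 * ?v)) * ennreal N) = ennreal (2 * ?v * (K * \<rho> powr (q - 2) * (2 * ?v) * N))"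
      using v K N by (simp flip: ennreal_mult)
    ultimately show ?thesis by (simp only:)
  qed
  finally show ?thesis by (simp add: K_def \<sigma>_def mult_left_mono)
qed

section \<open>Near and far part of the Slobodetskii integral\<close>

lemma nn_integral_ball_sym:
  fixes P :: "'a::euclidean_space \<Rightarrow> ennreal"
  assumes [measurable]: "P \<in> borel_measurable borel"
  shows "(\<integral>\<^sup>+ x. \<integral>\<^sup>+ y. (P x + P y) * indicator (ball x (dyadic i)) y \<partial>lborel \<partial>lborel)
    = ennreal (2 * unit_ball_vol DIM('a) * dyadic i ^ DIM('a)) * (\<integral>\<^sup>+ x. P x \<partial>lborel)"
proof -
  let ?v = "unit_ball_vol DIM('a)" let ?r = "dyadic i ^ DIM('a)"
  have "(\<integral>\<^sup>+ x. \<integral>\<^sup>+ y. (P x + P y) * indicator (ball x (dyadic i)) y \<partial>lborel \<partial>lborel) =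
    (\<integral>\<^sup>+ x. (ennreal (?v * ?r) * P x + ennreal ?r * ball_avg i P x) \<partial>lborel)"
  proof (rule nn_integral_cong)
    fix x :: 'a
    have "(\<integral>\<^sup>+ y. (P x + P y) * indicator (ball x (dyadic i)) y \<partial>lborel)
       = (\<integral>\<^sup>+ y. P x * indicator (ball x (dyadic i)) y \<partial>lborel) + (\<integral>\<^sup>+ y. P y * indicator (ball x (dyadic i)) y \<partial>lborel)"
      by (subst nn_integral_add[symmetric]) (auto simp: distrib_right)
    then show "(\<integral>\<^sup>+ y. (P x + P y) * indicator (ball x (dyadic i)) y \<partial>lborel) = ennreal (?v * ?r) * P x + ennreal ?r * ball_avg i P x"
      by (simp add: ball_integral_eq nn_integral_cmult_indicator emeasure_ball mult.commute)
  qed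
  also have "\<dots> = ennreal (?v * ?r) * (\<integral>\<^sup>+ x. P x \<partial>lborel) + ennreal ?r * (ennreal ?v * (\<integral>\<^sup>+ x. P x \<partial>lborel))"
    by (subst nn_integral_add) (simp_all add: nn_integral_cmult nn_integral_ball_avg)
  also have "\<dots> = (ennreal (?v * ?r) + ennreal ?r * ennreal ?v) * (\<integral>\<^sup>+ x. P x \<partial>lborel)"
    by (simp add: distrib_right mult.assoc)
  also have "ennreal (?v * ?r) + ennreal ?r * ennreal ?v = ennreal (2 * ?v * ?r)"
    by (simp add: mult.commute flip: ennreal_mult ennreal_plus)
  finally show ?thesis .
qed

lemma abs_diff_powr_le:
  fixes u :: "'a::euclidean_space \<Rightarrow> real" and q \<theta> :: real
  assumes [measurable]: "u \<in> borel_measurable borel" and xy: "dist x y < dyadic j" and q: "0 < q" and \<theta>: "0 < \<theta>"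
    and osc: "\<And>z. z \<in> {x, y} \<Longrightarrow> mean_osc j u z \<le> ennreal (2 ^ DIM('a)) * (\<Sum>m. ennreal (dyadic (m + j)) * ball_avg (m + j) f z)"
    and fin: "\<And>i z. j \<le> i \<Longrightarrow> ball_avg i f z < \<infinity>"
  shows "ennreal (\<bar>u x - u y\<bar> powr q) \<le>
    ennreal (2 powr q * ((2 ^ DIM('a) / unit_ball_vol DIM('a)) * 2 ^ DIM('a) / (1 - 2 powr - (\<theta> / 2))) powr q) *
      (osc_sum \<theta> q f j x + osc_sum \<theta> q f j y)"
proof -
  let ?C = "2 ^ DIM('a) / unit_ball_vol DIM('a)"
  have C: "0 < ?C" using unit_ball_vol_pos[of "real DIM('a)"] by simp
  let ?K = "(?C * 2 ^ DIM('a) / (1 - 2 powr - (\<theta> / 2))) powr q"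
  have "ennreal (\<bar>u x - u y\<bar> powr q) \<le> ennreal (2 powr q) * (ennreal ?K * osc_sum \<theta> q f j x + ennreal ?K * osc_sum \<theta> q f j y)"
  proof (rule powr_add_le[OF _ _ q C])
    show "ennreal \<bar>u x - u y\<bar> \<le> ennreal ?C * mean_osc j u x + ennreal ?C * mean_osc j u y"
      using abs_diff_le_mean_osc[OF assms(1) xy] by (simp only: distrib_left)
  next
    fix r :: real assume r: "0 \<le> r"
    show "ennreal (r powr q) \<le> ennreal ?K * osc_sum \<theta> q f j x" if "ennreal r \<le> ennreal ?C * mean_osc j u x"
      by (rule mean_osc_powr_le[OF osc fin \<theta> q r C that]) auto
    show "ennreal (r powr q) \<le> ennreal ?K * osc_sum \<theta> q f j y" if "ennreal r \<le> ennreal ?C * mean_osc j u y"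
      by (rule mean_osc_powr_le[OF osc fin \<theta> q r C that]) auto
  qed simp
  also have "\<dots> = ennreal (2 powr q * ?K) * (osc_sum \<theta> q f j x + osc_sum \<theta> q f j y)"
    by (simp add: ennreal_mult mult.assoc distrib_left)
  finally show ?thesis .
qed

definition slobodetskii_kernel :: "real \<Rightarrow> real \<Rightarrow> ('a::euclidean_space \<Rightarrow> real) \<Rightarrow> 'a \<Rightarrow> 'a \<Rightarrow> ennreal" where
  "slobodetskii_kernel \<theta> q u x y = ennreal (\<bar>u x - u y\<bar> powr q / norm (x - y) powr (real DIM('a) + \<theta> * q))"

abbreviation slobodetskii_near :: "real \<Rightarrow> real \<Rightarrow> real \<Rightarrow> ('a::euclidean_space \<Rightarrow> real) \<Rightarrow> ennreal" where
  "slobodetskii_near r \<theta> q u \<equiv>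
     (\<integral>\<^sup>+ x. \<integral>\<^sup>+ y. slobodetskii_kernel \<theta> q u x y * indicator (ball x r) y \<partial>lborel \<partial>lborel)"

abbreviation slobodetskii_far :: "real \<Rightarrow> real \<Rightarrow> real \<Rightarrow> ('a::euclidean_space \<Rightarrow> real) \<Rightarrow> ennreal" where
  "slobodetskii_far r \<theta> q u \<equiv>
     (\<integral>\<^sup>+ x. \<integral>\<^sup>+ y. slobodetskii_kernel \<theta> q u x y * indicator (- ball x r) y \<partial>lborel \<partial>lborel)"

abbreviation osc_controlled :: "('a::euclidean_space \<Rightarrow> real) \<Rightarrow> ('a \<Rightarrow> ennreal) \<Rightarrow> 'a \<Rightarrow> bool" where
  "osc_controlled u f x \<equiv>
     \<forall>j. mean_osc j u x \<le> ennreal (2 ^ DIM('a)) * (\<Sum>m. ennreal (dyadic (m + j)) * ball_avg (m + j) f x)"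

lemma slobodetskii_kernel_measurable [measurable]:
  assumes [measurable]: "u \<in> borel_measurable borel"
  shows "(\<lambda>(x::'a::euclidean_space, y). slobodetskii_kernel \<theta> q u x y) \<in> borel_measurable (borel \<Otimes>\<^sub>M borel)"
  unfolding slobodetskii_kernel_def[abs_def] by measurable

lemma nn_integral_nested_suminf:
  fixes g :: "nat \<Rightarrow> 'a::euclidean_space \<Rightarrow> 'a \<Rightarrow> ennreal"
  assumes [measurable]: "\<And>n. (\<lambda>(x, y). g n x y) \<in> borel_measurable (borel \<Otimes>\<^sub>M borel)"
  shows "(\<integral>\<^sup>+ x. \<integral>\<^sup>+ y. (\<Sum>n. c n * g n x y) \<partial>lborel \<partial>lborel) = (\<Sum>n. c n * (\<integral>\<^sup>+ x. \<integral>\<^sup>+ y. g n x y \<partial>lborel \<partial>lborel))"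
proof -
  have "(\<integral>\<^sup>+ y. (\<Sum>n. c n * g n x y) \<partial>lborel) = (\<Sum>n. c n * (\<integral>\<^sup>+ y. g n x y \<partial>lborel))" for x
    by (subst nn_integral_suminf) (simp_all add: nn_integral_cmult)
  then show ?thesis
    by (simp only:) (subst nn_integral_suminf, simp_all add: nn_integral_cmult)
qed

text \<open>Each pair of points is assigned to its dyadic annulus. At scale r the kernel costs r^(-d
  - \<theta> q) up to a constant, integration over the ball returns r^d, and r^(-\<theta> q) is
  exactly the weight in \<open>osc_sum_energy\<close>.\<close>

proposition near_energy:
  fixes q \<theta> :: real
  assumes \<theta>: "0 < \<theta>" and q: "0 < q"
  obtains K where "0 \<le> K"
    "\<And>(u :: 'a::euclidean_space \<Rightarrow> real) f i0. \<lbrakk>u \<in> borel_measurable borel; f \<in> borel_measurable borel;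
      AE x in lborel. osc_controlled u f x;
      \<And>i z. i0 \<le> i \<Longrightarrow> ball_avg i f z < \<infinity>\<rbrakk> \<Longrightarrow>
     slobodetskii_near (dyadic i0) \<theta> q u \<le> ennreal K * avg_energy \<theta> q i0 f"
proof -
  let ?d = "DIM('a)" let ?v = "unit_ball_vol DIM('a)"
  have v: "0 < ?v" using unit_ball_vol_pos[of "real DIM('a)"] by simp
  define D where "D = real ?d + \<theta> * q"
  have D: "0 < D" using \<theta> q by (simp add: D_def add_pos_pos)
  define K1 where "K1 = 2 powr q * ((2 ^ ?d / ?v) * 2 ^ ?d / (1 - 2 powr - (\<theta> / 2))) powr q"
  have K1: "0 \<le> K1" by (simp add: K1_def)
  define K2 where "K2 = 1 / (1 - 2 powr - (\<theta> * q / 2))"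
  have K2: "0 \<le> K2" using \<theta> q powr_less_one[of 2 "- (\<theta> * q / 2)"] by (simp add: K2_def)
  have main: "slobodetskii_near (dyadic i0) \<theta> q u
      \<le> ennreal (2 powr D * K1 * (2 * ?v) * K2) * avg_energy \<theta> q i0 f"
    if [measurable]: "u \<in> borel_measurable borel" "f \<in> borel_measurable borel"
      and osc: "AE x in lborel. osc_controlled u f x"
      and fin: "\<And>i z. i0 \<le> i \<Longrightarrow> ball_avg i f z < \<infinity>" for u :: "'a \<Rightarrow> real" and f i0
  proof -
    let ?P = "\<lambda>n. osc_sum \<theta> q f (n + i0)"
    let ?c = "\<lambda>n. ennreal (K1 * dyadic (Suc (n + i0)) powr (- D))"
    have "slobodetskii_near (dyadic i0) \<theta> q u
      \<le> (\<integral>\<^sup>+ x. \<integral>\<^sup>+ y. (\<Sum>n. ?c n * ((?P n x + ?P n y) * indicator (ball x (dyadic (n + i0))) y)) \<partial>lborel \<partial>lborel)"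
    proof (rule nn_integral_mono_AE)
      show "AE x in lborel. (\<integral>\<^sup>+ y. slobodetskii_kernel \<theta> q u x y * indicator (ball x (dyadic i0)) y \<partial>lborel) \<le>
         (\<integral>\<^sup>+ y. (\<Sum>n. ?c n * ((?P n x + ?P n y) * indicator (ball x (dyadic (n + i0))) y)) \<partial>lborel)"
        using osc
      proof eventually_elim
        case (elim x)
        show ?case
        proof (rule nn_integral_mono_AE)
          show "AE y in lborel. slobodetskii_kernel \<theta> q u x y * indicator (ball x (dyadic i0)) y \<le>
             (\<Sum>n. ?c n * ((?P n x + ?P n y) * indicator (ball x (dyadic (n + i0))) y))"
            using osc
          proof eventually_elim
            case (elim y)
            note ox = \<open>\<forall>j. mean_osc j u x \<le> _ j\<close>
            show ?case
            proof (cases "y \<in> ball x (dyadic i0) \<and> x \<noteq> y")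
              case True
              then have "0 < dist x y" "dist x y < dyadic i0" by auto
              then obtain n where n: "dyadic (Suc (n + i0)) \<le> dist x y" "dist x y < dyadic (n + i0)"
                by (rule dyadic_bracket)
              have "ennreal (\<bar>u x - u y\<bar> powr q) \<le> ennreal K1 * (?P n x + ?P n y)"
                unfolding K1_def using ox elim fin
                by (intro abs_diff_powr_le[OF _ n(2) q \<theta>]) auto
              moreover have "norm (x - y) powr (- D) \<le> dyadic (Suc (n + i0)) powr (- D)"
                using n D by (intro powr_mono2') (auto simp: dist_norm simp del: dyadic_simps(6))
              ultimately have "ennreal (norm (x - y) powr (- D)) * ennreal (\<bar>u x - u y\<bar> powr q) \<le>
                 ennreal (dyadic (Suc (n + i0)) powr (- D)) * (ennreal K1 * (?P n x + ?P n y))"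
                by (intro mult_mono ennreal_leI) auto
              moreover have "slobodetskii_kernel \<theta> q u x y = ennreal (norm (x - y) powr (- D)) * ennreal (\<bar>u x - u y\<bar> powr q)"
                unfolding slobodetskii_kernel_def D_def[symmetric] by (simp add: powr_minus divide_inverse mult.commute flip: ennreal_mult)
              moreover have "ennreal (dyadic (Suc (n + i0)) powr (- D)) * (ennreal K1 * (?P n x + ?P n y)) = ?c n * (?P n x + ?P n y)"
                using K1 by (simp only: ennreal_mult mult.assoc powr_ge_zero) (simp only: mult.left_commute)
              ultimately have "slobodetskii_kernel \<theta> q u x y * indicator (ball x (dyadic i0)) y \<le> ?c n * ((?P n x + ?P n y) * indicator (ball x (dyadic (n + i0))) y)"
                using True n by (simp del: dyadic_simps(6))
              also have "\<dots> \<le> (\<Sum>n. ?c n * ((?P n x + ?P n y) * indicator (ball x (dyadic (n + i0))) y))"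
                by (rule le_suminf_ennreal)
              finally show ?thesis .
            next
              case False
              \<comment> \<open>On the diagonal the numerator is
                \<open>0 powr q = 0\<close>.\<close>
              then have "slobodetskii_kernel \<theta> q u x y * indicator (ball x (dyadic i0)) y = 0" by (auto simp: slobodetskii_kernel_def)
              then show ?thesis by (simp only: zero_le)
            qed
          qed
        qed
      qed
    qed
    also have "\<dots> = (\<Sum>n. ?c n * (\<integral>\<^sup>+ x. \<integral>\<^sup>+ y. (?P n x + ?P n y) * indicator (ball x (dyadic (n + i0))) y \<partial>lborel \<partial>lborel))"
      by (rule nn_integral_nested_suminf) measurable
    also have "\<dots> = (\<Sum>n. ennreal (2 powr D * K1 * (2 * ?v)) * (ennreal (dyadic (n + i0) powr (- (\<theta> * q))) * (\<integral>\<^sup>+ x. ?P n x \<partial>lborel)))"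
    proof (intro suminf_cong)
      fix n
      let ?r = "dyadic (n + i0)"
      have e: "K1 * dyadic (Suc (n + i0)) powr (- D) * (2 * ?v * ?r ^ ?d) = 2 powr D * K1 * (2 * ?v) * ?r powr (- (\<theta> * q))"
      proof -
        have "dyadic (Suc (n + i0)) powr (- D) = 2 powr D * ?r powr (- D)"
          by (simp add: powr_divide powr_minus field_simps)
        moreover have "?r powr (- D) * ?r ^ ?d = ?r powr (- (\<theta> * q))"
        proof -
          have "?r powr (- D) * ?r powr (real ?d) = ?r powr (- (\<theta> * q))" by (simp add: D_def flip: powr_add)
          then show ?thesis by (simp only: powr_realpow dyadic_simps)
        qed
        ultimately show ?thesis by (simp only:) (metis (no_types, opaque_lifting) mult.assoc mult.left_commute)
      qed
      have "?c n * (ennreal (2 * ?v * ?r ^ ?d) * (\<integral>\<^sup>+ x. ?P n x \<partial>lborel)) = ennreal (K1 * dyadic (Suc (n + i0)) powr (- D) * (2 * ?v * ?r ^ ?d)) * (\<integral>\<^sup>+ x. ?P n x \<partial>lborel)"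
        using K1 v by (simp add: ennreal_mult mult.assoc del: dyadic_simps(6))
      also have "\<dots> = ennreal (2 powr D * K1 * (2 * ?v)) * (ennreal (?r powr (- (\<theta> * q))) * (\<integral>\<^sup>+ x. ?P n x \<partial>lborel))"
        unfolding e using K1 v by (simp add: ennreal_mult mult.assoc)
      finally show "?c n * (\<integral>\<^sup>+ x. \<integral>\<^sup>+ y. (?P n x + ?P n y) * indicator (ball x ?r) y \<partial>lborel \<partial>lborel) = \<dots>"
        by (subst nn_integral_ball_sym) measurable
    qed
    also have "\<dots> = ennreal (2 powr D * K1 * (2 * ?v)) * (\<Sum>n. ennreal (dyadic (n + i0) powr (- (\<theta> * q))) * (\<integral>\<^sup>+ x. ?P n x \<partial>lborel))"
      by (rule ennreal_suminf_cmult)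
    also have "\<dots> \<le> ennreal (2 powr D * K1 * (2 * ?v)) * (ennreal K2 * avg_energy \<theta> q i0 f)"
      unfolding K2_def by (intro mult_left_mono osc_sum_energy \<theta> q) auto
    also have "\<dots> = ennreal (2 powr D * K1 * (2 * ?v) * K2) * avg_energy \<theta> q i0 f"
      using K1 K2 v by (simp add: ennreal_mult mult.assoc)
    finally show ?thesis .
  qed
  show thesis
    by (rule that[of "2 powr D * K1 * (2 * ?v) * K2"]) (use K1 K2 v main in auto)
qed

text \<open>A sum over annuli growing outwards, found by applying \<open>dyadic_bracket\<close> to
  the reciprocal size of \<open>h\<close>. It is geometric because D exceeds the dimension.\<close>

lemma far_kernel_integral:
  fixes D :: real and r :: real
  assumes D: "real DIM('a::euclidean_space) < D" and r: "0 < r"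
  shows "(\<integral>\<^sup>+ h. ennreal (norm h powr (- D)) * indicator (- ball (0::'a) r) h \<partial>lborel) < \<infinity>"
proof -
  let ?d = "DIM('a)" let ?v = "unit_ball_vol DIM('a)"
  have v: "0 < ?v" using unit_ball_vol_pos[of "real DIM('a)"] by simp
  let ?c = "\<lambda>n. ennreal ((r / (2 * dyadic n)) powr (- D))"
  have "(\<integral>\<^sup>+ h. ennreal (norm h powr (- D)) * indicator (- ball (0::'a) r) h \<partial>lborel)
    \<le> (\<integral>\<^sup>+ h. (\<Sum>n. ?c n * indicator (ball (0::'a) (2 * r / dyadic n)) h) \<partial>lborel)"
  proof (rule nn_integral_mono)
    fix h :: 'a
    show "ennreal (norm h powr (- D)) * indicator (- ball 0 r) h \<le> (\<Sum>n. ?c n * indicator (ball 0 (2 * r / dyadic n)) h)"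
    proof (cases "r \<le> norm h")
      case True
      then have "0 < norm h" using r by linarith
      \<comment> \<open>The factor 2 keeps the quotient strictly below 1 also when
        \<open>norm h = r\<close>.\<close>
      then have "0 < r / (2 * norm h)" "r / (2 * norm h) < dyadic 0" using r True by (auto simp: divide_less_eq)
      then obtain n where "dyadic (Suc (n + 0)) \<le> r / (2 * norm h)" "r / (2 * norm h) < dyadic (n + 0)"
        by (rule dyadic_bracket)
      then have n: "r / (2 * dyadic n) \<le> norm h" "norm h < 2 * r / dyadic n"
        using \<open>0 < norm h\<close> r by (auto simp: field_simps)
      have "norm h powr (- D) \<le> (r / (2 * dyadic n)) powr (- D)"
        using n r D by (intro powr_mono2') auto
      then have "ennreal (norm h powr (- D)) * indicator (- ball 0 r) h \<le> ?c n * indicator (ball 0 (2 * r / dyadic n)) h"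
        using n by (auto simp: indicator_def intro: ennreal_leI)
      also have "\<dots> \<le> (\<Sum>n. ?c n * indicator (ball 0 (2 * r / dyadic n)) h)" by (rule le_suminf_ennreal)
      finally show ?thesis .
    qed simp
  qed
  also have "\<dots> = (\<Sum>n. ?c n * ennreal (?v * (2 * r / dyadic n) ^ ?d))"
    using r by (subst nn_integral_suminf) (auto simp: nn_integral_cmult_indicator emeasure_ball)
  also have "\<dots> = (\<Sum>n. ennreal ((r / 2) powr (- D) * (?v * (2 * r) ^ ?d)) * ennreal (dyadic n powr (D - ?d)))"
  proof (intro suminf_cong)
    fix n
    have ac: "(B * C) * (v * (Y * Z)) = (B * (v * Y)) * (C * Z)" for B C v Y Z :: real
      by simp
    have "(r / (2 * dyadic n)) powr (- D) = (r / 2) powr (- D) * dyadic n powr D"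
      using r by (simp add: powr_divide powr_mult powr_minus field_simps)
    moreover have "(2 * r / dyadic n) ^ ?d = (2 * r) ^ ?d * dyadic n powr (- ?d)"
      by (simp add: powr_minus powr_realpow divide_inverse power_mult_distrib power_inverse)
    moreover have "dyadic n powr D * dyadic n powr (- ?d) = dyadic n powr (D - ?d)"
      by (simp flip: powr_add)
    ultimately have "(r / (2 * dyadic n)) powr (- D) * (?v * (2 * r / dyadic n) ^ ?d) =
       ((r / 2) powr (- D) * (?v * (2 * r) ^ ?d)) * dyadic n powr (D - ?d)"
      by (simp only: ac)
    moreover have "0 \<le> ?v * (2 * r / dyadic n) ^ ?d" "0 \<le> (r / 2) powr (- D) * (?v * (2 * r) ^ ?d)"
      using r v by simp_all
    ultimately show "?c n * ennreal (?v * (2 * r / dyadic n) ^ ?d) =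
        ennreal ((r / 2) powr (- D) * (?v * (2 * r) ^ ?d)) * ennreal (dyadic n powr (D - ?d))"
      by (simp only: ennreal_mult[symmetric] powr_ge_zero)
  qed
  also have "\<dots> = ennreal ((r / 2) powr (- D) * (?v * (2 * r) ^ ?d)) * ennreal (1 / (1 - 2 powr - (D - ?d)))"
    using D by (simp only: ennreal_suminf_cmult suminf_geometric_powr diff_gt_0_iff_gt)
  also have "\<dots> < \<infinity>" by (simp add: ennreal_mult_less_top)
  finally show ?thesis .
qed

text \<open>Away from the diagonal the difference is simply split into its two terms. What remains
  is a convolution with a kernel that is integrable at infinity.\<close>

proposition far_energy:
  fixes q \<theta> r :: real
  assumes \<theta>: "0 < \<theta>" and q: "0 < q" and r: "0 < r"
  obtains K where "0 \<le> K"
    "\<And>u :: 'a::euclidean_space \<Rightarrow> real. u \<in> borel_measurable borel \<Longrightarrow>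
     slobodetskii_far r \<theta> q u \<le> ennreal K * (\<integral>\<^sup>+ x. ennreal (\<bar>u x\<bar> powr q) \<partial>lborel)"
proof -
  let ?d = "DIM('a)"
  define D where "D = real ?d + \<theta> * q"
  have D: "real ?d < D" using \<theta> q by (simp add: D_def)
  define W where "W h = ennreal (norm h powr (- D)) * indicator (- ball (0::'a) r) h" for h
  have [measurable]: "W \<in> borel_measurable borel" unfolding W_def[abs_def] by measurable
  have W_sym: "W (x - y) = W (y - x)" for x y by (simp add: W_def norm_minus_commute indicator_def)
  obtain J where J: "0 \<le> J" "(\<integral>\<^sup>+ h. W h \<partial>lborel) = ennreal J"
    using far_kernel_integral[OF D r] unfolding W_def[symmetric] by (metis ennreal_cases infinity_ennreal_def order_less_irrefl)
  have WJ: "(\<integral>\<^sup>+ y. W (x - y) \<partial>lborel) = ennreal J" for x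
    unfolding W_sym[of x] using nn_integral_translate[of W "- x"] J by simp
  show thesis
  proof (rule that[of "2 powr q * (2 * J)"])
    fix u :: "'a \<Rightarrow> real" assume [measurable]: "u \<in> borel_measurable borel"
    let ?U = "\<lambda>x. ennreal (\<bar>u x\<bar> powr q)"
    have point: "slobodetskii_kernel \<theta> q u x y * indicator (- ball x r) y \<le> ennreal (2 powr q) * (?U x * W (x - y) + ?U y * W (x - y))" for x y
    proof (cases "y \<in> ball x r")
      case False
      then have W: "W (x - y) = ennreal (norm (x - y) powr (- D))" by (simp add: W_def dist_norm indicator_def norm_minus_commute)
      have "ennreal (\<bar>u x - u y\<bar> powr q) \<le> ennreal (2 powr q) * (?U x + ?U y)"
      proof (rule powr_add_le[where S="ennreal \<bar>u x\<bar>" and T="ennreal \<bar>u y\<bar>" and C=1])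
        show "ennreal \<bar>u x - u y\<bar> \<le> ennreal \<bar>u x\<bar> + ennreal \<bar>u y\<bar>"
          using ennreal_leI[of "\<bar>u x - u y\<bar>" "\<bar>u x\<bar> + \<bar>u y\<bar>"] by simp
        show "ennreal (s powr q) \<le> ?U x" if "0 \<le> s" "ennreal s \<le> ennreal \<bar>u x\<bar>" for s
          using that q by (intro ennreal_leI powr_mono2) auto
        show "ennreal (s powr q) \<le> ?U y" if "0 \<le> s" "ennreal s \<le> ennreal \<bar>u y\<bar>" for s
          using that q by (intro ennreal_leI powr_mono2) auto
      qed (use q in auto)
      then have "ennreal (\<bar>u x - u y\<bar> powr q) * W (x - y) \<le> ennreal (2 powr q) * (?U x + ?U y) * W (x - y)"
        by (rule mult_right_mono) simp
      moreover have "slobodetskii_kernel \<theta> q u x y = ennreal (\<bar>u x - u y\<bar> powr q) * W (x - y)"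
        unfolding slobodetskii_kernel_def D_def[symmetric] W by (simp add: powr_minus divide_inverse flip: ennreal_mult)
      ultimately show ?thesis using False by (simp add: distrib_left distrib_right mult.assoc)
    qed simp
    have "slobodetskii_far r \<theta> q u
      \<le> (\<integral>\<^sup>+ x. \<integral>\<^sup>+ y. ennreal (2 powr q) * (?U x * W (x - y) + ?U y * W (x - y)) \<partial>lborel \<partial>lborel)"
      by (intro nn_integral_mono point)
    also have "\<dots> = ennreal (2 powr q) * ((\<integral>\<^sup>+ x. \<integral>\<^sup>+ y. ?U x * W (x - y) \<partial>lborel \<partial>lborel) + (\<integral>\<^sup>+ x. \<integral>\<^sup>+ y. ?U y * W (x - y) \<partial>lborel \<partial>lborel))"
      by (subst nn_integral_cmult, measurable, subst nn_integral_cmult, measurable)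
        (subst nn_integral_add, measurable, subst nn_integral_add, measurable)
    also have "(\<integral>\<^sup>+ x. \<integral>\<^sup>+ y. ?U x * W (x - y) \<partial>lborel \<partial>lborel) = (\<integral>\<^sup>+ x. ?U x \<partial>lborel) * ennreal J"
      by (subst nn_integral_cmult, measurable) (simp add: WJ nn_integral_multc)
    also have "(\<integral>\<^sup>+ x. \<integral>\<^sup>+ y. ?U y * W (x - y) \<partial>lborel \<partial>lborel) = (\<integral>\<^sup>+ y. \<integral>\<^sup>+ x. ?U y * W (x - y) \<partial>lborel \<partial>lborel)"
      by (rule lborel_pair.Fubini'[symmetric]) measurable
    also have "\<dots> = (\<integral>\<^sup>+ y. ?U y \<partial>lborel) * ennreal J"
      by (subst nn_integral_cmult, measurable) (subst W_sym, simp add: WJ nn_integral_multc)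
    also have "ennreal (2 powr q) * ((\<integral>\<^sup>+ x. ?U x \<partial>lborel) * ennreal J + (\<integral>\<^sup>+ y. ?U y \<partial>lborel) * ennreal J) =
       (ennreal (2 powr q) * (ennreal J + ennreal J)) * (\<integral>\<^sup>+ x. ?U x \<partial>lborel)"
      by (simp only: distrib_left distrib_right mult_ac)
    also have "ennreal (2 powr q) * (ennreal J + ennreal J) = ennreal (2 powr q * (2 * J))"
      using J by (simp flip: ennreal_mult ennreal_plus)
    finally show "slobodetskii_far r \<theta> q u
        \<le> ennreal (2 powr q * (2 * J)) * (\<integral>\<^sup>+ x. ?U x \<partial>lborel)" .
  qed (use J in simp)
qed

section \<open>Tubes around Lipschitz submanifolds\<close>

text \<open>Quantise the chart coordinates with mesh \<tau>. Points in the same cell are at chart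
  distance at most d \<tau>, hence at distance at most t. Only the coordinates in \<open>I\<close>
  have to be counted, the others being 0.\<close>

lemma chart_cover:
  fixes T :: "(real^'n::finite) set" and \<phi> :: "real^'n \<Rightarrow> real^'n"
  assumes lip: "\<And>x y. x \<in> T \<Longrightarrow> y \<in> T \<Longrightarrow> dist (\<phi> x) (\<phi> y) \<le> L * dist x y"
    and inv: "\<And>x y. x \<in> T \<Longrightarrow> y \<in> T \<Longrightarrow> dist x y \<le> L * dist (\<phi> x) (\<phi> y)"
    and L: "1 \<le> L" and flat: "\<And>x i. x \<in> T \<Longrightarrow> i \<notin> I \<Longrightarrow> \<phi> x $ i = 0"
    and diam: "\<And>x y. x \<in> T \<Longrightarrow> y \<in> T \<Longrightarrow> dist x y \<le> 4 * r"
    and t: "0 < t" "t \<le> r"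
  obtains P where "finite P" "real (card P) \<le> ((8 * L\<^sup>2 * CARD('n) + 3) * (r / t)) ^ card I"
    "T \<subseteq> (\<Union>p\<in>P. cball p t)"
proof (cases "T = {}")
  case True
  then show thesis using L t by (intro that[of "{}"]) auto
next
  case False
  then obtain s0 where s0: "s0 \<in> T" by auto
  let ?d = "real CARD('n)"
  \<comment> \<open>Chosen so that L d \<tau> = t; the factor d comes from bounding the norm by the
    sum of the coordinates.\<close>
  define \<tau> where "\<tau> = t / (L * ?d)"
  have \<tau>: "0 < \<tau>" using t L by (simp add: \<tau>_def)
  define m where "m s = (\<lambda>i\<in>I. \<lfloor>(\<phi> s - \<phi> s0) $ i / \<tau>\<rfloor>)" for s
  \<comment> \<open>The chart image has diameter at most 4 L r, which is 4 L^2 d r / t mesh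
    widths.\<close>
  define M where "M = \<lceil>4 * L\<^sup>2 * ?d * (r / t)\<rceil>"
  have M: "0 \<le> 4 * L\<^sup>2 * ?d * (r / t)" using t L by simp
  have sub: "m ` T \<subseteq> (\<Pi>\<^sub>E i\<in>I. {-M..M})"
  proof (clarsimp simp: m_def)
    fix s i assume s: "s \<in> T" and i: "i \<in> I"
    have "\<bar>(\<phi> s - \<phi> s0) $ i\<bar> \<le> dist (\<phi> s) (\<phi> s0)"
      unfolding dist_norm by (rule component_le_norm_cart)
    also have "\<dots> \<le> L * (4 * r)"
      by (rule order_trans[OF lip[OF s s0]]) (use diam[OF s s0] L in \<open>auto intro: mult_left_mono\<close>)
    finally have "\<bar>(\<phi> s - \<phi> s0) $ i / \<tau>\<bar> \<le> L * (4 * r) / \<tau>"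
      using \<tau> by (simp add: divide_right_mono)
    also have "\<dots> = 4 * L\<^sup>2 * ?d * (r / t)" using t L by (simp add: \<tau>_def power2_eq_square)
    also have "\<dots> \<le> real_of_int M" by (simp add: M_def)
    finally have "\<bar>(\<phi> s $ i - \<phi> s0 $ i) / \<tau>\<bar> \<le> real_of_int M" by simp
    then show "- M \<le> \<lfloor>(\<phi> s $ i - \<phi> s0 $ i) / \<tau>\<rfloor> \<and> \<lfloor>(\<phi> s $ i - \<phi> s0 $ i) / \<tau>\<rfloor> \<le> M"
      by linarith
  qed
  have finPi: "finite (\<Pi>\<^sub>E i\<in>I. {-M..M})" by (intro finite_PiE) auto
  then have fin: "finite (m ` T)" using sub finite_subset by blast
  \<comment> \<open>One point of \<open>T\<close> from every occupied cell.\<close>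
  define P where "P = inv_into T m ` m ` T"
  have "card P \<le> card (m ` T)" unfolding P_def by (rule card_image_le[OF fin])
  also have "\<dots> \<le> card (\<Pi>\<^sub>E i\<in>I. {-M..M})" by (rule card_mono[OF finPi sub])
  also have "\<dots> = nat (2 * M + 1) ^ card I" by (simp add: card_PiE)
  finally have "real (card P) \<le> real (nat (2 * M + 1)) ^ card I"
    by (metis of_nat_le_iff of_nat_power)
  also have "\<dots> \<le> ((8 * L\<^sup>2 * ?d + 3) * (r / t)) ^ card I"
  proof (rule power_mono)
    have "0 \<le> M" using M by (simp add: M_def)
    then have "real (nat (2 * M + 1)) = 2 * real_of_int M + 1" by simp
    also have "\<dots> \<le> 2 * (4 * L\<^sup>2 * ?d * (r / t) + 1) + 1"
      unfolding M_def by (intro add_right_mono mult_left_mono of_int_ceiling_le_add_one) auto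
    \<comment> \<open>The additive 3 is absorbed by r / t \<ge> 1.\<close>
    also have "\<dots> \<le> 2 * (4 * L\<^sup>2 * ?d * (r / t)) + 3 * (r / t)"
      using t by (simp add: pos_le_divide_eq)
    finally show "real (nat (2 * M + 1)) \<le> (8 * L\<^sup>2 * ?d + 3) * (r / t)"
      by (simp add: algebra_simps)
  qed simp
  finally have card: "real (card P) \<le> ((8 * L\<^sup>2 * ?d + 3) * (r / t)) ^ card I" .
  have "s \<in> (\<Union>p\<in>P. cball p t)" if s: "s \<in> T" for s
  proof -
    define p where "p = inv_into T m (m s)"
    have p: "p \<in> T" "m p = m s" using s by (auto simp: p_def inv_into_into f_inv_into_f)
    have "p \<in> P" using s by (simp add: P_def p_def)
    have comp: "\<bar>(\<phi> p - \<phi> s) $ i\<bar> \<le> \<tau>" for i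
    proof (cases "i \<in> I")
      case True
      then have "\<lfloor>(\<phi> p - \<phi> s0) $ i / \<tau>\<rfloor> = \<lfloor>(\<phi> s - \<phi> s0) $ i / \<tau>\<rfloor>"
        using fun_cong[OF p(2), of i] by (simp add: m_def)
      then have "\<bar>(\<phi> p - \<phi> s0) $ i / \<tau> - (\<phi> s - \<phi> s0) $ i / \<tau>\<bar> < 1" by linarith
      then have "\<bar>((\<phi> p - \<phi> s0) $ i - (\<phi> s - \<phi> s0) $ i) / \<tau>\<bar> < 1"
        by (simp only: diff_divide_distrib)
      then show ?thesis using \<tau> by (simp add: divide_less_eq)
    next
      case False
      then show ?thesis using flat[OF p(1)] flat[OF s] \<tau> by simp
    qed
    have "dist (\<phi> p) (\<phi> s) \<le> (\<Sum>i\<in>UNIV. \<bar>(\<phi> p - \<phi> s) $ i\<bar>)"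
      unfolding dist_norm by (rule norm_le_l1_cart)
    also have "\<dots> \<le> ?d * \<tau>"
      using sum_mono[of UNIV "\<lambda>i. \<bar>(\<phi> p - \<phi> s) $ i\<bar>" "\<lambda>_. \<tau>"] comp by simp
    finally have "L * dist (\<phi> p) (\<phi> s) \<le> L * (?d * \<tau>)"
      using L by (intro mult_left_mono) auto
    also have "\<dots> = t" using L by (simp add: \<tau>_def)
    finally have "dist p s \<le> t" using inv[OF p(1) s] by linarith
    then show ?thesis using \<open>p \<in> P\<close> by auto
  qed
  then show thesis using card fin by (intro that[of P]) (auto simp: P_def)
qed

text \<open>By compactness finitely many charts suffice, and a Lebesgue number puts every small
  piece of S into a single one of them; this makes \<open>N\<close> and \<open>r0\<close> uniform in
  x. In codimension d the finite set S covers itself and the exponent is 0.\<close>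

lemma submanifold_cover:
  fixes S :: "(real^'n::finite) set"
  assumes S: "compact_lipschitz_submanifold k S" "S \<noteq> {}" and k: "k \<le> CARD('n)"
  obtains N r0 where "0 < N" "0 < r0"
    "\<And>x r t. 0 < t \<Longrightarrow> t \<le> r \<Longrightarrow> r \<le> r0 \<Longrightarrow> \<exists>P. finite P \<and>
       real (card P) \<le> N * (r / t) ^ (CARD('n) - k) \<and> S \<inter> ball x (2 * r) \<subseteq> (\<Union>p\<in>P. cball p t)"
proof (cases "k = CARD('n)")
  case True
  then have "finite S" using S by (simp add: compact_lipschitz_submanifold_def)
  show thesis
  proof (rule that[of "real (card S)" 1])
    show "0 < real (card S)" using \<open>finite S\<close> S by (simp add: card_gt_0_iff)
    show "\<exists>P. finite P \<and> real (card P) \<le> real (card S) * (r / t) ^ (CARD('n) - k) \<and> S \<inter> ball x (2 * r) \<subseteq> (\<Union>p\<in>P. cball p t)"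
      if "0 < t" for x r t
    proof (intro exI[of _ S] conjI)
      show "S \<inter> ball x (2 * r) \<subseteq> (\<Union>p\<in>S. cball p t)" using that by force
    qed (use \<open>finite S\<close> True in simp_all)
  qed simp
next
  case False
  then have comp: "compact S" and chart: "\<forall>x\<in>S. \<exists>V (\<phi> :: real^'n \<Rightarrow> real^'n) I.
              open V \<and> x \<in> V \<and> bi_lipschitz_on V \<phi> \<and>
              card I = CARD('n) - k \<and> \<phi> ` (S \<inter> V) = coordinate_cube I"
    using S by (auto simp: compact_lipschitz_submanifold_def)
  from chart obtain V \<phi> I where ch: "\<And>x. x \<in> S \<Longrightarrow> open (V x) \<and> x \<in> V x \<and> bi_lipschitz_on (V x) (\<phi> x :: real^'n \<Rightarrow> real^'n) \<and>
              card (I x) = CARD('n) - k \<and> \<phi> x ` (S \<inter> V x) = coordinate_cube (I x)"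
    by metis
  then have "\<And>x. x \<in> S \<Longrightarrow> \<exists>L. L-lipschitz_on (V x) (\<phi> x) \<and> (\<forall>y\<in>V x. \<forall>z\<in>V x. dist y z \<le> L * dist (\<phi> x y) (\<phi> x z))"
    by (simp add: bi_lipschitz_on_def)
  then obtain L where L: "\<And>x. x \<in> S \<Longrightarrow> (L x)-lipschitz_on (V x) (\<phi> x)"
     "\<And>x y z. x \<in> S \<Longrightarrow> y \<in> V x \<Longrightarrow> z \<in> V x \<Longrightarrow> dist y z \<le> L x * dist (\<phi> x y) (\<phi> x z)"
    by metis
  have opV: "\<And>x. x \<in> S \<Longrightarrow> open (V x)" and inV: "\<And>x. x \<in> S \<Longrightarrow> x \<in> V x" using ch by blast+
  have covV: "S \<subseteq> (\<Union>x\<in>S. V x)" using inV by blast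
  obtain X where X: "X \<subseteq> S" "finite X" "S \<subseteq> (\<Union>x\<in>X. V x)"
    by (rule compactE_image[OF comp opV covV]) blast+
  have "X \<noteq> {}" using X S by auto
  \<comment> \<open>Inserting 1 yields the bound 1 \<le> L that \<open>chart_cover\<close>
    requires.\<close>
  define L0 where "L0 = Max (insert 1 (L ` X))"
  have L0: "1 \<le> L0" "\<And>x. x \<in> X \<Longrightarrow> L x \<le> L0" using X by (auto simp: L0_def)
  obtain \<delta> where \<delta>: "0 < \<delta>" "\<And>T. \<lbrakk>T \<subseteq> S; diameter T < \<delta>\<rbrakk> \<Longrightarrow> \<exists>B \<in> V ` X. T \<subseteq> B"
  proof (rule Lebesgue_number_lemma[OF comp, of "V ` X"])
    show "V ` X \<noteq> {}" "S \<subseteq> \<Union> (V ` X)" using X \<open>X \<noteq> {}\<close> by simp_all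
    show "open B" if "B \<in> V ` X" for B using that opV X by blast
  qed blast
  show thesis
  proof (rule that[of "(8 * L0\<^sup>2 * CARD('n) + 3) ^ (CARD('n) - k)" "\<delta> / 8"])
    show "0 < (8 * L0\<^sup>2 * CARD('n) + 3) ^ (CARD('n) - k)"
      using L0 by (intro zero_less_power add_nonneg_pos) auto
    show "0 < \<delta> / 8" using \<delta> by simp
    fix x r t assume t: "0 < t" "t \<le> r" and r: "r \<le> \<delta> / 8"
    define T where "T = S \<inter> ball x (2 * r)"
    \<comment> \<open>From r \<le> \<delta> / 8 the ball has diameter 4 r \<le> \<delta> / 2,
      strictly below the Lebesgue number.\<close>
    have "diameter T \<le> diameter (ball x (2 * r))"
      by (rule diameter_subset) (auto simp: T_def)
    also have "\<dots> < \<delta>" using t r \<delta>(1) by (simp add: diameter_ball)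
    finally obtain z where z: "z \<in> X" "T \<subseteq> V z" using \<delta>(2)[of T] by (auto simp: T_def)
    then have zS: "z \<in> S" using X by auto
    obtain P where P: "finite P" "real (card P) \<le> ((8 * L0\<^sup>2 * CARD('n) + 3) * (r / t)) ^ card (I z)"
      "T \<subseteq> (\<Union>p\<in>P. cball p t)"
    proof (rule chart_cover[of T "\<phi> z" L0 "I z" r t])
      fix a b assume ab: "a \<in> T" "b \<in> T"
      then have V: "a \<in> V z" "b \<in> V z" using z by auto
      show "dist (\<phi> z a) (\<phi> z b) \<le> L0 * dist a b"
        using lipschitz_onD[OF L(1)[OF zS] V] mult_right_mono[OF L0(2)[OF z(1)], of "dist a b"] by simp
      show "dist a b \<le> L0 * dist (\<phi> z a) (\<phi> z b)"
        using L(2)[OF zS V] mult_right_mono[OF L0(2)[OF z(1)], of "dist (\<phi> z a) (\<phi> z b)"] by simp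
      show "dist a b \<le> 4 * r"
        using ab dist_triangle[of a b x] by (simp add: T_def dist_commute)
    next
      fix a i assume a: "a \<in> T" and i: "i \<notin> I z"
      then have "\<phi> z a \<in> coordinate_cube (I z)" using z conjunct2[OF conjunct2[OF conjunct2[OF conjunct2[OF ch[OF zS]]]]] by (fastforce simp: T_def)
      then show "\<phi> z a $ i = 0" using i by (simp add: coordinate_cube_def)
    qed (use L0 t in auto)
    then show "\<exists>P. finite P \<and> real (card P) \<le> (8 * L0\<^sup>2 * CARD('n) + 3) ^ (CARD('n) - k) * (r / t) ^ (CARD('n) - k) \<and>
        S \<inter> ball x (2 * r) \<subseteq> (\<Union>p\<in>P. cball p t)"
      using ch[OF zS] by (intro exI[of _ P]) (simp add: T_def power_mult_distrib[symmetric])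
  qed
qed

section \<open>Tube volumes and negative powers of the distance\<close>

lemma submanifold_closed: "compact_lipschitz_submanifold k S \<Longrightarrow> closed S"
  by (auto simp: compact_lipschitz_submanifold_def compact_imp_closed finite_imp_closed split: if_splits)

text \<open>A point of the ball at distance less than t from S has a nearest point in S within 2 r
  of x. Doubling the radii of a cover of that piece by t-balls covers the tube: about (r / t)^(d-k)
  balls of volume about t^d.\<close>

lemma submanifold_tube_volume:
  fixes S :: "(real^'n::finite) set"
  assumes S: "compact_lipschitz_submanifold k S" "S \<noteq> {}" and k: "k \<le> CARD('n)"
  obtains C r0 where "0 < C" "0 < r0"
    "\<And>x r t. 0 < t \<Longrightarrow> t \<le> r \<Longrightarrow> r \<le> r0 \<Longrightarrow>
       emeasure lborel {y \<in> ball x r. infdist y S < t} \<le> ennreal (C * t ^ k * r ^ (CARD('n) - k))"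
proof -
  let ?d = "CARD('n)"
  obtain N r0 where N: "0 < N" "0 < r0"
    and cov: "\<And>x r t. 0 < t \<Longrightarrow> t \<le> r \<Longrightarrow> r \<le> r0 \<Longrightarrow> \<exists>P. finite P \<and>
       real (card P) \<le> N * (r / t) ^ (?d - k) \<and> S \<inter> ball x (2 * r) \<subseteq> (\<Union>p\<in>P. cball p t)"
    using submanifold_cover[OF S k] by blast
  let ?v = "unit_ball_vol (real ?d)"
  show thesis
  proof (rule that[of "N * (?v * 2 ^ ?d)" r0])
    fix x :: "real^'n" and r t :: real assume t: "0 < t" "t \<le> r" and r: "r \<le> r0"
    obtain P where P: "finite P" "real (card P) \<le> N * (r / t) ^ (?d - k)" "S \<inter> ball x (2 * r) \<subseteq> (\<Union>p\<in>P. cball p t)"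
      using cov[OF t r] by blast
    have sub: "{y \<in> ball x r. infdist y S < t} \<subseteq> (\<Union>p\<in>P. ball p (2 * t))"
    proof clarify
      fix y assume y: "y \<in> ball x r" "infdist y S < t"
      obtain s where s: "s \<in> S" "infdist y S = dist y s"
        using infdist_attains_inf[OF submanifold_closed[OF S(1)] S(2)] by blast
      have "dist x s < 2 * r" using y s t dist_triangle[of x s y] by simp
      then obtain p where p: "p \<in> P" "dist p s \<le> t" using s P(3) by auto
      have "dist p y < 2 * t" using p y s dist_triangle[of p y s] by (simp add: dist_commute)
      then show "y \<in> (\<Union>p\<in>P. ball p (2 * t))" using p by auto
    qed
    have "emeasure lborel {y \<in> ball x r. infdist y S < t} \<le> emeasure lborel (\<Union>p\<in>P. ball p (2 * t))"
      by (rule emeasure_mono[OF sub]) (use P in auto)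
    also have "\<dots> \<le> (\<Sum>p\<in>P. emeasure lborel (ball p (2 * t)))"
      by (rule emeasure_subadditive_finite) (use P in auto)
    also have "\<dots> = ennreal (real (card P) * (?v * (2 * t) ^ ?d))"
      using t by (simp add: emeasure_ball ennreal_mult ennreal_of_nat_eq_real_of_nat)
    also have "\<dots> \<le> ennreal ((N * (r / t) ^ (?d - k)) * (?v * (2 * t) ^ ?d))"
      using t by (intro ennreal_leI mult_right_mono P) auto
    also have "(N * (r / t) ^ (?d - k)) * (?v * (2 * t) ^ ?d) = N * (?v * 2 ^ ?d) * t ^ k * r ^ (?d - k)"
    proof -
      have "t ^ ?d = t ^ k * t ^ (?d - k)" using k by (simp flip: power_add)
      then show ?thesis using t by (simp add: power_mult_distrib power_divide)
    qed
    finally show "emeasure lborel {y \<in> ball x r. infdist y S < t} \<le> ennreal (N * (?v * 2 ^ ?d) * t ^ k * r ^ (?d - k))" .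
  qed (use N in auto)
qed

lemma infdist_measurable [measurable]: "(\<lambda>x. infdist x S) \<in> borel_measurable borel"
  by (intro borel_measurable_continuous_onI continuous_intros)

text \<open>Locally S lies in tubes of arbitrarily small width, whose volume tends to 0 because k
  \<ge> 1.\<close>

lemma submanifold_null:
  fixes S :: "(real^'n::finite) set"
  assumes S: "compact_lipschitz_submanifold k S" "S \<noteq> {}" and k: "1 \<le> k" "k \<le> CARD('n)"
  shows "AE x in lborel. x \<notin> S"
proof -
  have cl: "closed S" by (rule submanifold_closed[OF S(1)])
  have comp: "compact S" using S by (auto simp: compact_lipschitz_submanifold_def finite_imp_compact split: if_splits)
  obtain C r0 where C: "0 < C" "0 < r0" and vol: "\<And>x r t. 0 < t \<Longrightarrow> t \<le> r \<Longrightarrow> r \<le> r0 \<Longrightarrow>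
       emeasure lborel {y \<in> ball x r. infdist y S < t} \<le> ennreal (C * t ^ k * r ^ (CARD('n) - k))"
    using submanifold_tube_volume[OF S k(2)] by blast
  have null: "S \<inter> ball x r0 \<in> null_sets lborel" for x
  proof -
    let ?b = "\<lambda>n. C * (r0 * dyadic n) ^ k * r0 ^ (CARD('n) - k)"
    have "emeasure lborel (S \<inter> ball x r0) \<le> ennreal (?b n)" for n
    proof -
      have "0 < r0 * dyadic n" using C by simp
      then have "emeasure lborel (S \<inter> ball x r0) \<le> emeasure lborel {y \<in> ball x r0. infdist y S < r0 * dyadic n}"
        by (intro emeasure_mono) auto
      also have "\<dots> \<le> ennreal (?b n)" using C by (intro vol) (auto simp: mult_left_le)
      finally show ?thesis .
    qed
    moreover have "(\<lambda>n. ennreal (?b n)) \<longlonglongrightarrow> ennreal (C * (r0 * 0) ^ k * r0 ^ (CARD('n) - k))"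
      by (intro tendsto_ennrealI tendsto_intros dyadic_tendsto)
    ultimately have "emeasure lborel (S \<inter> ball x r0) \<le> ennreal (C * (r0 * 0) ^ k * r0 ^ (CARD('n) - k))"
      by (intro LIMSEQ_le_const) auto
    then have "emeasure lborel (S \<inter> ball x r0) = 0" using k by (simp add: power_0_left)
    then show ?thesis using cl by (auto simp: null_sets_def borel_closed)
  qed
  obtain X where X: "X \<subseteq> S" "finite X" "S \<subseteq> (\<Union>x\<in>X. ball x r0)"
    by (rule compactE_image[OF comp, of S "\<lambda>x. ball x r0"]) (use C in auto)
  have "S = (\<Union>x\<in>X. S \<inter> ball x r0)" using X by auto
  also have "\<dots> \<in> null_sets lborel" using X null by (intro null_sets.finite_UN) auto
  finally show ?thesis by (rule AE_not_in)
qed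

text \<open>Sum over the dyadic layers of the distance relative to r: the layer at distance t has
  volume at most a multiple of t^k r^(d-k), and the powers t^(k-s) are summable for s < k.
  \<open>r0\<close> is independent of s, so two exponents can share one starting scale.\<close>

proposition submanifold_weight_integral:
  fixes S :: "(real^'n::finite) set"
  assumes S: "compact_lipschitz_submanifold k S" "S \<noteq> {}" and k: "k \<le> CARD('n)"
  obtains r0 where "0 < r0" "\<And>s::real. 0 \<le> s \<Longrightarrow> s < real k \<Longrightarrow> \<exists>C>0. \<forall>x r. 0 < r \<longrightarrow> r \<le> r0 \<longrightarrow>
       (\<integral>\<^sup>+ y. ennreal (infdist y S powr (- s)) * indicator (ball x r) y \<partial>lborel) \<le> ennreal (C * r powr (CARD('n) - s))"
proof -
  let ?d = "CARD('n)"
  obtain C r0 where C: "0 < C" "0 < r0" and vol: "\<And>x r t. 0 < t \<Longrightarrow> t \<le> r \<Longrightarrow> r \<le> r0 \<Longrightarrow>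
       emeasure lborel {y \<in> ball x r. infdist y S < t} \<le> ennreal (C * t ^ k * r ^ (?d - k))"
    using submanifold_tube_volume[OF S k] by blast
  let ?v = "unit_ball_vol (real ?d)"
  have main: "\<exists>C>0. \<forall>(x::real^'n) r. 0 < r \<longrightarrow> r \<le> r0 \<longrightarrow>
       (\<integral>\<^sup>+ y. ennreal (infdist y S powr (- s)) * indicator (ball x r) y \<partial>lborel) \<le> ennreal (C * r powr (?d - s))"
    if s: "0 \<le> s" "s < real k" for s :: real
  proof -
    define Z where "Z = 1 / (1 - 2 powr - (real k - s))"
    have Z: "0 < Z" using s by (simp add: Z_def powr_less_one)
    define K where "K = ?v + 2 powr s * C * Z"
    have "0 < K" using C Z by (auto simp: K_def intro!: add_pos_pos)
    show ?thesis
    proof (intro exI[of _ K] conjI allI impI)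
      fix x :: "real^'n" and r :: real assume r: "0 < r" "r \<le> r0"
      let ?A = "\<lambda>j. {y \<in> ball x r. infdist y S < dyadic j * r}"
      have meas: "?A j \<in> sets borel" for j by measurable
      let ?c = "\<lambda>j. (dyadic (Suc j) * r) powr (- s)"
      have "(\<integral>\<^sup>+ y. ennreal (infdist y S powr (- s)) * indicator (ball x r) y \<partial>lborel) \<le>
        (\<integral>\<^sup>+ y. ennreal (r powr (- s)) * indicator (ball x r) y + (\<Sum>j. ennreal (?c j) * indicator (?A j) y) \<partial>lborel)"
      proof (rule nn_integral_mono)
        fix y
        consider "y \<notin> ball x r \<or> infdist y S = 0" | "y \<in> ball x r" "r \<le> infdist y S"
          | "y \<in> ball x r" "0 < infdist y S" "infdist y S < r"
          using infdist_nonneg[of y S] by linarith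
        then show "ennreal (infdist y S powr (- s)) * indicator (ball x r) y \<le>
          ennreal (r powr (- s)) * indicator (ball x r) y + (\<Sum>j. ennreal (?c j) * indicator (?A j) y)"
        proof cases
          \<comment> \<open>Points of S contribute nothing, since
            \<open>0 powr (- s) = 0\<close>.\<close>
          case 1 then show ?thesis by auto
        next
          case 2
          then have "infdist y S powr (- s) \<le> r powr (- s)" using r s by (intro powr_mono2') auto
          then show ?thesis using 2 by (intro add_increasing2) (auto intro: ennreal_leI)
        next
          case 3
          then have "0 < infdist y S / r" "infdist y S / r < dyadic 0" using r by auto
          then obtain j where "dyadic (Suc (j + 0)) \<le> infdist y S / r" "infdist y S / r < dyadic (j + 0)"
            by (rule dyadic_bracket)
          then have j: "dyadic (Suc j) * r \<le> infdist y S" "infdist y S < dyadic j * r"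
            using r by (auto simp: field_simps simp del: dyadic_simps(6))
          then have "infdist y S powr (- s) \<le> ?c j" using r s by (intro powr_mono2') (auto simp del: dyadic_simps(6))
          then have "ennreal (infdist y S powr (- s)) * indicator (ball x r) y \<le> ennreal (?c j) * indicator (?A j) y"
            using 3 j by (auto intro: ennreal_leI)
          also have "\<dots> \<le> (\<Sum>j. ennreal (?c j) * indicator (?A j) y)" by (rule le_suminf_ennreal)
          finally show ?thesis by (intro add_increasing) auto
        qed
      qed
      also have "\<dots> = ennreal (r powr (- s)) * emeasure lborel (ball x r) + (\<Sum>j. ennreal (?c j) * emeasure lborel (?A j))"
        using meas by (subst nn_integral_add) (auto simp: nn_integral_suminf nn_integral_cmult_indicator simp del: dyadic_simps(6))
      also have "\<dots> \<le> ennreal (r powr (- s)) * ennreal (?v * r ^ ?d) +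
         (\<Sum>j. ennreal (?c j) * ennreal (C * (dyadic j * r) ^ k * r ^ (?d - k)))"
        using r by (intro add_mono mult_left_mono suminf_le vol) (auto simp: emeasure_ball mult_left_le_one_le simp del: dyadic_simps(6))
      also have "ennreal (r powr (- s)) * ennreal (?v * r ^ ?d) = ennreal (?v * r powr (?d - s))"
        using r by (simp add: powr_diff powr_minus powr_realpow field_simps flip: ennreal_mult)
      also have "(\<Sum>j. ennreal (?c j) * ennreal (C * (dyadic j * r) ^ k * r ^ (?d - k))) =
         (\<Sum>j. ennreal (2 powr s * C * r powr (?d - s)) * ennreal (dyadic j powr (real k - s)))"
      proof (intro suminf_cong)
        fix j
        have rk: "r ^ k * r ^ (?d - k) = r ^ ?d" using k by (simp flip: power_add)
        have "?c j * (C * (dyadic j * r) ^ k * r ^ (?d - k)) =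
            2 powr s * C * (r powr (- s) * r ^ ?d) * (dyadic j ^ k * dyadic j powr (- s))"
          using r by (simp add: powr_divide powr_mult powr_minus power_mult_distrib rk[symmetric] field_simps)
        also have "r powr (- s) * r ^ ?d = r powr (?d - s)"
          using r by (simp add: powr_diff powr_minus powr_realpow field_simps)
        also have "dyadic j ^ k * dyadic j powr (- s) = dyadic j powr (real k - s)"
          by (simp add: powr_diff powr_minus powr_realpow field_simps)
        finally show "ennreal (?c j) * ennreal (C * (dyadic j * r) ^ k * r ^ (?d - k)) =
          ennreal (2 powr s * C * r powr (?d - s)) * ennreal (dyadic j powr (real k - s))"
          using C r by (simp flip: ennreal_mult del: dyadic_simps(6))
      qed
      also have "\<dots> = ennreal (2 powr s * C * r powr (?d - s)) * ennreal Z"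
        using s by (simp only: ennreal_suminf_cmult suminf_geometric_powr Z_def diff_gt_0_iff_gt)
      also have "ennreal (?v * r powr (?d - s)) + ennreal (2 powr s * C * r powr (?d - s)) * ennreal Z = ennreal (K * r powr (?d - s))"
        using C Z by (simp add: K_def algebra_simps flip: ennreal_mult ennreal_plus)
      finally show "(\<integral>\<^sup>+ y. ennreal (infdist y S powr (- s)) * indicator (ball x r) y \<partial>lborel) \<le> ennreal (K * r powr (?d - s))" .
    qed fact
  qed
  show thesis by (rule that[OF C(2) main])
qed

section \<open>Energy estimates for the distance weight\<close>

lemma ball_avg_square_le_total:
  fixes f \<delta> :: "'a::euclidean_space \<Rightarrow> real" and s C N :: real
  assumes "f \<in> borel_measurable borel" "\<delta> \<in> borel_measurable borel"
    and "\<And>y. 0 \<le> f y" "AE y in lborel. 0 < \<delta> y" and C: "0 \<le> C" and N: "0 \<le> N"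
    and H: "(\<integral>\<^sup>+ y. ennreal (\<delta> y powr (- s)) * indicator (ball x (dyadic i)) y \<partial>lborel)
       \<le> ennreal (C * dyadic i powr (DIM('a) - s))"
    and fN: "(\<integral>\<^sup>+ y. ennreal ((f y)\<^sup>2 * \<delta> y powr s) \<partial>lborel) = ennreal N"
  shows "(ball_mean i f x)\<^sup>2 \<le> ennreal (C * dyadic i powr (- (DIM('a) + s)) * N)"
proof -
  have "(ball_mean i f x)\<^sup>2 \<le>
     ennreal (C * dyadic i powr (- s)) * ball_avg i (\<lambda>y. ennreal ((f y)\<^sup>2 * \<delta> y powr s)) x"
    by (rule ball_avg_cauchy_schwarz) fact+
  also have "\<dots> \<le> ennreal (C * dyadic i powr (- s)) * (ennreal (dyadic i powr (- DIM('a))) * ennreal N)"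
    using ball_avg_le_total[of i "\<lambda>y. ennreal ((f y)\<^sup>2 * \<delta> y powr s)" x] fN by (intro mult_left_mono) auto
  also have "\<dots> = ennreal (C * (dyadic i powr (- s) * dyadic i powr (- DIM('a))) * N)"
    using C N by (simp add: mult_ac flip: ennreal_mult)
  also have "dyadic i powr (- s) * dyadic i powr (- DIM('a)) = dyadic i powr (- (DIM('a) + s))"
    by (simp add: algebra_simps flip: powr_add)
  finally show ?thesis .
qed

text \<open>For q = 2 the hypothesis on the exponents says no more than \<theta> \<le> 1; it is the
  strict inequality that supplies the surplus exponent 2 (1 - \<theta>).\<close>

lemma unweighted_energy:
  fixes q \<theta> :: real
  assumes q: "2 \<le> q" and \<theta>: "\<theta> < 1" and ex: "1 - DIM('a::euclidean_space) / 2 \<ge> \<theta> - DIM('a) / q"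
  obtains K where "0 \<le> K" "\<And>f N. \<lbrakk>f \<in> borel_measurable borel; \<And>y::'a. 0 \<le> f y; 0 \<le> N;
      (\<integral>\<^sup>+ y. ennreal ((f y)\<^sup>2) \<partial>lborel) = ennreal N\<rbrakk> \<Longrightarrow>
      avg_energy \<theta> q i0 (\<lambda>y. ennreal (f y)) \<le> ennreal (K * N powr (q / 2))"
proof (cases "q = 2")
  case True
  let ?v = "unit_ball_vol DIM('a)"
  have v: "0 < ?v" using unit_ball_vol_pos[of "real DIM('a)"] by simp
  let ?\<eta> = "2 * (1 - \<theta>)"
  let ?K = "?v\<^sup>2 / (1 - 2 powr - ?\<eta>)"
  have K: "0 \<le> ?K" using powr_less_one[of 2 "- ?\<eta>"] \<theta> by (intro divide_nonneg_nonneg) auto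
  show thesis
  proof (rule that)
    show "0 \<le> ?v powr ((q - 2) / 2) * ?K" using K by (intro mult_nonneg_nonneg) auto
    fix f :: "'a \<Rightarrow> real" and N :: real
    assume f: "f \<in> borel_measurable borel" "\<And>y. 0 \<le> f y" and N: "0 \<le> N" "(\<integral>\<^sup>+ y. ennreal ((f y)\<^sup>2) \<partial>lborel) = ennreal N"
    have "square_energy ?\<eta> i0 f
       \<le> ennreal ?K * (\<integral>\<^sup>+ y. ennreal ((f y)\<^sup>2) \<partial>lborel)"
      by (rule unweighted_square_energy) (use f \<theta> in auto)
    then have sq: "square_energy ?\<eta> i0 f \<le> ennreal (?K * N)"
      by (simp only: N(2) ennreal_mult[OF K N(1)])
    have "avg_energy \<theta> q i0 (\<lambda>y. ennreal (f y)) \<le> ennreal (?v powr ((q - 2) / 2) * ?K * N powr (q / 2))"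
    proof (rule avg_energy_le_square[where \<gamma>=0, OF f(1) _ K N(1) q _ sq])
      show "(ball_mean i f x)\<^sup>2 \<le> ennreal (?v * dyadic i powr (- (real DIM('a) + 0)) * N)" for i x
        by (rule ball_avg_square_le_total[where \<delta>="\<lambda>_. 1", OF f(1) _ f(2) _ _ N(1) unit_weight_integral])
          (use v N in auto)
    qed (use v True in auto)
    then show "avg_energy \<theta> q i0 (\<lambda>y. ennreal (f y)) \<le> ennreal (?v powr ((q - 2) / 2) * ?K * N powr (q / 2))" .
  qed
next
  case False
  then have q: "2 < q" using q by simp
  let ?v = "unit_ball_vol DIM('a)" let ?d = "real DIM('a)"
  have v: "0 < ?v" using unit_ball_vol_pos[of ?d] by simp
  let ?K = "2 * ?v * (1 / (1 - 2 powr - (?d * (q - 2) / 2)) + 1 / (1 - 2 powr - (?d / 2))) * (?v powr ((q - 2) / 2) * (2 * ?v))"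
  have "2 powr - (?d * (q - 2) / 2) < (1::real)" "2 powr - (?d / 2) < (1::real)" using q by (simp_all add: powr_less_one)
  then have K: "0 \<le> ?K" using v by (intro mult_nonneg_nonneg add_nonneg_nonneg) auto
  have "q * (\<theta> - ?d / q) \<le> q * (1 - ?d / 2)" using ex q by (intro mult_left_mono) auto
  moreover have "q * (\<theta> - ?d / q) = q * \<theta> - ?d" using q by (simp add: right_diff_distrib)
  ultimately have "q * \<theta> - ?d \<le> q * (1 - ?d / 2)" by (simp only:)
  then have ex': "?d * (q - 2) / 2 \<le> q * (1 - \<theta>)" by (simp add: field_simps)
  show thesis
    by (rule that[OF K]) (rule unweighted_critical_energy[OF _ _ _ _ q ex'])
qed

proposition weighted_energy:
  fixes S :: "(real^'n::finite) set" and k :: nat and \<gamma> q \<theta> :: real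
  assumes S: "compact_lipschitz_submanifold k S" "S \<noteq> {}" and k: "1 \<le> k" "k \<le> CARD('n)"
    and \<gamma>: "0 \<le> \<gamma>" "\<gamma> < real k" and q: "2 \<le> q" and \<theta>: "\<theta> < 1"
    and ex: "1 - (real CARD('n) + \<gamma>) / 2 \<ge> \<theta> - real CARD('n) / q"
  obtains i0 K where "0 \<le> K" "\<And>f N. \<lbrakk>f \<in> borel_measurable borel; \<And>y. 0 \<le> f y; 0 \<le> N;
      (\<integral>\<^sup>+ y. ennreal ((f y)\<^sup>2 * dist_weight S \<gamma> y) \<partial>lborel) = ennreal N\<rbrakk> \<Longrightarrow>
      avg_energy \<theta> q i0 (\<lambda>y. ennreal (f y)) \<le> ennreal (K * N powr (q / 2)) \<and>
      (\<forall>i x. i0 \<le> i \<longrightarrow> ball_mean i f x < \<infinity>)"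
proof (cases "\<gamma> = 0")
  case True
  let ?v = "unit_ball_vol (real CARD('n))"
  have v: "0 < ?v" by simp
  obtain K where K: "0 \<le> K" "\<And>f N. \<lbrakk>f \<in> borel_measurable borel; \<And>y::real^'n. 0 \<le> f y; 0 \<le> N;
      (\<integral>\<^sup>+ y. ennreal ((f y)\<^sup>2) \<partial>lborel) = ennreal N\<rbrakk> \<Longrightarrow>
      avg_energy \<theta> q 0 (\<lambda>y. ennreal (f y)) \<le> ennreal (K * N powr (q / 2))"
    by (rule unweighted_energy[where 'a="real^'n" and ?i0.0=0, OF q \<theta>]) (use ex True in auto)
  show thesis
  proof (rule that[OF K(1), of 0], intro conjI allI impI)
    fix f :: "real^'n \<Rightarrow> real" and N :: real
    assume f: "f \<in> borel_measurable borel" "\<And>y. 0 \<le> f y" and N: "0 \<le> N" "(\<integral>\<^sup>+ y. ennreal ((f y)\<^sup>2 * dist_weight S \<gamma> y) \<partial>lborel) = ennreal N"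
    have N2: "(\<integral>\<^sup>+ y. ennreal ((f y)\<^sup>2) \<partial>lborel) = ennreal N" using N(2) True by (simp add: dist_weight_def)
    show "avg_energy \<theta> q 0 (\<lambda>y. ennreal (f y)) \<le> ennreal (K * N powr (q / 2))"
      by (rule K(2)[OF f N(1) N2])
    fix i :: nat and x :: "real^'n"
    have "(ball_mean i f x)\<^sup>2 \<le> ennreal (?v * dyadic i powr (- (real DIM(real^'n) + 0)) * N)"
      by (rule ball_avg_square_le_total[where \<delta>="\<lambda>_. 1", OF f(1) _ f(2) _ _ N(1)
            order_trans[OF unit_weight_integral]])
        (use N2 v in auto)
    then have "(ball_mean i f x)\<^sup>2 < \<infinity>" by (rule le_less_trans) simp
    then show "ball_mean i f x < \<infinity>" by (simp add: power_less_top_ennreal)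
  qed
next
  case False
  then have \<gamma>0: "0 < \<gamma>" using \<gamma> by simp
  let ?d = "CARD('n)" let ?v = "unit_ball_vol (real ?d)" let ?\<delta> = "\<lambda>y. infdist y S"
  have v: "0 < ?v" by simp
  obtain r0 where r0: "0 < r0" and int: "\<And>s::real. 0 \<le> s \<Longrightarrow> s < real k \<Longrightarrow> \<exists>C>0. \<forall>x r. 0 < r \<longrightarrow> r \<le> r0 \<longrightarrow>
       (\<integral>\<^sup>+ y. ennreal (infdist y S powr (- s)) * indicator (ball x r) y \<partial>lborel) \<le> ennreal (C * r powr (?d - s))"
    using submanifold_weight_integral[OF S k(2)] by blast
  obtain i0 where i0: "dyadic i0 < r0" using ex_dyadic_less[OF r0] by blast
  have small: "dyadic i \<le> r0" if "i0 \<le> i" for i using dyadic_antimono[OF that] i0 by simp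
  \<comment> \<open>Half the gap between \<gamma> and k, so that \<gamma> + b is still admissible in
    \<open>int\<close>.\<close>
  define b where "b = (real k - \<gamma>) / 2"
  have b: "0 < b" "0 \<le> \<gamma> + b" "\<gamma> + b < real k" using \<gamma> by (simp_all add: b_def field_simps)
  obtain C1 where C1: "0 < C1" "\<And>x r. 0 < r \<Longrightarrow> r \<le> r0 \<Longrightarrow>
       (\<integral>\<^sup>+ y. ennreal (infdist y S powr (- \<gamma>)) * indicator (ball x r) y \<partial>lborel) \<le> ennreal (C1 * r powr (?d - \<gamma>))"
    using int[OF \<gamma>] by blast
  obtain C2 where C2: "0 < C2" "\<And>x r. 0 < r \<Longrightarrow> r \<le> r0 \<Longrightarrow>
       (\<integral>\<^sup>+ y. ennreal (infdist y S powr (- (\<gamma> + b))) * indicator (ball x r) y \<partial>lborel) \<le> ennreal (C2 * r powr (?d - (\<gamma> + b)))"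
    using int[OF b(2,3)] by blast
  have pos: "AE y in lborel. 0 < ?\<delta> y"
    using submanifold_null[OF S k]
  proof eventually_elim
    case (elim y)
    then have "?\<delta> y \<noteq> 0" using in_closed_iff_infdist_zero[OF submanifold_closed[OF S(1)] S(2)] by blast
    then show ?case using infdist_nonneg[of y S] by linarith
  qed
  let ?K = "?v * (?v + C2) * (1 / (1 - 2 powr - \<gamma>) + 3 powr b / (1 - 2 powr - b))"
  have "2 powr - \<gamma> < (1::real)" "2 powr - b < (1::real)" using \<gamma>0 b by (simp_all add: powr_less_one)
  then have K: "0 \<le> ?K" using v C2(1) by (intro mult_nonneg_nonneg add_nonneg_nonneg) auto
  show thesis
  proof (rule that)
    show "0 \<le> C1 powr ((q - 2) / 2) * ?K" using K by simp
    fix f :: "real^'n \<Rightarrow> real" and N :: real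
    assume f: "f \<in> borel_measurable borel" "\<And>y. 0 \<le> f y" and N: "0 \<le> N" "(\<integral>\<^sup>+ y. ennreal ((f y)\<^sup>2 * dist_weight S \<gamma> y) \<partial>lborel) = ennreal N"
    have N2: "(\<integral>\<^sup>+ y. ennreal ((f y)\<^sup>2 * ?\<delta> y powr \<gamma>) \<partial>lborel) = ennreal N" using N(2) False by (simp add: dist_weight_def)
    have sup: "(ball_mean i f x)\<^sup>2 \<le> ennreal (C1 * dyadic i powr (- (DIM(real^'n) + \<gamma>)) * N)" if "i0 \<le> i" for i x
      by (rule ball_avg_square_le_total[OF f(1) infdist_measurable f(2) pos _ N(1) _ N2])
        (use C1 small[OF that] in auto)
    have "square_energy \<gamma> i0 f
      \<le> ennreal (unit_ball_vol DIM(real^'n) * (unit_ball_vol DIM(real^'n) + C2) * (1 / (1 - 2 powr - \<gamma>) + 3 powr b / (1 - 2 powr - b))) *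
      (\<integral>\<^sup>+ y. ennreal ((f y)\<^sup>2 * ?\<delta> y powr \<gamma>) \<partial>lborel)"
    proof (rule weighted_square_energy[OF f(1) infdist_measurable f(2) pos _ _ \<gamma>0 b(1)])
      show "?\<delta> y \<le> ?\<delta> x + dist x y" for x y
        using infdist_triangle[of y S x] by (simp add: dist_commute)
      show "(\<integral>\<^sup>+ y. ennreal (?\<delta> y powr (- (\<gamma> + b))) * indicator (ball x (dyadic i)) y \<partial>lborel)
         \<le> ennreal (C2 * dyadic i powr (DIM(real^'n) - (\<gamma> + b)))" if "i0 \<le> i" for x i
        using C2(2)[of "dyadic i" x] small[OF that] by simp
    qed (use C2 in simp)
    then have sq: "square_energy \<gamma> i0 f \<le> ennreal (?K * N)"
      by (simp only: N2 ennreal_mult[OF K N(1)] DIM_cart DIM_real mult_1_right)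
    have "q * (\<theta> - ?d / q) \<le> q * (1 - (?d + \<gamma>) / 2)" using ex q by (intro mult_left_mono) auto
    moreover have "q * (\<theta> - ?d / q) = q * \<theta> - ?d" using q by (simp add: right_diff_distrib)
    ultimately have "q * \<theta> - ?d \<le> q * (1 - (?d + \<gamma>) / 2)" by (simp only:)
    then have ex': "\<gamma> \<le> q * (1 - \<theta>) - (DIM(real^'n) + \<gamma>) * (q - 2) / 2" by (simp add: field_simps)
    have "avg_energy \<theta> q i0 (\<lambda>y. ennreal (f y)) \<le> ennreal (C1 powr ((q - 2) / 2) * ?K * N powr (q / 2))"
      by (rule avg_energy_le_square[OF f(1) _ K N(1) q sup sq ex']) (use C1 in simp_all)
    moreover have "ball_mean i f x < \<infinity>" if "i0 \<le> i" for i x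
    proof -
      have "(ball_mean i f x)\<^sup>2 < \<infinity>" using sup[OF that, of x] by (rule le_less_trans) simp
      then show ?thesis by (simp add: power_less_top_ennreal)
    qed
    ultimately show "avg_energy \<theta> q i0 (\<lambda>y. ennreal (f y)) \<le> ennreal (C1 powr ((q - 2) / 2) * ?K * N powr (q / 2)) \<and>
      (\<forall>i x. i0 \<le> i \<longrightarrow> ball_mean i f x < \<infinity>)" by blast
  qed
qed

text \<open>A value of u is controlled by the oscillation at scale \<open>i0\<close> and the average
  of |u| there. The latter contributes a single term of an unweighted energy with |u| in place of
  the gradient, and so is bounded by the L^2 norm.\<close>

proposition Lq_energy:
  fixes q \<theta> :: real
  assumes \<theta>: "0 < \<theta>" and q: "2 \<le> q"
  obtains K where "0 \<le> K"
    "\<And>(u :: 'a::euclidean_space \<Rightarrow> real) f N. \<lbrakk>u \<in> borel_measurable borel; f \<in> borel_measurable borel;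
      AE x in lborel. osc_controlled u f x;
      \<And>i z. i0 \<le> i \<Longrightarrow> ball_avg i f z < \<infinity>; 0 \<le> N; (\<integral>\<^sup>+ x. ennreal (\<bar>u x\<bar>\<^sup>2) \<partial>lborel) = ennreal N\<rbrakk> \<Longrightarrow>
     (\<integral>\<^sup>+ x. ennreal (\<bar>u x\<bar> powr q) \<partial>lborel) \<le> ennreal K * (avg_energy \<theta> q i0 f + ennreal (N powr (q / 2)))"
proof -
  let ?d = "DIM('a)" let ?v = "unit_ball_vol DIM('a)"
  have v: "0 < ?v" using unit_ball_vol_pos[of "real DIM('a)"] by simp
  define C where "C = 1 / ?v"
  have C: "0 < C" using v by (simp add: C_def)
  define K1 where "K1 = (C * 2 ^ ?d / (1 - 2 powr - (\<theta> / 2))) powr q"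
  define K2 where "K2 = 1 / (1 - 2 powr - (\<theta> * q / 2))"
  have K2: "0 \<le> K2" using \<theta> q powr_less_one[of 2 "- (\<theta> * q / 2)"] by (simp add: K2_def)
  \<comment> \<open>Only one scale is involved, so any \<tau> < 1 that satisfies the unweighted
    hypothesis on the exponents will do. The summand 1 keeps \<tau> below 1 for q = 2; negative
    values are allowed.\<close>
  define \<tau> where "\<tau> = 1 - (1 + ?d * (q - 2) / 2) / q"
  have \<tau>: "\<tau> < 1" using q by (simp add: \<tau>_def add_pos_nonneg)
  have q\<tau>: "q * (1 - \<tau>) = 1 + ?d * (q - 2) / 2" using q by (simp add: \<tau>_def)
  obtain K3 where K3: "0 \<le> K3" "\<And>f N. \<lbrakk>f \<in> borel_measurable borel; \<And>y::'a. 0 \<le> f y; 0 \<le> N;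
      (\<integral>\<^sup>+ y. ennreal ((f y)\<^sup>2) \<partial>lborel) = ennreal N\<rbrakk> \<Longrightarrow>
      avg_energy \<tau> q i0 (\<lambda>y. ennreal (f y)) \<le> ennreal (K3 * N powr (q / 2))"
  proof (rule unweighted_energy[where 'a='a and ?i0.0=i0, OF q \<tau>])
    have "1 - ?d / 2 - (\<tau> - ?d / q) = 1 / q" using q by (simp add: \<tau>_def field_simps)
    moreover have "0 \<le> 1 / q" using q by simp
    ultimately show "1 - ?d / 2 \<ge> \<tau> - ?d / q" by linarith
  qed blast
  define K where "K = 2 powr q * (K1 * (dyadic i0 powr (\<theta> * q) * K2) + C powr q * (dyadic i0 powr (- (q * (1 - \<tau>))) * K3))"
  show thesis
  proof (rule that[of K])
    show "0 \<le> K" using K2 K3(1) by (simp add: K_def K1_def)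
    fix u :: "'a \<Rightarrow> real" and f N
    assume [measurable]: "u \<in> borel_measurable borel" "f \<in> borel_measurable borel"
      and osc: "AE x in lborel. osc_controlled u f x"
      and fin: "\<And>i z. i0 \<le> i \<Longrightarrow> ball_avg i f z < \<infinity>" and N: "0 \<le> N" "(\<integral>\<^sup>+ x. ennreal (\<bar>u x\<bar>\<^sup>2) \<partial>lborel) = ennreal N"
    let ?A = "\<lambda>x. ball_avg i0 (\<lambda>y. ennreal \<bar>u y\<bar>) x"
    let ?P = "osc_sum \<theta> q f i0"
    have Afin: "?A x < \<infinity>" for x
    proof -
      have "(?A x)\<^sup>2 \<le> ennreal (?v * dyadic i0 powr (- (real ?d + 0)) * N)"
        by (rule ball_avg_square_le_total[where \<delta>="\<lambda>_. 1", OF _ _ _ _ _ N(1) unit_weight_integral])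
          (use v N in auto)
      then have "(?A x)\<^sup>2 < \<infinity>" by (rule le_less_trans) simp
      then show ?thesis by (simp add: power_less_top_ennreal)
    qed
    have "(\<integral>\<^sup>+ x. ennreal (\<bar>u x\<bar> powr q) \<partial>lborel) \<le>
       (\<integral>\<^sup>+ x. ennreal (2 powr q) * (ennreal K1 * ?P x + ennreal (C powr q) * ennreal (enn2real (?A x) powr q)) \<partial>lborel)"
    proof (rule nn_integral_mono_AE)
      show "AE x in lborel. ennreal (\<bar>u x\<bar> powr q) \<le>
         ennreal (2 powr q) * (ennreal K1 * ?P x + ennreal (C powr q) * ennreal (enn2real (?A x) powr q))"
        using osc
      proof eventually_elim
        case (elim x)
        show ?case
        proof (rule powr_add_le[OF _ _ _ C])
          show "ennreal \<bar>u x\<bar> \<le> ennreal C * mean_osc i0 u x + ennreal C * ?A x"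
            using abs_le_mean_osc[of u x i0] by (simp only: C_def distrib_left) simp
        next
          fix r :: real assume r: "0 \<le> r"
          show "ennreal (r powr q) \<le> ennreal K1 * ?P x" if "ennreal r \<le> ennreal C * mean_osc i0 u x"
            unfolding K1_def by (rule mean_osc_powr_le[OF _ fin \<theta> _ r C that]) (use elim q in auto)
          show "ennreal (r powr q) \<le> ennreal (C powr q) * ennreal (enn2real (?A x) powr q)" if "ennreal r \<le> ennreal C * ?A x"
          proof -
            have "?A x = ennreal (enn2real (?A x))" using Afin[of x] by simp
            then have "ennreal r \<le> ennreal (C * enn2real (?A x))" using that C by (metis ennreal_mult enn2real_nonneg less_imp_le)
            then have "r \<le> C * enn2real (?A x)" using C by (simp add: ennreal_le_iff)
            then have "r powr q \<le> (C * enn2real (?A x)) powr q" using r q by (intro powr_mono2) auto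
            then show ?thesis using C by (simp add: powr_mult ennreal_leI flip: ennreal_mult)
          qed
        qed (use q in auto)
      qed
    qed
    also have "\<dots> = ennreal (2 powr q) * (ennreal K1 * (\<integral>\<^sup>+ x. ?P x \<partial>lborel) +
        ennreal (C powr q) * (\<integral>\<^sup>+ x. ennreal (enn2real (?A x) powr q) \<partial>lborel))"
      by (subst nn_integral_cmult, measurable) (subst nn_integral_add, measurable, subst nn_integral_cmult, measurable,
        subst nn_integral_cmult, measurable)
    also have "\<dots> \<le> ennreal (2 powr q) * (ennreal K1 * (ennreal (dyadic i0 powr (\<theta> * q)) * (ennreal K2 * avg_energy \<theta> q i0 f)) +
        ennreal (C powr q) * (ennreal (dyadic i0 powr (- (q * (1 - \<tau>)))) * ennreal (K3 * N powr (q / 2))))"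
    proof (intro mult_left_mono add_mono)
      \<comment> \<open>The oscillation at scale \<open>i0\<close> is the term with index 0 of the
        series in \<open>osc_sum_energy\<close>.\<close>
      have "ennreal (dyadic i0 powr (- (\<theta> * q))) * (\<integral>\<^sup>+ x. ?P x \<partial>lborel) \<le>
         (\<Sum>n. ennreal (dyadic (n + i0) powr (- (\<theta> * q))) * (\<integral>\<^sup>+ x. osc_sum \<theta> q f (n + i0) x \<partial>lborel))"
        using le_suminf_ennreal[of "\<lambda>n. ennreal (dyadic (n + i0) powr (- (\<theta> * q))) * (\<integral>\<^sup>+ x. osc_sum \<theta> q f (n + i0) x \<partial>lborel)" 0] by simp
      also have "\<dots> \<le> ennreal K2 * avg_energy \<theta> q i0 f"
        unfolding K2_def by (rule osc_sum_energy) (use \<theta> q in auto)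
      finally have "ennreal (dyadic i0 powr (\<theta> * q)) * (ennreal (dyadic i0 powr (- (\<theta> * q))) * (\<integral>\<^sup>+ x. ?P x \<partial>lborel))
          \<le> ennreal (dyadic i0 powr (\<theta> * q)) * (ennreal K2 * avg_energy \<theta> q i0 f)"
        by (rule mult_left_mono) simp
      then show "(\<integral>\<^sup>+ x. ?P x \<partial>lborel) \<le> ennreal (dyadic i0 powr (\<theta> * q)) * (ennreal K2 * avg_energy \<theta> q i0 f)"
        by (simp add: mult.assoc[symmetric] flip: ennreal_mult powr_add)
    next
      let ?I = "\<integral>\<^sup>+ x. ennreal (enn2real (?A x) powr q) \<partial>lborel"
      have "ennreal (dyadic i0 powr (q * (1 - \<tau>))) * ?I \<le> avg_energy \<tau> q i0 (\<lambda>y. ennreal \<bar>u y\<bar>)"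
        unfolding avg_energy_def
        using le_suminf_ennreal[of "\<lambda>i. ennreal (dyadic (i + i0) powr (q * (1 - \<tau>))) *
          (\<integral>\<^sup>+ x. ennreal (enn2real (ball_avg (i + i0) (\<lambda>y. ennreal \<bar>u y\<bar>) x) powr q) \<partial>lborel)" 0] by simp
      also have "\<dots> \<le> ennreal (K3 * N powr (q / 2))" by (rule K3(2)) (use N in auto)
      finally have "ennreal (dyadic i0 powr (- (q * (1 - \<tau>)))) * (ennreal (dyadic i0 powr (q * (1 - \<tau>))) * ?I) \<le>
          ennreal (dyadic i0 powr (- (q * (1 - \<tau>)))) * ennreal (K3 * N powr (q / 2))"
        by (rule mult_left_mono) simp
      then show "?I \<le> ennreal (dyadic i0 powr (- (q * (1 - \<tau>)))) * ennreal (K3 * N powr (q / 2))"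
        by (simp add: mult.assoc[symmetric] flip: ennreal_mult powr_add)
    qed auto
    also have "\<dots> = ennreal (2 powr q * (K1 * (dyadic i0 powr (\<theta> * q) * K2))) * avg_energy \<theta> q i0 f +
       ennreal (2 powr q * (C powr q * (dyadic i0 powr (- (q * (1 - \<tau>))) * K3))) * ennreal (N powr (q / 2))"
      using K2 K3(1) by (simp add: K1_def distrib_left ennreal_mult mult.assoc)
    also have "\<dots> \<le> ennreal K * avg_energy \<theta> q i0 f + ennreal K * ennreal (N powr (q / 2))"
      using K2 K3(1) by (intro add_mono mult_right_mono ennreal_leI) (auto simp: K_def K1_def distrib_left)
    finally show "(\<integral>\<^sup>+ x. ennreal (\<bar>u x\<bar> powr q) \<partial>lborel) \<le> ennreal K * (avg_energy \<theta> q i0 f + ennreal (N powr (q / 2)))"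
      by (simp only: distrib_left)
  qed
qed

section \<open>The embedding\<close>

lemma locally_integrable_measurable:
  fixes g :: "'a::euclidean_space \<Rightarrow> 'b::euclidean_space"
  assumes "locally_integrable g"
  shows "g \<in> borel_measurable lebesgue"
proof -
  let ?Q = "\<lambda>n. cbox (- (real n *\<^sub>R One)) (real n *\<^sub>R One) :: 'a set"
  have m: "(\<lambda>x. indicator (?Q n) x *\<^sub>R g x) \<in> borel_measurable lebesgue" for n
    using assms compact_cbox
    unfolding locally_integrable_def set_integrable_def by (intro borel_measurable_integrable) blast
  show ?thesis
  proof (rule borel_measurable_LIMSEQ_metric[OF m])
    fix x :: 'a
    have "x \<in> (\<Union>i::nat. box (- (real i *\<^sub>R One)) (real i *\<^sub>R One))" unfolding UN_box_eq_UNIV by simp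
    then obtain N :: nat where N: "x \<in> box (- (real N *\<^sub>R One)) (real N *\<^sub>R One)" by blast
    have "\<forall>\<^sub>F n in sequentially. indicator (?Q n) x *\<^sub>R g x = g x"
    proof (rule eventually_sequentiallyI[of N])
      fix n assume n: "N \<le> n"
      have "x \<in> ?Q n"
        unfolding mem_box
      proof
        fix b :: 'a assume b: "b \<in> Basis"
        then have "- real N < x \<bullet> b \<and> x \<bullet> b < real N" using N by (auto simp: mem_box)
        then show "- (real n *\<^sub>R One) \<bullet> b \<le> x \<bullet> b \<and> x \<bullet> b \<le> real n *\<^sub>R One \<bullet> b"
          using b n by (simp add: inner_minus_left)
      qed
      then show "indicator (?Q n) x *\<^sub>R g x = g x" by simp
    qed
    then show "(\<lambda>n. indicator (?Q n) x *\<^sub>R g x) \<longlonglongrightarrow> g x" by (rule tendsto_eventually)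
  qed
qed

lemma borel_representative:
  fixes g :: "real^'n::finite \<Rightarrow> real^'m::finite"
  assumes [measurable]: "g \<in> borel_measurable lebesgue"
  obtains h where "h \<in> borel_measurable borel" "AE x in lborel. g x = h x"
proof -
  have "\<exists>h\<in>borel_measurable lborel. AE x in lborel. g x $ i = h x" for i
    by (rule completion_ex_borel_measurable_real) simp
  then obtain h where h: "\<And>i. h i \<in> borel_measurable lborel" "\<And>i. AE x in lborel. g x $ i = h i x" by metis
  show thesis
  proof (rule that[of "\<lambda>x. \<chi> i. h i x"])
    show "(\<lambda>x. \<chi> i. h i x) \<in> borel_measurable borel"
      unfolding borel_measurable_euclidean_space[where f="\<lambda>x. \<chi> i. h i x"]
      using h(1) by (auto simp: Basis_vec_def inner_axis)
    have "AE x in lborel. \<forall>i\<in>UNIV. g x $ i = h i x" using h(2) by (intro AE_finite_allI) auto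
    then show "AE x in lborel. g x = (\<chi> i. h i x)" by eventually_elim (simp add: vec_eq_iff)
  qed
qed

lemma set_integrable_representative:
  fixes g h :: "'a::euclidean_space \<Rightarrow> 'b::euclidean_space"
  assumes g: "locally_integrable g" and [measurable]: "h \<in> borel_measurable borel" and gh: "AE x in lborel. g x = h x"
  shows "set_integrable lborel (box a b) h"
proof -
  have "g absolutely_integrable_on cbox a b" using g compact_cbox unfolding locally_integrable_def by blast
  then have "set_integrable lebesgue (box a b) g"
    by (rule set_integrable_subset) (auto simp: box_subset_cbox)
  moreover have "AE x in lebesgue. indicator (box a b) x *\<^sub>R g x = indicator (box a b) x *\<^sub>R h x"
    using AE_completion[OF gh] by eventually_elim simp
  ultimately have "integrable lebesgue (\<lambda>x. indicator (box a b) x *\<^sub>R h x)"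
    unfolding set_integrable_def
    by (subst integrable_cong_AE[where g="\<lambda>x. indicator (box a b) x *\<^sub>R g x"]) (auto intro: borel_measurable_integrable measurable_completion)
  then show ?thesis unfolding set_integrable_def by (subst (asm) integrable_completion) auto
qed

text \<open>Weak gradients are defined by Lebesgue integrals of Lebesgue measurable functions,
  whereas the difference formula was derived for Borel functions. Both integrals in the defining
  identity are moved to representatives.\<close>

lemma has_weak_gradient_difference:
  fixes u u' :: "real^'n::finite \<Rightarrow> real" and g g' :: "real^'n \<Rightarrow> real^'n"
  assumes w: "has_weak_gradient u g"
    and [measurable]: "u' \<in> borel_measurable borel" "g' \<in> borel_measurable borel"
    and uu': "AE x in lborel. u x = u' x" and gg': "AE x in lborel. g x = g' x"
  shows "AE x in lborel. u' (x + h) - u' x = (LINT t|lborel. (g' (x + t *\<^sub>R h) \<bullet> h) * indicator {0..1} t)"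
proof (rule weak_gradient_difference)
  have u: "locally_integrable u" and g: "locally_integrable g" using w by (simp_all add: has_weak_gradient_def)
  show "set_integrable lborel (box a b) u'" for a b by (rule set_integrable_representative[OF u _ uu']) simp
  show "set_integrable lborel (box a b) g'" for a b by (rule set_integrable_representative[OF g _ gg']) simp
  fix a b :: "real^'n" and c :: real and i assume c: "c > 0"
  note partial_deriv_box_bump_measurable[OF c, measurable] box_bump_measurable[OF c, measurable]
  have [measurable]: "u \<in> borel_measurable lebesgue" "g \<in> borel_measurable lebesgue"
    using u g by (simp_all add: locally_integrable_measurable)
  have [measurable]: "f \<in> borel_measurable lebesgue" if "f \<in> borel_measurable borel" for f :: "real^'n \<Rightarrow> real"
    using that by (intro measurable_completion) simp
  have gi: "(\<lambda>x. g x $ i) \<in> borel_measurable lebesgue" by measurable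
  have "(LINT x|lborel. u' x * partial_deriv i (box_bump c a b) x) = (LINT x|lebesgue. u' x * partial_deriv i (box_bump c a b) x)"
    by (rule integral_completion[symmetric]) simp
  also have "\<dots> = (LINT x|lebesgue. u x * partial_deriv i (box_bump c a b) x)"
  proof (rule integral_cong_AE)
    show "AE x in lebesgue. u' x * partial_deriv i (box_bump c a b) x = u x * partial_deriv i (box_bump c a b) x"
      using AE_completion[OF uu'] by eventually_elim simp
  qed (auto intro!: borel_measurable_times measurable_completion)
  also have "\<dots> = - (LINT x|lebesgue. g x $ i * box_bump c a b x)"
    using w prod_bump_test_function[OF c] unfolding has_weak_gradient_def box_bump_def by blast
  also have "(LINT x|lebesgue. g x $ i * box_bump c a b x) = (LINT x|lebesgue. g' x $ i * box_bump c a b x)"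
  proof (rule integral_cong_AE)
    show "AE x in lebesgue. g x $ i * box_bump c a b x = g' x $ i * box_bump c a b x"
      using AE_completion[OF gg'] by eventually_elim simp
  qed (use gi in \<open>auto intro!: borel_measurable_times measurable_completion\<close>)
  also have "\<dots> = (LINT x|lborel. g' x $ i * box_bump c a b x)"
    by (rule integral_completion) simp
  finally show "(LINT x|lborel. u' x * partial_deriv i (box_bump c a b) x) = - (LINT x|lborel. g' x $ i * box_bump c a b x)" .
qed simp_all

text \<open>The null set of bad x depends on h. Exchanging the quantifiers on the product space
  gives, for almost every x, the bound for almost every h, as \<open>mean_osc_le\<close>
  requires.\<close>

lemma mean_osc_le_of_difference:
  fixes u :: "real^'n::finite \<Rightarrow> real" and g :: "real^'n \<Rightarrow> real^'n"
  assumes [measurable]: "u \<in> borel_measurable borel" "g \<in> borel_measurable borel"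
    and diff: "\<And>h. AE x in lborel. u (x + h) - u x = (LINT t|lborel. (g (x + t *\<^sub>R h) \<bullet> h) * indicator {0..1} t)"
  shows "AE x in lborel. osc_controlled u (\<lambda>y. ennreal (norm (g y))) x"
proof -
  let ?P = "\<lambda>x h. ennreal \<bar>u (x + h) - u x\<bar> \<le> ennreal (norm h) * (\<integral>\<^sup>+ t. ennreal (norm (g (x + t *\<^sub>R h))) * indicator {0..1} t \<partial>lborel)"
  have "AE x in lborel. ?P x h" for h
    using diff[of h]
  proof eventually_elim
    case (elim x)
    \<comment> \<open>If the integrand is not integrable, its Bochner integral is 0 by default and
      the bound is trivial.\<close>
    have "ennreal \<bar>u (x + h) - u x\<bar> \<le> (\<integral>\<^sup>+ t. norm ((g (x + t *\<^sub>R h) \<bullet> h) * indicator {0..1} t) \<partial>lborel)"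
      unfolding elim using integral_norm_bound_ennreal[of lborel "\<lambda>t. (g (x + t *\<^sub>R h) \<bullet> h) * indicator {0..1} t"]
      by (cases "integrable lborel (\<lambda>t. (g (x + t *\<^sub>R h) \<bullet> h) * indicator {0..1} t)") (auto simp: not_integrable_integral_eq)
    also have "\<dots> \<le> (\<integral>\<^sup>+ t. ennreal (norm h) * (ennreal (norm (g (x + t *\<^sub>R h))) * indicator {0..1} t) \<partial>lborel)"
    proof (rule nn_integral_mono)
      fix t :: real
      have "\<bar>g (x + t *\<^sub>R h) \<bullet> h\<bar> \<le> norm h * norm (g (x + t *\<^sub>R h))"
        using Cauchy_Schwarz_ineq2[of "g (x + t *\<^sub>R h)" h] by (simp add: mult.commute)
      then show "ennreal (norm ((g (x + t *\<^sub>R h) \<bullet> h) * indicator {0..1} t)) \<le> ennreal (norm h) * (ennreal (norm (g (x + t *\<^sub>R h))) * indicator {0..1} t)"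
        by (auto simp: indicator_def ennreal_leI simp flip: ennreal_mult)
    qed
    also have "\<dots> = ennreal (norm h) * (\<integral>\<^sup>+ t. ennreal (norm (g (x + t *\<^sub>R h))) * indicator {0..1} t \<partial>lborel)"
      by (rule nn_integral_cmult) simp
    finally show ?case .
  qed
  then have "AE h in lborel. AE x in lborel. ?P x h" by simp
  moreover have "{z \<in> space (lborel \<Otimes>\<^sub>M lborel). ?P (fst z) (snd z)} \<in> sets (lborel \<Otimes>\<^sub>M lborel)"
    by measurable
  ultimately have "AE x in lborel. AE h in lborel. ?P x h"
    by (subst lborel_pair.AE_commute)
  then show ?thesis
  proof eventually_elim
    case (elim x)
    then show ?case by (intro allI mean_osc_le) auto
  qed
qed

section \<open>Assembling the estimate\<close>

lemma slobodetskii_split: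
  fixes u :: "'a::euclidean_space \<Rightarrow> real"
  assumes [measurable]: "u \<in> borel_measurable borel"
  shows "(\<integral>\<^sup>+ x. \<integral>\<^sup>+ y. slobodetskii_kernel \<theta> q u x y \<partial>lborel \<partial>lborel) =
    slobodetskii_near r \<theta> q u +
    slobodetskii_far r \<theta> q u"
proof -
  have [measurable]: "(\<lambda>(x::'a, y). indicator (- ball x r) y :: ennreal) \<in> borel_measurable (borel \<Otimes>\<^sub>M borel)"
  proof -
    have "(\<lambda>z::'a \<times> 'a. 1 - indicator (ball (fst z) r) (snd z) :: ennreal) \<in> borel_measurable (borel \<Otimes>\<^sub>M borel)"
      by measurable
    moreover have "1 - indicator (ball x r) y = (indicator (- ball x r) y :: ennreal)" for x y :: 'a
      by (auto simp: indicator_def)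
    ultimately show ?thesis by (simp add: case_prod_unfold)
  qed
  have "slobodetskii_kernel \<theta> q u x y = slobodetskii_kernel \<theta> q u x y * indicator (ball x r) y + slobodetskii_kernel \<theta> q u x y * indicator (- ball x r) y" for x y
    by (auto simp: indicator_def)
  then have "(\<integral>\<^sup>+ x. \<integral>\<^sup>+ y. slobodetskii_kernel \<theta> q u x y \<partial>lborel \<partial>lborel) =
    (\<integral>\<^sup>+ x. \<integral>\<^sup>+ y. (slobodetskii_kernel \<theta> q u x y * indicator (ball x r) y + slobodetskii_kernel \<theta> q u x y * indicator (- ball x r) y) \<partial>lborel \<partial>lborel)"
    by (intro nn_integral_cong) simp
  also have "\<dots> = (\<integral>\<^sup>+ x. ((\<integral>\<^sup>+ y. slobodetskii_kernel \<theta> q u x y * indicator (ball x r) y \<partial>lborel) +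
      (\<integral>\<^sup>+ y. slobodetskii_kernel \<theta> q u x y * indicator (- ball x r) y \<partial>lborel)) \<partial>lborel)"
    by (intro nn_integral_cong nn_integral_add) measurable
  also have "\<dots> = slobodetskii_near r \<theta> q u +
    slobodetskii_far r \<theta> q u"
    by (intro nn_integral_add) measurable
  finally show ?thesis .
qed

lemma Lp_integral_representative:
  assumes "AE x in lborel. u x = u' x"
  shows "Lp_integral p u = (\<integral>\<^sup>+ x. ennreal (\<bar>u' x\<bar> powr p) \<partial>lborel)"
  unfolding Lp_integral_def nn_integral_completion
  by (rule nn_integral_cong_AE) (use assms in \<open>eventually_elim, simp\<close>)

lemma slobodetskii_integral_representative:
  fixes u u' :: "real^'n::finite \<Rightarrow> real"
  assumes u: "AE x in lborel. u x = u' x"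
  shows "slobodetskii_integral \<theta> q u = (\<integral>\<^sup>+ x. \<integral>\<^sup>+ y. slobodetskii_kernel \<theta> q u' x y \<partial>lborel \<partial>lborel)"
  unfolding slobodetskii_integral_def nn_integral_completion slobodetskii_kernel_def
proof (rule nn_integral_cong_AE)
  show "AE x in lborel. (\<integral>\<^sup>+ y. ennreal (\<bar>u x - u y\<bar> powr q / norm (x - y) powr (real CARD('n) + \<theta> * q)) \<partial>lborel) =
     (\<integral>\<^sup>+ y. ennreal (\<bar>u' x - u' y\<bar> powr q / norm (x - y) powr (real DIM(real^'n) + \<theta> * q)) \<partial>lborel)"
    using u
  proof eventually_elim
    case (elim x)
    show ?case by (rule nn_integral_cong_AE) (use u in eventually_elim, simp add: elim)
  qed
qed

text \<open>Stated for the square T of the Sobolev norm and the q-th power of the Slobodetskii norm,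
  so that everything stays with integrals; a q-th root gives the inequality of norms.\<close>

proposition slobodetskii_embedding:
  fixes S :: "(real^'n::finite) set" and k :: nat and \<gamma> q \<theta> :: real
  assumes S: "compact_lipschitz_submanifold k S" "S \<noteq> {}" and k: "1 \<le> k" "k \<le> CARD('n)"
    and \<gamma>: "0 \<le> \<gamma>" "\<gamma> < real k" and q: "2 \<le> q" and \<theta>: "0 < \<theta>" "\<theta> < 1"
    and ex: "1 - (real CARD('n) + \<gamma>) / 2 \<ge> \<theta> - real CARD('n) / q"
  obtains C where "0 \<le> C" "\<And>u T. \<lbrakk>u \<in> weighted_W12_space (dist_weight S \<gamma>); 0 \<le> T;
     Lp_integral 2 u + weighted_dirichlet_integral (dist_weight S \<gamma>) u = ennreal T\<rbrakk> \<Longrightarrow>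
     Lp_integral q u + slobodetskii_integral \<theta> q u \<le> ennreal (C * T powr (q / 2))"
proof -
  have q0: "0 < q" using q by simp
  obtain i0 K where K: "0 \<le> K" "\<And>f N. \<lbrakk>f \<in> borel_measurable borel; \<And>y. 0 \<le> f y; 0 \<le> N;
      (\<integral>\<^sup>+ y. ennreal ((f y)\<^sup>2 * dist_weight S \<gamma> y) \<partial>lborel) = ennreal N\<rbrakk> \<Longrightarrow>
      avg_energy \<theta> q i0 (\<lambda>y. ennreal (f y)) \<le> ennreal (K * N powr (q / 2)) \<and>
      (\<forall>i x. i0 \<le> i \<longrightarrow> ball_avg i (\<lambda>y. ennreal (f y)) x < \<infinity>)"
    by (rule weighted_energy[OF S k \<gamma> q \<theta>(2) ex]) blast
  obtain Kn where Kn: "0 \<le> Kn"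
    "\<And>(u :: real^'n \<Rightarrow> real) f i0. \<lbrakk>u \<in> borel_measurable borel; f \<in> borel_measurable borel;
      AE x in lborel. osc_controlled u f x;
      \<And>i z. i0 \<le> i \<Longrightarrow> ball_avg i f z < \<infinity>\<rbrakk> \<Longrightarrow>
     slobodetskii_near (dyadic i0) \<theta> q u \<le> ennreal Kn * avg_energy \<theta> q i0 f"
    by (rule near_energy[where 'a="real^'n", OF \<theta>(1) q0]) blast
  obtain Kf where Kf: "0 \<le> Kf"
    "\<And>u :: real^'n \<Rightarrow> real. u \<in> borel_measurable borel \<Longrightarrow>
     slobodetskii_far (dyadic i0) \<theta> q u \<le> ennreal Kf * (\<integral>\<^sup>+ x. ennreal (\<bar>u x\<bar> powr q) \<partial>lborel)"
    by (rule far_energy[where 'a="real^'n", OF \<theta>(1) q0 dyadic_simps(1)[of i0]]) blast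
  obtain Kl where Kl: "0 \<le> Kl"
    "\<And>(u :: real^'n \<Rightarrow> real) f N. \<lbrakk>u \<in> borel_measurable borel; f \<in> borel_measurable borel;
      AE x in lborel. osc_controlled u f x;
      \<And>i z. i0 \<le> i \<Longrightarrow> ball_avg i f z < \<infinity>; 0 \<le> N; (\<integral>\<^sup>+ x. ennreal (\<bar>u x\<bar>\<^sup>2) \<partial>lborel) = ennreal N\<rbrakk> \<Longrightarrow>
     (\<integral>\<^sup>+ x. ennreal (\<bar>u x\<bar> powr q) \<partial>lborel) \<le> ennreal Kl * (avg_energy \<theta> q i0 f + ennreal (N powr (q / 2)))"
    by (rule Lq_energy[where 'a="real^'n" and ?i0.0=i0, OF \<theta>(1) q]) blast
  define L where "L = Kl * (K + 1)"
  have L: "0 \<le> L" using Kl(1) K(1) by (simp add: L_def)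
  show thesis
  proof (rule that[of "L + (Kn * K + Kf * L)"])
    show "0 \<le> L + (Kn * K + Kf * L)" using L Kn(1) K(1) Kf(1) by simp
    fix u :: "real^'n \<Rightarrow> real" and T :: real
    assume u: "u \<in> weighted_W12_space (dist_weight S \<gamma>)" and T: "0 \<le> T"
      "Lp_integral 2 u + weighted_dirichlet_integral (dist_weight S \<gamma>) u = ennreal T"
    define g where "g = weak_gradient u"
    \<comment> \<open>Membership in the space guarantees that some weak gradient exists, so the
      chosen one is a weak gradient.\<close>
    have w: "has_weak_gradient u g"
      using u someI_ex[of "has_weak_gradient u"] by (auto simp: weighted_W12_space_def weak_gradient_def g_def)
    have "u \<in> borel_measurable lebesgue" using u by (simp add: weighted_W12_space_def Lp_space_def)
    from completion_ex_borel_measurable_real[OF this]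
    obtain u' where u': "u' \<in> borel_measurable borel" "AE x in lborel. u x = u' x" by auto
    have "g \<in> borel_measurable lebesgue"
      using w by (intro locally_integrable_measurable) (simp add: has_weak_gradient_def)
    then obtain g' where g': "g' \<in> borel_measurable borel" "AE x in lborel. g x = g' x"
      by (rule borel_representative)
    note [measurable] = u'(1) g'(1)
    let ?f = "\<lambda>y. norm (g' y)"
    have osc: "AE x in lborel. osc_controlled u' (\<lambda>y. ennreal (?f y)) x"
      by (rule mean_osc_le_of_difference[OF u'(1) g'(1) has_weak_gradient_difference[OF w u'(1) g'(1) u'(2) g'(2)]])
    have U: "(\<integral>\<^sup>+ x. ennreal (\<bar>u' x\<bar>\<^sup>2) \<partial>lborel) = Lp_integral 2 u"
      unfolding Lp_integral_representative[OF u'(2)] by (simp add: powr_numeral)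
    have N: "(\<integral>\<^sup>+ y. ennreal ((?f y)\<^sup>2 * dist_weight S \<gamma> y) \<partial>lborel) = weighted_dirichlet_integral (dist_weight S \<gamma>) u"
      unfolding weighted_dirichlet_integral_def nn_integral_completion g_def[symmetric]
      by (rule nn_integral_cong_AE) (use g'(2) in \<open>eventually_elim, simp\<close>)
    have "Lp_integral 2 u \<le> ennreal T" "weighted_dirichlet_integral (dist_weight S \<gamma>) u \<le> ennreal T"
      unfolding T(2)[symmetric] by (simp_all add: add_increasing add_increasing2)
    then obtain M N where M: "0 \<le> M" "Lp_integral 2 u = ennreal M" "M \<le> T"
      and N': "0 \<le> N" "weighted_dirichlet_integral (dist_weight S \<gamma>) u = ennreal N" "N \<le> T"
      using T(1) by (cases "Lp_integral 2 u"; cases "weighted_dirichlet_integral (dist_weight S \<gamma>) u") (auto simp: top_unique)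
    let ?T = "T powr (q / 2)"
    have MT: "M powr (q / 2) \<le> ?T" and NT: "N powr (q / 2) \<le> ?T"
      using M N' q by (auto intro!: powr_mono2)
    have E: "avg_energy \<theta> q i0 (\<lambda>y. ennreal (?f y)) \<le> ennreal (K * N powr (q / 2)) \<and>
      (\<forall>i x. i0 \<le> i \<longrightarrow> ball_mean i ?f x < \<infinity>)"
      by (rule K(2)) (use N N' in auto)
    then have fin: "\<And>i z. i0 \<le> i \<Longrightarrow> ball_mean i ?f z < \<infinity>" by blast
    have E: "avg_energy \<theta> q i0 (\<lambda>y. ennreal (?f y)) \<le> ennreal (K * ?T)"
      by (rule order_trans[OF conjunct1[OF E] ennreal_leI[OF mult_left_mono[OF NT K(1)]]])
    have Lq: "Lp_integral q u \<le> ennreal (L * ?T)"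
    proof -
      have "Lp_integral q u \<le> ennreal Kl * (avg_energy \<theta> q i0 (\<lambda>y. ennreal (?f y)) + ennreal (M powr (q / 2)))"
        unfolding Lp_integral_representative[OF u'(2)]
        by (rule Kl(2)[OF u'(1) _ osc fin M(1)]) (use U M in auto)
      also have "\<dots> \<le> ennreal Kl * (ennreal (K * ?T) + ennreal ?T)"
        using MT by (intro mult_left_mono add_mono E ennreal_leI) auto
      also have "\<dots> = ennreal (L * ?T)"
        using Kl(1) K(1) by (simp add: L_def algebra_simps flip: ennreal_mult ennreal_plus)
      finally show ?thesis .
    qed
    have "slobodetskii_integral \<theta> q u \<le> ennreal Kn * avg_energy \<theta> q i0 (\<lambda>y. ennreal (?f y)) + ennreal Kf * Lp_integral q u"
      unfolding slobodetskii_integral_representative[OF u'(2)] Lp_integral_representative[OF u'(2)]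
        slobodetskii_split[OF u'(1), of \<theta> q "dyadic i0"]
      by (intro add_mono Kn(2)[OF u'(1) _ osc fin] Kf(2) u'(1)) auto
    also have "\<dots> \<le> ennreal Kn * ennreal (K * ?T) + ennreal Kf * ennreal (L * ?T)"
      by (intro add_mono mult_left_mono E Lq) auto
    finally have "Lp_integral q u + slobodetskii_integral \<theta> q u \<le> ennreal (L * ?T) + (ennreal Kn * ennreal (K * ?T) + ennreal Kf * ennreal (L * ?T))"
      by (intro add_mono Lq)
    also have "\<dots> = ennreal ((L + (Kn * K + Kf * L)) * ?T)"
      using Kn(1) K(1) Kf(1) L by (simp add: algebra_simps flip: ennreal_mult ennreal_plus)
    finally show "Lp_integral q u + slobodetskii_integral \<theta> q u \<le> ennreal ((L + (Kn * K + Kf * L)) * ?T)" .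
  qed
qed

theorem proposition5p3:
  fixes \<Omega> S :: "(real^'n::finite) set" and k :: nat and \<gamma> q \<theta> :: real
  assumes "2 \<le> CARD('n)"
    and "open \<Omega>" and "connected \<Omega>" and "bounded \<Omega>" and "\<Omega> \<noteq> {}"
    and "1 \<le> k" and "k \<le> CARD('n)"
    and "compact_lipschitz_submanifold k S" and "S \<noteq> {}" and "S \<subseteq> closure \<Omega>"
    and "0 \<le> \<gamma>" and "\<gamma> < real k"
    and "2 \<le> q" and "0 < \<theta>" and "\<theta> < 1"
    and "1 - (real CARD('n) + \<gamma>) / 2 \<ge> \<theta> - real CARD('n) / q"
  shows "weighted_W12_space (dist_weight S \<gamma>) \<subseteq> slobodetskii_space \<theta> q \<and>
    (\<exists>C. \<forall>u\<in>weighted_W12_space (dist_weight S \<gamma>).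
       slobodetskii_norm \<theta> q u \<le> C * weighted_W12_norm (dist_weight S \<gamma>) u)"
proof -
  let ?X = "weighted_W12_space (dist_weight S \<gamma>)"
  obtain C where C: "0 \<le> C" "\<And>u T. \<lbrakk>u \<in> ?X; 0 \<le> T;
     Lp_integral 2 u + weighted_dirichlet_integral (dist_weight S \<gamma>) u = ennreal T\<rbrakk> \<Longrightarrow>
     Lp_integral q u + slobodetskii_integral \<theta> q u \<le> ennreal (C * T powr (q / 2))"
    by (rule slobodetskii_embedding[OF assms(8,9,6,7,11-16)]) blast
  have fin: "\<exists>T\<ge>0. Lp_integral 2 u + weighted_dirichlet_integral (dist_weight S \<gamma>) u = ennreal T" if "u \<in> ?X" for u
  proof -
    have "Lp_integral 2 u + weighted_dirichlet_integral (dist_weight S \<gamma>) u < top"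
      using that by (auto simp: weighted_W12_space_def Lp_space_def)
    then show ?thesis by (metis ennreal_cases order_less_irrefl)
  qed
  show ?thesis
  proof (intro conjI exI[of _ "C powr (1 / q)"] ballI subsetI)
    fix u assume u: "u \<in> ?X"
    obtain T where T: "0 \<le> T" "Lp_integral 2 u + weighted_dirichlet_integral (dist_weight S \<gamma>) u = ennreal T"
      using fin[OF u] by blast
    have le: "Lp_integral q u + slobodetskii_integral \<theta> q u \<le> ennreal (C * T powr (q / 2))"
      by (rule C(2)[OF u T])
    then have "Lp_integral q u + slobodetskii_integral \<theta> q u < top" by (rule le_less_trans) simp
    then show "u \<in> slobodetskii_space \<theta> q"
      using u by (simp add: slobodetskii_space_def weighted_W12_space_def Lp_space_def)
    have "enn2real (Lp_integral q u + slobodetskii_integral \<theta> q u) \<le> C * T powr (q / 2)"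
      using le C(1) by (intro enn2real_leI) auto
    then have "slobodetskii_norm \<theta> q u \<le> (C * T powr (q / 2)) powr (1 / q)"
      unfolding slobodetskii_norm_def using assms(13) by (intro powr_mono2) auto
    also have "\<dots> = C powr (1 / q) * sqrt T"
      using C(1) T(1) assms(13) by (simp add: powr_mult powr_powr powr_half_sqrt)
    also have "sqrt T = weighted_W12_norm (dist_weight S \<gamma>) u"
      using T by (simp add: weighted_W12_norm_def)
    finally show "slobodetskii_norm \<theta> q u \<le> C powr (1 / q) * weighted_W12_norm (dist_weight S \<gamma>) u" .
  qed
qed

end
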